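(* Let $F$ be a field of characteristic $0$ and $V$ an $F$-vector space with $\dim V=k<\infty$ (purely even, i.e. $V_1=0$). Let $\Omega\subseteq\mathbb{Y}$ be a nonempty filter containing the column $(1^{k+1})$, with corresponding algebra $A_\Omega=T(V)/I_\Omega$. Then the following are equivalent: (1) $A_\Omega$ satisfies a nontrivial polynomial identity; (2) $A_\Omega$ has polynomial rate of growth, i.e. there is a polynomial $p$ with $\dim A_\Omega(n)\le p(n)$ for all $n$; (3) there exists an integer $c>0$ such that $(c^2)=(c,c)\in\Omega$. Moreover, if $(c^2)\in\Omega$ then $A_\Omega$ satisfies the identity $[x_1,x_2][x_3,x_4]\cdots[x_{2m-1},x_{2m}]=0$ (hence also $[x,y]^m=0$), where $m=c(k-1)+1$.
   Context: $\mathbb{Y}$ is the set of all partitions with inclusion $\mu\subseteq\lambda$ iff $\mu_i\le\lambda_i$ for all $i$; a filter is an upward-closed subset. $T(V)=\bigoplus_nT^n(V)$, $T^n(V)=V^{\otimes n}$, with $S_n$ acting by place permutations; for $\lambda\vdash n$, $W_\lambda\subseteq T^n(V)$ is the isotypic component of the irreducible character $\chi^\lambda$ (so $T^n(V)=\bigoplus_{\lambda\vdash n,\ \lambda_{k+1}=0}W_\lambda$). $I_\Omega=\bigoplus_{\lambda\in\Omega}W_\lambda$ is a two-sided ideal, $A_\Omega=T(V)/I_\Omega$, and $A_\Omega(n)=T^n(V)/(I_\Omega\cap T^n(V))$. $[x,y]=xy-yx$. *)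

theory Defs
  imports
    "HOL-Library.Poly_Mapping"
    "HOL-Combinatorics.Permutations"
    "HOL-Computational_Algebra.Polynomial"
    "HOL-Algebra.QuotRing"
    "HOL-Algebra.Module"
    "HOL-Algebra.Algebraic_Closure_Type"
begin

text \<open>
  The ground field is a type \<open>'f\<close> of class \<^class>\<open>field_char_0\<close>. Vector spaces and
  (not necessarily commutative) algebras over it are \<^typ>\<open>('f, 'a) module\<close> records,
  with \<^const>\<open>ring_of_type_algebra\<close> as the record of the ground field.
\<close>

section \<open>Linear algebra\<close>

abbreviation subspace_of :: "'a set \<Rightarrow> ('f::field, 'a) module \<Rightarrow> bool" where
  "subspace_of U M \<equiv> submodule U (ring_of_type_algebra :: 'f ring) M"

definition lin_span :: "('f::field, 'a) module \<Rightarrow> 'a set \<Rightarrow> 'a set" where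
  "lin_span M S = \<Inter>{U. subspace_of U M \<and> S \<subseteq> U}"

definition is_basis :: "('f::field, 'a) module \<Rightarrow> 'a set \<Rightarrow> bool" where
  "is_basis M B \<longleftrightarrow> B \<subseteq> carrier M \<and> lin_span M B = carrier M
     \<and> (\<forall>b\<in>B. b \<notin> lin_span M (B - {b}))"

definition has_dim :: "('f::field, 'a) module \<Rightarrow> nat \<Rightarrow> bool" where
  "has_dim M d \<longleftrightarrow> (\<exists>B. finite B \<and> card B = d \<and> is_basis M B)"

text \<open>
  The quotient \<open>A/I\<close>: the library's factor ring together with the induced scalar
  multiplication. (Adding \<open>I\<close> matters only for \<open>c = 0\<close>, where \<open>{c \<odot> x | x \<in> C}\<close> is not
  a full coset.) When \<open>A\<close> is merely a vector space and \<open>I\<close> a subspace of it, the linear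
  part of the record is still the quotient space.
\<close>
definition quotient_algebra :: "('f, 'a) module \<Rightarrow> 'a set \<Rightarrow> ('f, 'a set) module" where
  "quotient_algebra A I = ring.extend (A Quot I)
     (module.fields (\<lambda>c C. \<Union>x\<in>C. I +>\<^bsub>A\<^esub> (c \<odot>\<^bsub>A\<^esub> x)))"

definition monoid_algebra :: "'g monoid \<Rightarrow> ('f::field, 'g \<Rightarrow>\<^sub>0 'f) module" where
  "monoid_algebra G =
     \<lparr> carrier = {a. Poly_Mapping.keys a \<subseteq> carrier G},
       monoid.mult = (\<lambda>a b. \<Sum>g\<in>Poly_Mapping.keys a. \<Sum>h\<in>Poly_Mapping.keys b.
          Poly_Mapping.single (g \<otimes>\<^bsub>G\<^esub> h) (Poly_Mapping.lookup a g * Poly_Mapping.lookup b h)),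
       one = Poly_Mapping.single \<one>\<^bsub>G\<^esub> 1,
       zero = 0,
       add = (+),
       module.smult = (\<lambda>c. Poly_Mapping.map ((*) c)) \<rparr>"

section \<open>Partitions\<close>

text \<open>
  A partition \<open>(\<mu>\<^sub>1, \<mu>\<^sub>2, \<dots>)\<close> is a function on \<^typ>\<open>nat\<close> with \<open>\<mu> i\<close> standing for
  \<open>\<mu>\<^sub>i\<^sub>+\<^sub>1\<close>; inclusion of partitions is the pointwise order \<open>\<le>\<close> of functions.
  Likewise tensor places and permuted points are \<open>{..<n}\<close>.
\<close>
definition partitions :: "(nat \<Rightarrow> nat) set" where
  "partitions = {\<mu>. antimono \<mu> \<and> finite {i. \<mu> i \<noteq> 0}}"

definition psize :: "(nat \<Rightarrow> nat) \<Rightarrow> nat" where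
  "psize \<mu> = (\<Sum>i | \<mu> i \<noteq> 0. \<mu> i)"

definition partition_filter :: "(nat \<Rightarrow> nat) set \<Rightarrow> bool" where
  "partition_filter \<Omega> \<longleftrightarrow> \<Omega> \<subseteq> partitions
     \<and> (\<forall>\<mu>\<in>\<Omega>. \<forall>\<nu>\<in>partitions. \<mu> \<le> \<nu> \<longrightarrow> \<nu> \<in> \<Omega>)"

text \<open>The partition \<open>(c\<^sup>r)\<close> with \<open>r\<close> parts equal to \<open>c\<close>.\<close>
definition rect :: "nat \<Rightarrow> nat \<Rightarrow> (nat \<Rightarrow> nat)" where
  "rect c r = (\<lambda>i. if i < r then c else 0)"

section \<open>The irreducible representations of the symmetric group\<close>

definition symgrp :: "nat \<Rightarrow> (nat \<Rightarrow> nat) monoid" where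
  "symgrp n = \<lparr> carrier = {\<sigma>. \<sigma> permutes {..<n}}, monoid.mult = (\<circ>), one = id \<rparr>"

text \<open>
  The tableau of shape \<open>\<mu>\<close> filled with \<open>0, 1, 2, \<dots>\<close> row by row; the cell in row \<open>i\<close>
  and column \<open>j\<close> exists iff \<open>j < \<mu> i\<close>.
\<close>
definition tableau :: "(nat \<Rightarrow> nat) \<Rightarrow> nat \<Rightarrow> nat \<Rightarrow> nat" where
  "tableau \<mu> i j = (\<Sum>i'<i. \<mu> i') + j"

definition row_group :: "(nat \<Rightarrow> nat) \<Rightarrow> (nat \<Rightarrow> nat) set" where
  "row_group \<mu> = {p. p permutes {..<psize \<mu>} \<and>
     (\<forall>i j. j < \<mu> i \<longrightarrow> (\<exists>j'. j' < \<mu> i \<and> p (tableau \<mu> i j) = tableau \<mu> i j'))}"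

definition column_group :: "(nat \<Rightarrow> nat) \<Rightarrow> (nat \<Rightarrow> nat) set" where
  "column_group \<mu> = {q. q permutes {..<psize \<mu>} \<and>
     (\<forall>i j. j < \<mu> i \<longrightarrow> (\<exists>i'. j < \<mu> i' \<and> q (tableau \<mu> i j) = tableau \<mu> i' j))}"

definition young_symmetrizer :: "(nat \<Rightarrow> nat) \<Rightarrow> (nat \<Rightarrow> nat) \<Rightarrow>\<^sub>0 'f::field" where
  "young_symmetrizer \<mu> = (\<Sum>p\<in>row_group \<mu>. \<Sum>q\<in>column_group \<mu>.
     Poly_Mapping.single (p \<circ> q) (of_int (sign q)))"

text \<open>
  The Specht module, i.e. the left ideal of the group algebra generated by the Young
  symmetrizer. It is irreducible and \<open>\<chi>\<^sup>\<mu>\<close> is its character; a single row gives the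
  trivial character and a single column the sign character.
\<close>
definition specht :: "(nat \<Rightarrow> nat) \<Rightarrow> ('f::field, (nat \<Rightarrow> nat) \<Rightarrow>\<^sub>0 'f) module" where
  "specht \<mu> = (let A = monoid_algebra (symgrp (psize \<mu>)) in
     A \<lparr> carrier := {a \<otimes>\<^bsub>A\<^esub> young_symmetrizer \<mu> | a. a \<in> carrier A} \<rparr>)"

definition specht_action ::
  "(nat \<Rightarrow> nat) \<Rightarrow> (nat \<Rightarrow> nat) \<Rightarrow> ((nat \<Rightarrow> nat) \<Rightarrow>\<^sub>0 'f::field) \<Rightarrow> ((nat \<Rightarrow> nat) \<Rightarrow>\<^sub>0 'f)" where
  "specht_action \<mu> \<sigma> a =
     Poly_Mapping.single \<sigma> 1 \<otimes>\<^bsub>monoid_algebra (symgrp (psize \<mu>))\<^esub> a"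

definition rep_isomorphic :: "'s set \<Rightarrow> ('f::field, 'a) module \<Rightarrow> ('s \<Rightarrow> 'a \<Rightarrow> 'a)
    \<Rightarrow> ('f, 'b) module \<Rightarrow> ('s \<Rightarrow> 'b \<Rightarrow> 'b) \<Rightarrow> bool" where
  "rep_isomorphic G M \<alpha> N \<beta> \<longleftrightarrow> (\<exists>\<phi>. bij_betw \<phi> (carrier M) (carrier N)
     \<and> (\<forall>x\<in>carrier M. \<forall>y\<in>carrier M. \<phi> (x \<oplus>\<^bsub>M\<^esub> y) = \<phi> x \<oplus>\<^bsub>N\<^esub> \<phi> y)
     \<and> (\<forall>c. \<forall>x\<in>carrier M. \<phi> (c \<odot>\<^bsub>M\<^esub> x) = c \<odot>\<^bsub>N\<^esub> \<phi> x)
     \<and> (\<forall>g\<in>G. \<forall>x\<in>carrier M. \<phi> (\<alpha> g x) = \<beta> g (\<phi> x)))"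

text \<open>The sum of all subrepresentations of \<open>M\<close> isomorphic to the irreducible \<open>N\<close>.\<close>
definition isotypic_component :: "'s set \<Rightarrow> ('f::field, 'a) module \<Rightarrow> ('s \<Rightarrow> 'a \<Rightarrow> 'a)
    \<Rightarrow> ('f, 'b) module \<Rightarrow> ('s \<Rightarrow> 'b \<Rightarrow> 'b) \<Rightarrow> 'a set" where
  "isotypic_component G M \<alpha> N \<beta> = lin_span M (\<Union>{U. subspace_of U M
     \<and> (\<forall>g\<in>G. \<forall>x\<in>U. \<alpha> g x \<in> U) \<and> rep_isomorphic G (M \<lparr> carrier := U \<rparr>) \<alpha> N \<beta>})"

section \<open>The tensor algebra\<close>

definition free_algebra :: "('f::field, 'x list \<Rightarrow>\<^sub>0 'f) module" where
  "free_algebra = monoid_algebra \<lparr> carrier = UNIV, monoid.mult = (@), one = [] \<rparr>"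

definition homogeneous :: "nat \<Rightarrow> ('x list \<Rightarrow>\<^sub>0 'f::field) set" where
  "homogeneous n = {a. \<forall>w\<in>Poly_Mapping.keys a. length w = n}"

text \<open>
  \<open>V\<close> is the type \<open>'v\<close> with scalar multiplication \<open>s\<close>. Its tensor algebra is the free
  algebra on the set \<open>V\<close> modulo the ideal making the generators depend linearly on the
  elements of \<open>V\<close>; the class of the word \<open>[v\<^sub>1, \<dots>, v\<^sub>n]\<close> is the tensor \<open>v\<^sub>1 \<otimes> \<dots> \<otimes> v\<^sub>n\<close>.
\<close>
definition tensor_relations ::
  "('f::field \<Rightarrow> 'v::ab_group_add \<Rightarrow> 'v) \<Rightarrow> ('v list \<Rightarrow>\<^sub>0 'f) set" where
  "tensor_relations s = Idl\<^bsub>free_algebra\<^esub>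
     ({Poly_Mapping.single [v + w] 1 - Poly_Mapping.single [v] 1 - Poly_Mapping.single [w] 1 | v w. True}
      \<union> {Poly_Mapping.single [s c v] 1 - Poly_Mapping.single [v] c | c v. True})"

definition tensor_algebra ::
  "('f::field \<Rightarrow> 'v::ab_group_add \<Rightarrow> 'v) \<Rightarrow> ('f, ('v list \<Rightarrow>\<^sub>0 'f) set) module" where
  "tensor_algebra s = quotient_algebra free_algebra (tensor_relations s)"

definition tensor_power ::
  "('f::field \<Rightarrow> 'v::ab_group_add \<Rightarrow> 'v) \<Rightarrow> nat \<Rightarrow> ('f, ('v list \<Rightarrow>\<^sub>0 'f) set) module" where
  "tensor_power s n = (tensor_algebra s)
     \<lparr> carrier := (\<lambda>a. tensor_relations s +>\<^bsub>free_algebra\<^esub> a) ` homogeneous n \<rparr>"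

text \<open>
  \<open>\<sigma> (v\<^sub>1 \<otimes> \<dots> \<otimes> v\<^sub>n) = u\<^sub>1 \<otimes> \<dots> \<otimes> u\<^sub>n\<close> with \<open>u\<^sub>i = v\<^sub>j\<close> for \<open>j = \<sigma>\<inverse>(i)\<close>, extended linearly. An
  element of the tensor power is a coset, which also contains inhomogeneous elements of
  the free algebra; the action is computed on its homogeneous representatives.
\<close>
definition place_action ::
  "('f::field \<Rightarrow> 'v::ab_group_add \<Rightarrow> 'v) \<Rightarrow> nat \<Rightarrow> (nat \<Rightarrow> nat)
     \<Rightarrow> ('v list \<Rightarrow>\<^sub>0 'f) set \<Rightarrow> ('v list \<Rightarrow>\<^sub>0 'f) set" where
  "place_action s n \<sigma> C = (\<Union>a \<in> C \<inter> homogeneous n. tensor_relations s +>\<^bsub>free_algebra\<^esub>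
     (\<Sum>w\<in>Poly_Mapping.keys a.
        Poly_Mapping.single (permute_list (inv_into UNIV \<sigma>) w) (Poly_Mapping.lookup a w)))"

section \<open>The algebras \<open>A\<^sub>\<Omega>\<close>\<close>

definition W_comp :: "('f::field \<Rightarrow> 'v::ab_group_add \<Rightarrow> 'v) \<Rightarrow> (nat \<Rightarrow> nat)
    \<Rightarrow> ('v list \<Rightarrow>\<^sub>0 'f) set set" where
  "W_comp s \<mu> = isotypic_component (carrier (symgrp (psize \<mu>)))
     (tensor_power s (psize \<mu>)) (place_action s (psize \<mu>))
     (specht \<mu>) (specht_action \<mu>)"

definition I_ideal :: "('f::field \<Rightarrow> 'v::ab_group_add \<Rightarrow> 'v) \<Rightarrow> (nat \<Rightarrow> nat) set
    \<Rightarrow> ('v list \<Rightarrow>\<^sub>0 'f) set set" where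
  "I_ideal s \<Omega> = lin_span (tensor_algebra s) (\<Union>\<mu>\<in>\<Omega>. W_comp s \<mu>)"

definition A_alg :: "('f::field \<Rightarrow> 'v::ab_group_add \<Rightarrow> 'v) \<Rightarrow> (nat \<Rightarrow> nat) set
    \<Rightarrow> ('f, ('v list \<Rightarrow>\<^sub>0 'f) set set) module" where
  "A_alg s \<Omega> = quotient_algebra (tensor_algebra s) (I_ideal s \<Omega>)"

definition A_comp :: "('f::field \<Rightarrow> 'v::ab_group_add \<Rightarrow> 'v) \<Rightarrow> (nat \<Rightarrow> nat) set \<Rightarrow> nat
    \<Rightarrow> ('f, ('v list \<Rightarrow>\<^sub>0 'f) set set) module" where
  "A_comp s \<Omega> n = quotient_algebra (tensor_power s n)
     (I_ideal s \<Omega> \<inter> carrier (tensor_power s n))"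

definition polynomial_growth :: "('f::field \<Rightarrow> 'v::ab_group_add \<Rightarrow> 'v) \<Rightarrow> (nat \<Rightarrow> nat) set \<Rightarrow> bool" where
  "polynomial_growth s \<Omega> \<longleftrightarrow>
     (\<exists>p :: real poly. \<forall>n. \<exists>d. has_dim (A_comp s \<Omega> n) d \<and> real d \<le> poly p (real n))"

section \<open>Polynomial identities\<close>

definition word_value :: "('f, 'a) module \<Rightarrow> (nat \<Rightarrow> 'a) \<Rightarrow> nat list \<Rightarrow> 'a" where
  "word_value A x w = foldr (\<lambda>i y. x i \<otimes>\<^bsub>A\<^esub> y) w \<one>\<^bsub>A\<^esub>"

text \<open>Polynomials in the noncommuting variables \<open>x\<^sub>0, x\<^sub>1, \<dots>\<close> are elements of the free algebra on \<^typ>\<open>nat\<close>.\<close>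
definition eval_poly :: "('f::field, 'a) module \<Rightarrow> (nat \<Rightarrow> 'a) \<Rightarrow> (nat list \<Rightarrow>\<^sub>0 'f) \<Rightarrow> 'a" where
  "eval_poly A x f =
     (\<Oplus>\<^bsub>A\<^esub>w\<in>Poly_Mapping.keys f. Poly_Mapping.lookup f w \<odot>\<^bsub>A\<^esub> word_value A x w)"

definition satisfies_identity :: "('f::field, 'a) module \<Rightarrow> (nat list \<Rightarrow>\<^sub>0 'f) \<Rightarrow> bool" where
  "satisfies_identity A f \<longleftrightarrow>
     (\<forall>x. (\<forall>i. x i \<in> carrier A) \<longrightarrow> eval_poly A x f = \<zero>\<^bsub>A\<^esub>)"

definition PI_algebra :: "('f::field, 'a) module \<Rightarrow> bool" where
  "PI_algebra A \<longleftrightarrow> (\<exists>f. f \<noteq> 0 \<and> satisfies_identity A f)"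

definition commutator :: "('f, 'a) module \<Rightarrow> 'a \<Rightarrow> 'a \<Rightarrow> 'a" where
  "commutator A x y = (x \<otimes>\<^bsub>A\<^esub> y) \<ominus>\<^bsub>A\<^esub> (y \<otimes>\<^bsub>A\<^esub> x)"

text \<open>\<open>[x\<^sub>1, x\<^sub>2] [x\<^sub>3, x\<^sub>4] \<dots> [x\<^sub>2\<^sub>m\<^sub>-\<^sub>1, x\<^sub>2\<^sub>m]\<close>\<close>
definition commutator_product :: "('f, 'a) module \<Rightarrow> (nat \<Rightarrow> 'a) \<Rightarrow> nat \<Rightarrow> 'a" where
  "commutator_product A x m =
     foldr (\<lambda>i y. commutator A (x (2 * i + 1)) (x (2 * i + 2)) \<otimes>\<^bsub>A\<^esub> y) [0..<m] \<one>\<^bsub>A\<^esub>"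

end

theory Submission
  imports Defs
begin

text \<open>
  Tensors are handled through their coordinates on words. The sum \<open>z\<^sub>\<mu>\<close> of the conjugates of the Young
  symmetrizer is central, satisfies \<open>z\<^sub>\<mu> z\<^sub>\<mu> = c z\<^sub>\<mu>\<close> with \<open>c \<noteq> 0\<close>, and \<open>W\<^sub>\<mu>\<close> is its eigenspace for \<open>c\<close>.
  A weight vector killed by the raising operators of \<open>gl\<close> is a combination of polytabloids, because
  its leading word is a Yamanouchi word. Since the operators \<open>z\<^sub>\<mu>\<close> commute with raising operators, looking at
  highest weight vectors gives both \<open>\<Sum>\<^sub>\<mu> c\<inverse> z\<^sub>\<mu> = 1\<close> and \<open>z\<^sub>\<nu> z\<^sub>\<mu> = 0\<close> whenever \<open>|\<mu>| = |\<nu>| + 1\<close> and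
  \<open>\<nu> \<subseteq> \<mu>\<close> fails. Hence \<open>I\<^sub>\<Omega>\<close> is an ideal, and a tensor lies in it iff all \<open>z\<^sub>\<mu>\<close> with \<open>\<mu> \<notin> \<Omega>\<close> kill it.

  A tensor that is skew in \<open>m\<close> disjoint pairs of places is killed by \<open>z\<^sub>\<mu>\<close> unless \<open>\<mu>\<close> has at least \<open>m\<close> cells
  below its first row. With at most \<open>k\<close> rows and \<open>m = c (k - 1) + 1\<close> this forces \<open>\<mu>\<close> to contain \<open>(c, c)\<close>, so
  every product of \<open>m\<close> commutators lies in \<open>I\<^sub>\<Omega>\<close>. Modulo such products a word with \<open>m\<close> disjoint adjacent
  descents is a combination of smaller words, and only polynomially many words remain. If \<open>\<Omega>\<close> contains no
  \<open>(c, c)\<close>, all its members have at least three rows; then \<open>I\<^sub>\<Omega>\<close> has no coordinates on words in two letters,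
  so \<open>A\<^sub>\<Omega>\<close> maps onto a free algebra of rank two.
\<close>

section \<open>Tableaux\<close>

text \<open>\<open>W_comp\<close> is given by isomorphic copies of a Specht module. That description
  shows neither that the components exhaust a tensor power nor how they behave when a letter is
  multiplied on. Eigenvalue equations of operators do show it, and they need neither complete
  reducibility nor a dimension count: a failure of completeness or of branching would produce a
  nonzero space of functions stable under the raising operators, hence a highest weight vector, on
  which the central operators act by known scalars. The alphabet is all of the natural numbers, so
  that this part of the argument is independent of \<open>k\<close>; tensors over \<open>V\<close>
  are the functions supported on the letters below \<open>k\<close>, and operators from the
  symmetric group preserve this support. The scalar \<open>c\<close> is nonzero by positivity of a
  sum of squares, which in a field without order has to be transported to the integers.\<close>

definition cells :: "(nat \<Rightarrow> nat) \<Rightarrow> (nat \<times> nat) set" where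
  "cells \<mu> = {(i, j). j < \<mu> i}"

text \<open>The numbering \<open>tableau\<close> repeats values outside the diagram, hence the
  inverse over \<open>cells\<close>. Besides giving a coordinate, \<open>row_of \<mu>\<close> is
  used as a word: the word of content \<mu> with the letter i at the places of row i.\<close>

definition row_of :: "(nat \<Rightarrow> nat) \<Rightarrow> nat \<Rightarrow> nat" where
  "row_of \<mu> x = fst (inv_into (cells \<mu>) (\<lambda>(i, j). tableau \<mu> i j) x)"

definition col_of :: "(nat \<Rightarrow> nat) \<Rightarrow> nat \<Rightarrow> nat" where
  "col_of \<mu> x = snd (inv_into (cells \<mu>) (\<lambda>(i, j). tableau \<mu> i j) x)"

lemma partitions_antimono: "\<mu> \<in> partitions \<Longrightarrow> i \<le> j \<Longrightarrow> \<mu> j \<le> \<mu> i"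
  by (auto simp: partitions_def antimono_def)

lemma partitions_bound:
  assumes "\<mu> \<in> partitions"
  obtains N where "\<And>i. i \<ge> N \<Longrightarrow> \<mu> i = 0"
proof -
  obtain N where "\<forall>i\<in>{i. \<mu> i \<noteq> 0}. i < N"
    using assms finite_nat_set_iff_bounded[of "{i. \<mu> i \<noteq> 0}"] unfolding partitions_def by auto
  then show ?thesis using that[of N] by (metis leD mem_Collect_eq)
qed

lemma psize_eq_sum:
  assumes "\<And>i. i \<ge> N \<Longrightarrow> \<mu> i = 0"
  shows "psize \<mu> = (\<Sum>i<N. \<mu> i)"
  unfolding psize_def
  by (rule sum.mono_neutral_left) (use assms in \<open>auto intro: ccontr\<close>)

lemma tableau_less_next_row:
  assumes "j < \<mu> i" "i < i'" shows "tableau \<mu> i j < tableau \<mu> i' j'"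
proof -
  have "(\<Sum>l<i. \<mu> l) + j < (\<Sum>l<Suc i. \<mu> l)" using assms by simp
  also have "\<dots> \<le> (\<Sum>l<i'. \<mu> l)" by (rule sum_mono2) (use assms in auto)
  finally show ?thesis by (simp add: tableau_def)
qed

lemma inj_on_tableau: "inj_on (\<lambda>(i, j). tableau \<mu> i j) (cells \<mu>)"
proof (rule inj_onI, clarify)
  fix i j i' j' assume a: "(i, j) \<in> cells \<mu>" "(i', j') \<in> cells \<mu>" "tableau \<mu> i j = tableau \<mu> i' j'"
  have "i = i'"
    using tableau_less_next_row[of j \<mu> i i' j'] tableau_less_next_row[of j' \<mu> i' i j] a
    by (auto simp: cells_def not_less_iff_gr_or_eq[symmetric] intro: linorder_cases[of i i'])
  then show "i = i' \<and> j = j'" using a by (simp add: tableau_def)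
qed

lemma tableau_image:
  assumes "\<mu> \<in> partitions"
  shows "(\<lambda>(i, j). tableau \<mu> i j) ` cells \<mu> = {..<psize \<mu>}"
proof -
  obtain N where N: "\<And>i. i \<ge> N \<Longrightarrow> \<mu> i = 0" using partitions_bound[OF assms] by blast
  have ps: "psize \<mu> = (\<Sum>i<N. \<mu> i)" by (rule psize_eq_sum) (rule N)
  have "\<exists>i j. j < \<mu> i \<and> tableau \<mu> i j = x" if "x < (\<Sum>i<M. \<mu> i)" for x M
    using that
  proof (induction M)
    case (Suc M)
    show ?case
    proof (cases "x < (\<Sum>i<M. \<mu> i)")
      case False
      then have "x - (\<Sum>i<M. \<mu> i) < \<mu> M" "tableau \<mu> M (x - (\<Sum>i<M. \<mu> i)) = x"
        using Suc.prems by (auto simp: tableau_def)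
      then show ?thesis by blast
    qed (use Suc in auto)
  qed simp
  moreover have "tableau \<mu> i j < psize \<mu>" if "j < \<mu> i" for i j
  proof -
    have "i < N" using N[of i] that by (cases "i < N") auto
    then show ?thesis using tableau_less_next_row[of j \<mu> i N 0] that by (simp add: tableau_def ps)
  qed
  ultimately show ?thesis using ps by (fastforce simp: cells_def)
qed

lemma tableau_less: "\<mu> \<in> partitions \<Longrightarrow> j < \<mu> i \<Longrightarrow> tableau \<mu> i j < psize \<mu>"
  using tableau_image[of \<mu>] by (fastforce simp: cells_def)

lemma row_col_tableau:
  assumes "j < \<mu> i"
  shows row_of_tableau: "row_of \<mu> (tableau \<mu> i j) = i" and col_of_tableau: "col_of \<mu> (tableau \<mu> i j) = j"
proof -
  have "inv_into (cells \<mu>) (\<lambda>(i, j). tableau \<mu> i j) (tableau \<mu> i j) = (i, j)"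
    using inv_into_f_f[OF inj_on_tableau[of \<mu>], of "(i, j)"] assms by (simp add: cells_def)
  then show "row_of \<mu> (tableau \<mu> i j) = i" "col_of \<mu> (tableau \<mu> i j) = j"
    by (simp_all add: row_of_def col_of_def)
qed

lemma tableau_row_col:
  assumes "\<mu> \<in> partitions" "x < psize \<mu>"
  shows col_of_less: "col_of \<mu> x < \<mu> (row_of \<mu> x)"
    and tableau_row_of_col_of: "tableau \<mu> (row_of \<mu> x) (col_of \<mu> x) = x"
proof -
  obtain i j where ij: "j < \<mu> i" "x = tableau \<mu> i j"
    using tableau_image[OF assms(1)] assms(2) unfolding cells_def
    by (smt (verit) case_prodE imageE lessThan_iff mem_Collect_eq old.prod.case)
  then show "col_of \<mu> x < \<mu> (row_of \<mu> x)" "tableau \<mu> (row_of \<mu> x) (col_of \<mu> x) = x"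
    by (simp_all add: row_col_tableau)
qed

lemma row_col_inj:
  assumes "\<mu> \<in> partitions" "x < psize \<mu>" "y < psize \<mu>" "row_of \<mu> x = row_of \<mu> y" "col_of \<mu> x = col_of \<mu> y"
  shows "x = y"
  using assms by (metis tableau_row_of_col_of)

text \<open>In this form closure under composition and inverses is immediate, and membership of a
  transposition is an equality of row numbers.\<close>

lemma row_group_eq:
  assumes "\<mu> \<in> partitions"
  shows "row_group \<mu> = {p. p permutes {..<psize \<mu>} \<and> (\<forall>x<psize \<mu>. row_of \<mu> (p x) = row_of \<mu> x)}"
proof -
  have "(\<forall>i j. j < \<mu> i \<longrightarrow> (\<exists>j'. j' < \<mu> i \<and> p (tableau \<mu> i j) = tableau \<mu> i j')) \<longleftrightarrow>
    (\<forall>x<psize \<mu>. row_of \<mu> (p x) = row_of \<mu> x)" if p: "p permutes {..<psize \<mu>}" for p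
  proof safe
    fix x assume h: "\<forall>i j. j < \<mu> i \<longrightarrow> (\<exists>j'. j' < \<mu> i \<and> p (tableau \<mu> i j) = tableau \<mu> i j')" "x < psize \<mu>"
    then show "row_of \<mu> (p x) = row_of \<mu> x"
      using col_of_less[OF assms h(2)] tableau_row_of_col_of[OF assms h(2)] by (metis row_of_tableau)
  next
    fix i j assume h: "\<forall>x<psize \<mu>. row_of \<mu> (p x) = row_of \<mu> x" "j < \<mu> i"
    have "p (tableau \<mu> i j) < psize \<mu>" using tableau_less[OF assms h(2)] permutes_in_image[OF p] by auto
    then show "\<exists>j'<\<mu> i. p (tableau \<mu> i j) = tableau \<mu> i j'"
      using h tableau_less[OF assms h(2)] tableau_row_col[OF assms] by (metis row_of_tableau)
  qed
  then show ?thesis by (auto simp: row_group_def)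
qed

lemma column_group_eq:
  assumes "\<mu> \<in> partitions"
  shows "column_group \<mu> = {p. p permutes {..<psize \<mu>} \<and> (\<forall>x<psize \<mu>. col_of \<mu> (p x) = col_of \<mu> x)}"
proof -
  have "(\<forall>i j. j < \<mu> i \<longrightarrow> (\<exists>i'. j < \<mu> i' \<and> p (tableau \<mu> i j) = tableau \<mu> i' j)) \<longleftrightarrow>
    (\<forall>x<psize \<mu>. col_of \<mu> (p x) = col_of \<mu> x)" if p: "p permutes {..<psize \<mu>}" for p
  proof safe
    fix x assume h: "\<forall>i j. j < \<mu> i \<longrightarrow> (\<exists>i'. j < \<mu> i' \<and> p (tableau \<mu> i j) = tableau \<mu> i' j)" "x < psize \<mu>"
    then show "col_of \<mu> (p x) = col_of \<mu> x"
      using col_of_less[OF assms h(2)] tableau_row_of_col_of[OF assms h(2)] by (metis col_of_tableau)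
  next
    fix i j assume h: "\<forall>x<psize \<mu>. col_of \<mu> (p x) = col_of \<mu> x" "j < \<mu> i"
    have "p (tableau \<mu> i j) < psize \<mu>" using tableau_less[OF assms h(2)] permutes_in_image[OF p] by auto
    then show "\<exists>i'. j < \<mu> i' \<and> p (tableau \<mu> i j) = tableau \<mu> i' j"
      using h tableau_less[OF assms h(2)] tableau_row_col[OF assms] by (metis col_of_tableau)
  qed
  then show ?thesis by (auto simp: column_group_def)
qed

lemma card_row:
  assumes "\<mu> \<in> partitions"
  shows "card {x. x < psize \<mu> \<and> row_of \<mu> x = l} = \<mu> l"
proof -
  have "bij_betw (tableau \<mu> l) {..<\<mu> l} {x. x < psize \<mu> \<and> row_of \<mu> x = l}"
    by (rule bij_betw_byWitness[where f' = "col_of \<mu>"])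
       (use assms in \<open>auto simp: row_col_tableau tableau_less dest: tableau_row_of_col_of col_of_less\<close>)
  then show ?thesis by (metis bij_betw_same_card card_lessThan)
qed

section \<open>Words separating the columns of a tableau\<close>

text \<open>The filling \<open>v\<close> repeats no letter within a column. It will be the row
  number of a place in a second, permuted tableau, which makes the results below the combinatorial
  core of the theory of Young symmetrizers.\<close>

locale column_separating =
  fixes \<mu> v :: "nat \<Rightarrow> nat"
  assumes part: "\<mu> \<in> partitions"
    and sep: "\<And>x y. x < psize \<mu> \<Longrightarrow> y < psize \<mu> \<Longrightarrow> col_of \<mu> x = col_of \<mu> y \<Longrightarrow> v x = v y \<Longrightarrow> x = y"
begin

text \<open>The letters before \<open>l\<close> have the largest possible multiplicities and so, by
  induction, occupy all columns allowed to them. A letter \<open>l\<close> in a column j \<ge> \<mu>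
  l would meet there all letters i with \<mu> i > j. These are already as many as the cells of that
  column, so there is no room.\<close>

lemma col_of_image_subset:
  assumes "\<And>l'. l' < l \<Longrightarrow> card {x. x < psize \<mu> \<and> v x = l'} = \<mu> l'"
  shows "col_of \<mu> ` {x. x < psize \<mu> \<and> v x = l} \<subseteq> {..<\<mu> l}"
  using assms
proof (induction l rule: less_induct)
  case (less l)
  have img: "col_of \<mu> ` {x. x < psize \<mu> \<and> v x = l'} = {..<\<mu> l'}" if "l' < l" for l'
  proof (rule card_subset_eq)
    show "col_of \<mu> ` {x. x < psize \<mu> \<and> v x = l'} \<subseteq> {..<\<mu> l'}"
      by (rule less.IH[OF that]) (use that less.prems in auto)
    have "inj_on (col_of \<mu>) {x. x < psize \<mu> \<and> v x = l'}" by (rule inj_onI) (auto intro: sep)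
    then show "card (col_of \<mu> ` {x. x < psize \<mu> \<and> v x = l'}) = card {..<\<mu> l'}"
      using less.prems[OF that] by (simp add: card_image)
  qed simp
  show ?case
  proof (rule ccontr)
    assume "\<not> ?thesis"
    then obtain x where x: "x < psize \<mu>" "v x = l" "\<mu> l \<le> col_of \<mu> x" by fastforce
    define C where "C = {y. y < psize \<mu> \<and> col_of \<mu> y = col_of \<mu> x}"
    define R where "R = {i. col_of \<mu> x < \<mu> i}"
    have Rl: "R \<subseteq> {..<l}" using x partitions_antimono[OF part, of l]
      by (auto simp: R_def not_le[symmetric]) (meson leD le_trans)
    have finR: "finite R" using Rl finite_subset by blast
    have "inj_on (row_of \<mu>) C" by (rule inj_onI) (auto simp: C_def intro: row_col_inj[OF part])
    moreover have "row_of \<mu> ` C \<subseteq> R" by (auto simp: C_def R_def) (metis col_of_less part)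
    ultimately have cC: "card C \<le> card R" using finR card_inj_on_le by blast
    \<comment> \<open>Each \<open>i\<close> in \<open>R\<close> is smaller than \<open>l\<close>, so
      \<open>img\<close> lists its columns completely, and the column of \<open>x\<close> is among
      them.\<close>
    have "insert l R \<subseteq> v ` C"
    proof (clarsimp, intro conjI subsetI)
      show "l \<in> v ` C" using x by (auto simp: C_def)
      fix i assume i: "i \<in> R"
      then have "col_of \<mu> x \<in> col_of \<mu> ` {y. y < psize \<mu> \<and> v y = i}"
        using img[of i] Rl by (auto simp: R_def)
      then show "i \<in> v ` C" by (auto simp: C_def)
    qed
    moreover have "finite C" by (simp add: C_def)
    ultimately have "card (insert l R) \<le> card C" by (meson card_image_le card_mono finite_imageI le_trans)
    moreover have "l \<notin> R" using Rl by auto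
    ultimately show False using cC finR by simp
  qed
qed

lemma inj_col_of: "inj_on (col_of \<mu>) {x. x < psize \<mu> \<and> v x = l}"
  by (rule inj_onI) (auto intro: sep)

text \<open>The lexicographic shadow of the dominance order: the first multiplicity that differs
  from \<mu> is smaller than that of \<mu>.\<close>

lemma content_le:
  assumes "\<And>l'. l' < l \<Longrightarrow> card {x. x < psize \<mu> \<and> v x = l'} = \<mu> l'"
  shows "card {x. x < psize \<mu> \<and> v x = l} \<le> \<mu> l"
  using card_inj_on_le[OF inj_col_of col_of_image_subset[OF assms]] by simp

text \<open>Every place moves inside its column to the row named by its letter. The target cell
  exists by \<open>col_of_image_subset\<close>, and separation makes the move injective.\<close>

lemma exists_column_perm:
  assumes "\<And>l. card {x. x < psize \<mu> \<and> v x = l} = \<mu> l"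
  obtains q where "q \<in> column_group \<mu>" "\<And>x. x < psize \<mu> \<Longrightarrow> row_of \<mu> (q x) = v x"
proof -
  define q where "q x = (if x < psize \<mu> then tableau \<mu> (v x) (col_of \<mu> x) else x)" for x
  have c: "col_of \<mu> x < \<mu> (v x)" if "x < psize \<mu>" for x
    using col_of_image_subset[of "v x"] assms that by auto
  have inj: "inj_on q {..<psize \<mu>}"
  proof (rule inj_onI, simp)
    fix x y assume xy: "x < psize \<mu>" "y < psize \<mu>" "q x = q y"
    then have "v x = v y \<and> col_of \<mu> x = col_of \<mu> y"
      using c by (auto simp: q_def) (metis row_of_tableau, metis col_of_tableau)
    then show "x = y" using xy sep by auto
  qed
  have "q ` {..<psize \<mu>} \<subseteq> {..<psize \<mu>}"
    using c part by (auto simp: q_def tableau_less)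
  then have "bij_betw q {..<psize \<mu>} {..<psize \<mu>}"
    using inj by (simp add: bij_betw_def endo_inj_surj)
  then have "q permutes {..<psize \<mu>}" by (rule bij_imp_permutes) (simp add: q_def)
  then have "q \<in> column_group \<mu>"
    by (auto simp: column_group_eq part q_def col_of_tableau c)
  moreover have "row_of \<mu> (q x) = v x" if "x < psize \<mu>" for x
    using that c by (simp add: q_def row_of_tableau)
  ultimately show ?thesis using that by blast
qed

end

section \<open>Permutation operators\<close>

abbreviation pinv :: "(nat \<Rightarrow> nat) \<Rightarrow> nat \<Rightarrow> nat" where
  "pinv \<equiv> inv_into UNIV"

definition perms :: "nat \<Rightarrow> (nat \<Rightarrow> nat) set" where
  "perms n = {\<sigma>. \<sigma> permutes {..<n}}"

text \<open>A function on words \<open>u\<close> (of which only the letters \<open>u 0, \<dots>, u (n - 1)\<close> matter) represents a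
  tensor by its coordinates; this is the action by place permutations.\<close>
definition act :: "(nat \<Rightarrow> nat) \<Rightarrow> ((nat \<Rightarrow> nat) \<Rightarrow> 'f) \<Rightarrow> (nat \<Rightarrow> nat) \<Rightarrow> 'f" where
  "act \<sigma> f = (\<lambda>u. f (u \<circ> \<sigma>))"

text \<open>These are the operators of the elements of the group algebra. Existential coefficients
  allow sums and compositions without computing in that algebra.\<close>

definition group_op :: "nat \<Rightarrow> (((nat \<Rightarrow> nat) \<Rightarrow> 'f::comm_ring_1) \<Rightarrow> (nat \<Rightarrow> nat) \<Rightarrow> 'f) \<Rightarrow> bool" where
  "group_op n T \<longleftrightarrow> (\<exists>a. \<forall>f u. T f u = (\<Sum>\<sigma>\<in>perms n. a \<sigma> * f (u \<circ> \<sigma>)))"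

definition perm_group :: "nat \<Rightarrow> (nat \<Rightarrow> nat) set \<Rightarrow> bool" where
  "perm_group n G \<longleftrightarrow> G \<subseteq> perms n \<and> id \<in> G \<and> (\<forall>p\<in>G. \<forall>q\<in>G. p \<circ> q \<in> G) \<and> (\<forall>p\<in>G. pinv p \<in> G)"

lemma act_act: "act \<sigma> (act \<tau> f) = act (\<sigma> \<circ> \<tau>) f"
  by (simp add: act_def comp_assoc)

lemma act_id [simp]: "act id f = f"
  by (simp add: act_def)

lemma finite_perms [simp]: "finite (perms n)"
  unfolding perms_def by (rule finite_permutations) simp

lemma perm_group_perms: "perm_group n (perms n)"
  by (auto simp: perm_group_def perms_def permutes_id permutes_compose permutes_inv)

lemma perms_comp: "\<sigma> \<in> perms n \<Longrightarrow> \<tau> \<in> perms n \<Longrightarrow> \<sigma> \<circ> \<tau> \<in> perms n"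
  and perms_inv: "\<sigma> \<in> perms n \<Longrightarrow> pinv \<sigma> \<in> perms n"
  and perms_id: "id \<in> perms n"
  using perm_group_perms by (auto simp: perm_group_def)

lemma perms_bij: "\<sigma> \<in> perms n \<Longrightarrow> bij \<sigma>"
  by (auto simp: perms_def permutes_bij)

lemma perms_inv_o [simp]: "\<sigma> \<in> perms n \<Longrightarrow> pinv \<sigma> \<circ> \<sigma> = id" "\<sigma> \<in> perms n \<Longrightarrow> \<sigma> \<circ> pinv \<sigma> = id"
  by (auto simp: perms_def permutes_inv_o)

lemma perms_inv_inv [simp]: "\<sigma> \<in> perms n \<Longrightarrow> pinv (pinv \<sigma>) = \<sigma>"
  by (auto simp: perms_bij inv_inv_eq)

lemma perms_inv_comp: "\<sigma> \<in> perms n \<Longrightarrow> \<tau> \<in> perms n \<Longrightarrow> pinv (\<sigma> \<circ> \<tau>) = pinv \<tau> \<circ> pinv \<sigma>"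
  by (simp add: perms_bij o_inv_distrib)

lemma perms_mono: "n \<le> m \<Longrightarrow> \<sigma> \<in> perms n \<Longrightarrow> \<sigma> \<in> perms m"
  unfolding perms_def by (auto intro: permutes_subset)

lemma perms_less: "\<sigma> \<in> perms n \<Longrightarrow> \<sigma> x < n \<longleftrightarrow> x < n"
  using permutes_in_image[of \<sigma> "{..<n}" x] by (auto simp: perms_def)

lemma perm_group_finite: "perm_group n G \<Longrightarrow> finite G"
  unfolding perm_group_def using finite_perms finite_subset by blast

lemma sum_left_translate:
  assumes "perm_group n G" "p \<in> G"
  shows "(\<Sum>g\<in>G. F (p \<circ> g)) = (\<Sum>g\<in>G. F g)"
proof -
  have p: "pinv p \<in> G" "pinv p \<circ> p = id" "p \<circ> pinv p = id" using assms by (auto simp: perm_group_def)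
  show ?thesis
    by (rule sum.reindex_bij_witness[where i = "\<lambda>g. pinv p \<circ> g" and j = "\<lambda>g. p \<circ> g"])
       (use assms p in \<open>auto simp: perm_group_def comp_assoc[symmetric]\<close>)
qed

lemma sum_right_translate:
  assumes "perm_group n G" "p \<in> G"
  shows "(\<Sum>g\<in>G. F (g \<circ> p)) = (\<Sum>g\<in>G. F g)"
proof -
  have p: "pinv p \<in> G" "pinv p \<circ> p = id" "p \<circ> pinv p = id" using assms by (auto simp: perm_group_def)
  show ?thesis
    by (rule sum.reindex_bij_witness[where i = "\<lambda>g. g \<circ> pinv p" and j = "\<lambda>g. g \<circ> p"])
       (use assms p in \<open>auto simp: perm_group_def comp_assoc\<close>)
qed

lemma sum_inverse:
  assumes "perm_group n G"
  shows "(\<Sum>g\<in>G. F (pinv g)) = (\<Sum>g\<in>G. F g)"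
  by (rule sum.reindex_bij_witness[where i = pinv and j = pinv])
     (use assms in \<open>auto simp: perm_group_def\<close>)

lemma group_opI: "(\<And>f u. T f u = (\<Sum>\<sigma>\<in>perms n. a \<sigma> * f (u \<circ> \<sigma>))) \<Longrightarrow> group_op n T"
  unfolding group_op_def by blast

lemma group_op_cong:
  assumes "group_op n T" "\<And>f u. T' f u = T f u"
  shows "group_op n T'"
  using assms unfolding group_op_def by simp

lemma group_op_linear:
  assumes "group_op n T"
  shows "T (\<lambda>u. \<Sum>i\<in>I. c i * f i u) = (\<lambda>u. \<Sum>i\<in>I. c i * T (f i) u)"
proof -
  obtain a where a: "\<And>f u. T f u = (\<Sum>\<sigma>\<in>perms n. a \<sigma> * f (u \<circ> \<sigma>))"
    using assms unfolding group_op_def by blast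
  show ?thesis
    unfolding a sum_distrib_left
    by (subst sum.swap) (simp add: sum_distrib_left mult.left_commute)
qed

lemma group_op_scale: "group_op n T \<Longrightarrow> T (\<lambda>u. c * f u) = (\<lambda>u. c * T f u)"
  using group_op_linear[of n T "\<lambda>_. c" "\<lambda>_. f" "{()}"] by simp

lemma group_op_zero: "group_op n T \<Longrightarrow> T (\<lambda>u. 0) = (\<lambda>u. 0)"
  using group_op_scale[of n T 0 "\<lambda>_. 0"] by simp

lemma group_op_add: "group_op n T \<Longrightarrow> T (\<lambda>u. f u + g u) = (\<lambda>u. T f u + T g u)"
  unfolding group_op_def by (auto simp: distrib_left sum.distrib)

lemma group_op_diff: "group_op n T \<Longrightarrow> T (\<lambda>u. f u - g u) = (\<lambda>u. T f u - T g u)"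
  unfolding group_op_def by (auto simp: right_diff_distrib sum_subtractf)

lemma group_op_act: "\<sigma> \<in> perms n \<Longrightarrow> group_op n (act \<sigma>)"
  by (rule group_opI[where a = "\<lambda>\<tau>. if \<tau> = \<sigma> then 1 else 0"])
     (simp add: act_def if_distrib[of "\<lambda>x. x * _"] cong: if_cong)

lemma group_op_sum:
  assumes "\<And>i. i \<in> I \<Longrightarrow> group_op n (T i)"
  shows "group_op n (\<lambda>f u. \<Sum>i\<in>I. c i * T i f u)"
proof -
  have "\<forall>i. \<exists>a. i \<in> I \<longrightarrow> (\<forall>f u. T i f u = (\<Sum>\<sigma>\<in>perms n. a \<sigma> * f (u \<circ> \<sigma>)))"
    using assms unfolding group_op_def by blast
  then obtain a where a: "\<And>i f u. i \<in> I \<Longrightarrow> T i f u = (\<Sum>\<sigma>\<in>perms n. a i \<sigma> * f (u \<circ> \<sigma>))"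
    by metis
  show ?thesis
  proof (rule group_opI[where a = "\<lambda>\<sigma>. \<Sum>i\<in>I. c i * a i \<sigma>"])
    fix f u
    have "(\<Sum>i\<in>I. c i * T i f u) = (\<Sum>i\<in>I. \<Sum>\<sigma>\<in>perms n. c i * a i \<sigma> * f (u \<circ> \<sigma>))"
      by (rule sum.cong) (simp_all add: a sum_distrib_left mult.assoc)
    also have "\<dots> = (\<Sum>\<sigma>\<in>perms n. \<Sum>i\<in>I. c i * a i \<sigma> * f (u \<circ> \<sigma>))" by (rule sum.swap)
    finally show "(\<Sum>i\<in>I. c i * T i f u) = (\<Sum>\<sigma>\<in>perms n. (\<Sum>i\<in>I. c i * a i \<sigma>) * f (u \<circ> \<sigma>))"
      by (simp add: sum_distrib_right)
  qed
qed

lemma group_op_act_comp: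
  assumes "\<sigma> \<in> perms n" "group_op n T"
  shows "group_op n (\<lambda>f. act \<sigma> (T f))"
proof -
  obtain a where a: "\<And>f u. T f u = (\<Sum>\<sigma>\<in>perms n. a \<sigma> * f (u \<circ> \<sigma>))"
    using assms unfolding group_op_def by blast
  show ?thesis
  proof (rule group_opI[where a = "\<lambda>\<tau>. a (pinv \<sigma> \<circ> \<tau>)"])
    fix f u
    have "act \<sigma> (T f) u = (\<Sum>\<tau>\<in>perms n. a \<tau> * f (u \<circ> (\<sigma> \<circ> \<tau>)))" by (simp add: act_def a comp_assoc)
    also have "\<dots> = (\<Sum>\<tau>\<in>perms n. a (pinv \<sigma> \<circ> (\<sigma> \<circ> \<tau>)) * f (u \<circ> (\<sigma> \<circ> \<tau>)))"
      using assms(1) by (simp add: comp_assoc[symmetric])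
    also have "\<dots> = (\<Sum>\<tau>\<in>perms n. a (pinv \<sigma> \<circ> \<tau>) * f (u \<circ> \<tau>))"
      by (rule sum_left_translate[OF perm_group_perms assms(1)])
    finally show "act \<sigma> (T f) u = (\<Sum>\<tau>\<in>perms n. a (pinv \<sigma> \<circ> \<tau>) * f (u \<circ> \<tau>))" .
  qed
qed

lemma group_op_comp:
  assumes "group_op n S" "group_op n T"
  shows "group_op n (\<lambda>f. S (T f))"
proof -
  obtain a where a: "\<And>f u. S f u = (\<Sum>\<sigma>\<in>perms n. a \<sigma> * f (u \<circ> \<sigma>))"
    using assms unfolding group_op_def by blast
  have "group_op n (\<lambda>f u. \<Sum>\<sigma>\<in>perms n. a \<sigma> * act \<sigma> (T f) u)"
    by (rule group_op_sum) (rule group_op_act_comp[OF _ assms(2)])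
  then show ?thesis by (rule group_op_cong) (simp add: a act_def)
qed

text \<open>Lets symmetrizers of adjacent degrees be composed, as branching requires.\<close>

lemma group_op_mono:
  assumes "n \<le> m" "group_op n T" shows "group_op m T"
proof -
  obtain a where a: "\<And>f u. T f u = (\<Sum>\<sigma>\<in>perms n. a \<sigma> * f (u \<circ> \<sigma>))"
    using assms unfolding group_op_def by blast
  have "group_op m (\<lambda>f u. \<Sum>\<sigma>\<in>perms n. a \<sigma> * act \<sigma> f u)"
    by (rule group_op_sum) (rule group_op_act[OF perms_mono[OF assms(1)]])
  then show ?thesis by (rule group_op_cong) (simp add: a act_def)
qed

lemma group_op_commute:
  assumes C: "group_op n C" "\<And>\<sigma> f. \<sigma> \<in> perms n \<Longrightarrow> C (act \<sigma> f) = act \<sigma> (C f)" and T: "group_op n T"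
  shows "C (T f) = T (C f)"
proof -
  obtain a where a: "\<And>f u. T f u = (\<Sum>\<sigma>\<in>perms n. a \<sigma> * f (u \<circ> \<sigma>))"
    using T unfolding group_op_def by blast
  have T': "T f = (\<lambda>u. \<Sum>\<sigma>\<in>perms n. a \<sigma> * act \<sigma> f u)" for f by (rule ext) (simp add: a act_def)
  show ?thesis unfolding T' group_op_linear[OF C(1)] by (rule ext, rule sum.cong) (simp_all add: C(2))
qed

section \<open>Young symmetrizers as operators\<close>

definition row_op :: "(nat \<Rightarrow> nat) \<Rightarrow> ((nat \<Rightarrow> nat) \<Rightarrow> 'f) \<Rightarrow> (nat \<Rightarrow> nat) \<Rightarrow> 'f::field_char_0" where
  "row_op \<mu> f = (\<lambda>u. \<Sum>p\<in>row_group \<mu>. f (u \<circ> p))"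

definition col_op :: "(nat \<Rightarrow> nat) \<Rightarrow> ((nat \<Rightarrow> nat) \<Rightarrow> 'f) \<Rightarrow> (nat \<Rightarrow> nat) \<Rightarrow> 'f::field_char_0" where
  "col_op \<mu> f = (\<lambda>u. \<Sum>q\<in>column_group \<mu>. of_int (sign q) * f (u \<circ> q))"

text \<open>Up to a nonzero scalar, this is the central idempotent of the group algebra that belongs to \<open>\<chi>\<^sup>\<mu>\<close>.\<close>
definition central_op :: "(nat \<Rightarrow> nat) \<Rightarrow> ((nat \<Rightarrow> nat) \<Rightarrow> 'f) \<Rightarrow> (nat \<Rightarrow> nat) \<Rightarrow> 'f::field_char_0" where
  "central_op \<mu> f = (\<lambda>u. \<Sum>g\<in>perms (psize \<mu>). row_op \<mu> (col_op \<mu> (act (pinv g) f)) (u \<circ> g))"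

lemma perm_group_row: "\<mu> \<in> partitions \<Longrightarrow> perm_group (psize \<mu>) (row_group \<mu>)"
  unfolding perm_group_def
proof (safe)
  assume m: "\<mu> \<in> partitions"
  show "p \<in> perms (psize \<mu>)" if "p \<in> row_group \<mu>" for p
    using that m by (auto simp: row_group_eq perms_def)
  show "id \<in> row_group \<mu>" using m by (auto simp: row_group_eq permutes_id)
  show "p \<circ> q \<in> row_group \<mu>" if "p \<in> row_group \<mu>" "q \<in> row_group \<mu>" for p q
    using that m perms_less[of q "psize \<mu>"] by (auto simp: row_group_eq perms_def permutes_compose)
  show "pinv p \<in> row_group \<mu>" if "p \<in> row_group \<mu>" for p
  proof -
    have p: "p permutes {..<psize \<mu>}" "pinv p permutes {..<psize \<mu>}"
      using that m by (auto simp: row_group_eq permutes_inv)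
    have "row_of \<mu> (pinv p x) = row_of \<mu> x" if "x < psize \<mu>" for x
    proof -
      have "pinv p x < psize \<mu>" using permutes_in_image[OF p(2)] that by auto
      then have "row_of \<mu> (p (pinv p x)) = row_of \<mu> (pinv p x)"
        using \<open>p \<in> row_group \<mu>\<close> m by (auto simp: row_group_eq)
      then show ?thesis by (simp add: permutes_inverses(1)[OF p(1)])
    qed
    then show ?thesis using p m by (auto simp: row_group_eq)
  qed
qed

lemma perm_group_column: "\<mu> \<in> partitions \<Longrightarrow> perm_group (psize \<mu>) (column_group \<mu>)"
  unfolding perm_group_def
proof (safe)
  assume m: "\<mu> \<in> partitions"
  show "p \<in> perms (psize \<mu>)" if "p \<in> column_group \<mu>" for p
    using that m by (auto simp: column_group_eq perms_def)
  show "id \<in> column_group \<mu>" using m by (auto simp: column_group_eq permutes_id)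
  show "p \<circ> q \<in> column_group \<mu>" if "p \<in> column_group \<mu>" "q \<in> column_group \<mu>" for p q
    using that m perms_less[of q "psize \<mu>"] by (auto simp: column_group_eq perms_def permutes_compose)
  show "pinv p \<in> column_group \<mu>" if "p \<in> column_group \<mu>" for p
  proof -
    have p: "p permutes {..<psize \<mu>}" "pinv p permutes {..<psize \<mu>}"
      using that m by (auto simp: column_group_eq permutes_inv)
    have "col_of \<mu> (pinv p x) = col_of \<mu> x" if "x < psize \<mu>" for x
    proof -
      have "pinv p x < psize \<mu>" using permutes_in_image[OF p(2)] that by auto
      then have "col_of \<mu> (p (pinv p x)) = col_of \<mu> (pinv p x)"
        using \<open>p \<in> column_group \<mu>\<close> m by (auto simp: column_group_eq)
      then show ?thesis by (simp add: permutes_inverses(1)[OF p(1)])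
    qed
    then show ?thesis using p m by (auto simp: column_group_eq)
  qed
qed

lemma row_group_perms: "\<mu> \<in> partitions \<Longrightarrow> p \<in> row_group \<mu> \<Longrightarrow> p \<in> perms (psize \<mu>)"
  and column_group_perms: "\<mu> \<in> partitions \<Longrightarrow> q \<in> column_group \<mu> \<Longrightarrow> q \<in> perms (psize \<mu>)"
  using perm_group_row[of \<mu>] perm_group_column[of \<mu>] unfolding perm_group_def by blast+

lemma sign_comp_perms: "\<sigma> \<in> perms n \<Longrightarrow> \<tau> \<in> perms n \<Longrightarrow> sign (\<sigma> \<circ> \<tau>) = sign \<sigma> * sign \<tau>"
  unfolding perms_def by (intro sign_compose) (auto intro: permutes_imp_permutation[of "{..<n}"])

lemma sign_inv_perms: "\<sigma> \<in> perms n \<Longrightarrow> sign (pinv \<sigma>) = sign \<sigma>"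
  unfolding perms_def by (intro sign_inverse) (auto intro: permutes_imp_permutation[of "{..<n}"])

lemma sign_square [simp]: "of_int (sign \<sigma>) * (of_int (sign \<sigma>) * x) = (x::'f::comm_ring_1)"
  by (simp add: sign_def)

context
  fixes \<mu> :: "nat \<Rightarrow> nat"
  assumes \<mu>: "\<mu> \<in> partitions"
begin

lemma group_op_row_op: "group_op (psize \<mu>) (row_op \<mu>)"
  by (rule group_op_cong[OF group_op_sum[where I = "row_group \<mu>" and T = act and c = "\<lambda>_. 1"]])
     (simp_all add: row_op_def act_def group_op_act[OF row_group_perms[OF \<mu>]])

lemma group_op_col_op: "group_op (psize \<mu>) (col_op \<mu>)"
  by (rule group_op_cong[OF group_op_sum[where I = "column_group \<mu>" and T = act and c = "\<lambda>q. of_int (sign q)"]])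
     (simp_all add: col_op_def act_def group_op_act[OF column_group_perms[OF \<mu>]])

lemma group_op_young: "group_op (psize \<mu>) (\<lambda>f. row_op \<mu> (col_op \<mu> f))"
  by (rule group_op_comp[OF group_op_row_op group_op_col_op])

lemma group_op_central_op: "group_op (psize \<mu>) (central_op \<mu>)"
proof -
  have "group_op (psize \<mu>) (\<lambda>f u. \<Sum>g\<in>perms (psize \<mu>). 1 * act g (row_op \<mu> (col_op \<mu> (act (pinv g) f))) u)"
    by (intro group_op_sum group_op_act_comp group_op_comp[OF group_op_young] group_op_act perms_inv)
  then show ?thesis by (rule group_op_cong) (simp add: central_op_def act_def)
qed

lemma row_op_act: "p \<in> row_group \<mu> \<Longrightarrow> row_op \<mu> (act p f) = row_op \<mu> f"
  using sum_right_translate[OF perm_group_row[OF \<mu>], where F = "\<lambda>p. f (_ \<circ> p)"]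
  by (simp add: row_op_def act_def comp_assoc)

lemma act_row_op: "p \<in> row_group \<mu> \<Longrightarrow> act p (row_op \<mu> f) = row_op \<mu> f"
  using sum_left_translate[OF perm_group_row[OF \<mu>], where F = "\<lambda>p. f (_ \<circ> p)"]
  by (simp add: row_op_def act_def comp_assoc)

lemma col_op_act:
  assumes q: "q \<in> column_group \<mu>"
  shows "col_op \<mu> (act q f) = (\<lambda>u. of_int (sign q) * col_op \<mu> f u)"
proof
  fix u
  have "(\<Sum>r\<in>column_group \<mu>. of_int (sign r) * f (u \<circ> r)) = (\<Sum>r\<in>column_group \<mu>. of_int (sign (r \<circ> q)) * f (u \<circ> (r \<circ> q)))"
    by (rule sum_right_translate[OF perm_group_column[OF \<mu>] q, symmetric])
  also have "\<dots> = of_int (sign q) * (\<Sum>r\<in>column_group \<mu>. of_int (sign r) * f (u \<circ> r \<circ> q))"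
    unfolding sum_distrib_left
    by (rule sum.cong) (use q in \<open>simp_all add: sign_comp_perms[OF column_group_perms[OF \<mu>] column_group_perms[OF \<mu>]] comp_assoc mult.commute mult.left_commute\<close>)
  finally show "col_op \<mu> (act q f) u = of_int (sign q) * col_op \<mu> f u"
    by (simp add: col_op_def act_def)
qed

lemma act_col_op:
  assumes q: "q \<in> column_group \<mu>"
  shows "act q (col_op \<mu> f) = (\<lambda>u. of_int (sign q) * col_op \<mu> f u)"
proof
  fix u
  have "(\<Sum>r\<in>column_group \<mu>. of_int (sign r) * f (u \<circ> r)) = (\<Sum>r\<in>column_group \<mu>. of_int (sign (q \<circ> r)) * f (u \<circ> (q \<circ> r)))"
    by (rule sum_left_translate[OF perm_group_column[OF \<mu>] q, symmetric])
  also have "\<dots> = of_int (sign q) * (\<Sum>r\<in>column_group \<mu>. of_int (sign r) * f (u \<circ> q \<circ> r))"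
    unfolding sum_distrib_left
    by (rule sum.cong) (use q in \<open>simp_all add: sign_comp_perms[OF column_group_perms[OF \<mu>] column_group_perms[OF \<mu>]] comp_assoc mult.commute mult.left_commute\<close>)
  finally show "act q (col_op \<mu> f) u = of_int (sign q) * col_op \<mu> f u"
    by (simp add: col_op_def act_def)
qed

lemma transpose_column_group:
  assumes "x < psize \<mu>" "y < psize \<mu>" "col_of \<mu> x = col_of \<mu> y"
  shows "transpose x y \<in> column_group \<mu>"
  using assms \<mu> permutes_swap_id[of x "{..<psize \<mu>}" y] by (auto simp: column_group_eq transpose_def)

lemma transpose_row_group:
  assumes "x < psize \<mu>" "y < psize \<mu>" "row_of \<mu> x = row_of \<mu> y"
  shows "transpose x y \<in> row_group \<mu>"
  using assms \<mu> permutes_swap_id[of x "{..<psize \<mu>}" y] by (auto simp: row_group_eq transpose_def)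

text \<open>The transposition is either absorbed by the column sum, which changes the sign, or left
  out by the symmetry of \<open>f\<close>. In characteristic 0 the two results agree only at
  0.\<close>

lemma col_op_symmetric_zero:
  assumes "x < psize \<mu>" "y < psize \<mu>" "x \<noteq> y" "col_of \<mu> x = col_of \<mu> y" "act (transpose x y) f = f"
  shows "col_op \<mu> f = (\<lambda>u. 0)"
proof
  fix u
  have "col_op \<mu> f = (\<lambda>u. of_int (sign (transpose x y)) * col_op \<mu> f u)"
    using col_op_act[OF transpose_column_group[OF assms(1,2,4)], of f] assms(5) by simp
  then have "col_op \<mu> f u = - col_op \<mu> f u" using assms(3) by (metis mult_minus1 of_int_1 of_int_minus sign_swap_id)
  then show "col_op \<mu> f u = 0" by simp
qed

text \<open>Here the transposition acts on the result instead of the argument: it fixes the word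
  \<open>u\<close> at which the value is taken.\<close>

lemma col_op_repeated_letter:
  assumes "x < psize \<mu>" "y < psize \<mu>" "x \<noteq> y" "col_of \<mu> x = col_of \<mu> y" "u x = u y"
  shows "col_op \<mu> f u = 0"
proof -
  have "u \<circ> transpose x y = u" using assms(5) by (auto simp: transpose_def)
  then have "act (transpose x y) (col_op \<mu> f) u = col_op \<mu> f u" by (simp add: act_def)
  then have "col_op \<mu> f u = - col_op \<mu> f u"
    using act_col_op[OF transpose_column_group[OF assms(1,2,4)], of f] assms(3) by (simp add: sign_swap_id)
  then show ?thesis by simp
qed

lemma row_op_alternating_zero:
  assumes "x < psize \<mu>" "y < psize \<mu>" "row_of \<mu> x = row_of \<mu> y" "act (transpose x y) f = (\<lambda>u. - f u)"
  shows "row_op \<mu> f = (\<lambda>u. 0)"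
proof
  fix u
  have "row_op \<mu> f = row_op \<mu> (\<lambda>u. - f u)"
    using row_op_act[OF transpose_row_group[OF assms(1-3)], of f] assms(4) by simp
  also have "\<dots> = (\<lambda>u. - row_op \<mu> f u)" by (simp add: row_op_def sum_negf)
  finally have "row_op \<mu> f u = - row_op \<mu> f u" by metis
  then show "row_op \<mu> f u = 0" by simp
qed

end

lemma pinv_apply:
  assumes "\<sigma> \<in> perms n" shows "pinv \<sigma> (\<sigma> x) = x" "\<sigma> (pinv \<sigma> x) = x"
  using assms by (auto simp: perms_def permutes_inverses)

lemma transpose_conj:
  assumes "\<sigma> \<in> perms n"
  shows "transpose x y \<circ> \<sigma> = \<sigma> \<circ> transpose (pinv \<sigma> x) (pinv \<sigma> y)"
    and "\<sigma> \<circ> transpose x y = transpose (\<sigma> x) (\<sigma> y) \<circ> \<sigma>"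
  using pinv_apply[OF assms] by (auto simp: fun_eq_iff transpose_def) (metis)+

lemma sum_rotate: "(\<Sum>p\<in>A. \<Sum>q\<in>B. \<Sum>g\<in>C. H p q g) = (\<Sum>g\<in>C. \<Sum>q\<in>B. \<Sum>p\<in>A. H p q g)"
proof -
  have "(\<Sum>p\<in>A. \<Sum>q\<in>B. \<Sum>g\<in>C. H p q g) = (\<Sum>q\<in>B. \<Sum>p\<in>A. \<Sum>g\<in>C. H p q g)" by (rule sum.swap)
  also have "\<dots> = (\<Sum>q\<in>B. \<Sum>g\<in>C. \<Sum>p\<in>A. H p q g)" by (intro sum.cong refl sum.swap)
  also have "\<dots> = (\<Sum>g\<in>C. \<Sum>q\<in>B. \<Sum>p\<in>A. H p q g)" by (rule sum.swap)
  finally show ?thesis .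
qed

section \<open>Rows against columns: products of symmetrizers\<close>

lemma card_word_content:
  assumes "\<mu> \<in> partitions" "\<sigma> \<in> perms (psize \<mu>)"
  shows "card {x. x < psize \<mu> \<and> row_of \<mu> (\<sigma> x) = l} = \<mu> l"
proof -
  have "bij_betw \<sigma> {x. x < psize \<mu> \<and> row_of \<mu> (\<sigma> x) = l} {x. x < psize \<mu> \<and> row_of \<mu> x = l}"
    by (rule bij_betw_byWitness[where f' = "pinv \<sigma>"])
       (use assms perms_less[OF assms(2)] perms_less[OF perms_inv[OF assms(2)]] pinv_apply[OF assms(2)] in auto)
  from bij_betw_same_card[OF this] show ?thesis using card_row[OF assms(1), of l] by simp
qed

text \<open>The transposition of \<open>x\<close> and \<open>y\<close> lies both in the column group
  of \<nu> and in the row group of \<mu> conjugated by \<open>g\<close>.\<close>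

lemma col_op_zero_of_pair:
  assumes "\<nu> \<in> partitions" "\<mu> \<in> partitions" "psize \<nu> = psize \<mu>" "g \<in> perms (psize \<mu>)"
    and "x < psize \<mu>" "y < psize \<mu>" "x \<noteq> y" "col_of \<nu> x = col_of \<nu> y"
    and "row_of \<mu> (pinv g x) = row_of \<mu> (pinv g y)"
  shows "col_op \<nu> (act g (row_op \<mu> f)) = (\<lambda>u. 0)"
proof (rule col_op_symmetric_zero[OF assms(1)])
  have "transpose (pinv g x) (pinv g y) \<in> row_group \<mu>"
    using assms perms_less[OF perms_inv[OF assms(4)]] by (intro transpose_row_group) auto
  then show "act (transpose x y) (act g (row_op \<mu> f)) = act g (row_op \<mu> f)"
    unfolding act_act transpose_conj(1)[OF assms(4)] using assms(2) by (simp add: act_act[symmetric] act_row_op)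
qed (use assms in auto)

text \<open>If the product were nonzero, \<open>col_op_zero_of_pair\<close> would make the rows of
  the permuted tableau of \<mu> a filling that separates the columns of \<nu>. Its content is \<mu>,
  and \<open>content_le\<close> contradicts \<nu> l < \<mu> l.\<close>

lemma col_op_row_op_zero:
  assumes "\<nu> \<in> partitions" "\<mu> \<in> partitions" "psize \<nu> = psize \<mu>" "g \<in> perms (psize \<mu>)"
    and l: "\<And>l'. l' < l \<Longrightarrow> \<mu> l' = \<nu> l'" "\<nu> l < \<mu> l"
  shows "col_op \<nu> (act g (row_op \<mu> f)) = (\<lambda>u. 0)"
proof (rule ccontr)
  assume nz: "\<not> ?thesis"
  interpret column_separating \<nu> "\<lambda>x. row_of \<mu> (pinv g x)"
    by standard (use nz assms(1-4) col_op_zero_of_pair in metis)+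
  have "card {x. x < psize \<nu> \<and> row_of \<mu> (pinv g x) = l} \<le> \<nu> l"
    by (rule content_le) (use l assms card_word_content[OF assms(2) perms_inv[OF assms(4)]] in auto)
  then show False using l assms card_word_content[OF assms(2) perms_inv[OF assms(4)]] by auto
qed

text \<open>When there is no such pair, the rows of the tableau permuted by \<open>g\<close>
  separate the columns, and the column permutation that realizes these rows turns \<open>g\<close>
  into a row permutation.\<close>

lemma column_row_factorization:
  assumes \<mu>: "\<mu> \<in> partitions" and g: "g \<in> perms (psize \<mu>)"
  obtains (pair) x y where "x < psize \<mu>" "y < psize \<mu>" "x \<noteq> y" "col_of \<mu> x = col_of \<mu> y"
      "row_of \<mu> (pinv g x) = row_of \<mu> (pinv g y)"
    | (factor) q p where "q \<in> column_group \<mu>" "p \<in> row_group \<mu>" "g = q \<circ> p"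
proof (cases "\<exists>x y. x < psize \<mu> \<and> y < psize \<mu> \<and> x \<noteq> y \<and> col_of \<mu> x = col_of \<mu> y \<and>
    row_of \<mu> (pinv g x) = row_of \<mu> (pinv g y)")
  case True
  then show ?thesis using pair by blast
next
  case False
  interpret column_separating \<mu> "\<lambda>x. row_of \<mu> (pinv g x)"
    by standard (use False \<mu> in blast)+
  obtain q where q: "q \<in> column_group \<mu>" "\<And>x. x < psize \<mu> \<Longrightarrow> row_of \<mu> (q x) = row_of \<mu> (pinv g x)"
    using exists_column_perm[OF card_word_content[OF \<mu> perms_inv[OF g]]] by blast
  have qp: "q \<in> perms (psize \<mu>)" using q column_group_perms[OF \<mu>] by blast
  have "pinv q \<in> column_group \<mu>" using q perm_group_column[OF \<mu>] by (auto simp: perm_group_def)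
  moreover have "q \<circ> g \<in> row_group \<mu>"
    using q perms_comp[OF qp g] perms_less[OF g] pinv_apply[OF g] \<mu> by (auto simp: row_group_eq perms_def)
  moreover have "g = pinv q \<circ> (q \<circ> g)" using qp by (simp add: comp_assoc[symmetric])
  ultimately show ?thesis using factor by blast
qed

text \<open>Linearity reduces an arbitrary middle factor from the group algebra to a single
  permutation.\<close>

lemma group_op_sandwich:
  assumes C: "group_op n C" and T: "group_op n T"
    and act: "\<And>g. g \<in> perms n \<Longrightarrow> \<exists>c. \<forall>f. C (act g (D f)) = (\<lambda>u. c * C (D f) u)"
  shows "\<exists>c. \<forall>f. C (T (D f)) = (\<lambda>u. c * C (D f) u)"
proof -
  obtain a where a: "\<And>f u. T f u = (\<Sum>\<sigma>\<in>perms n. a \<sigma> * f (u \<circ> \<sigma>))"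
    using T unfolding group_op_def by blast
  obtain k where k: "\<And>g f. g \<in> perms n \<Longrightarrow> C (act g (D f)) = (\<lambda>u. k g * C (D f) u)"
    using act by metis
  have T': "T f = (\<lambda>u. \<Sum>\<sigma>\<in>perms n. a \<sigma> * act \<sigma> f u)" for f by (rule ext) (simp add: a act_def)
  have "C (T (D f)) u = (\<Sum>\<sigma>\<in>perms n. a \<sigma> * k \<sigma>) * C (D f) u" for f u
    unfolding T' group_op_linear[OF C] sum_distrib_right
    by (rule sum.cong) (simp_all add: k mult.assoc)
  then show ?thesis by blast
qed

text \<open>Von Neumann's lemma for Young symmetrizers.\<close>
lemma col_row_sandwich:
  fixes T :: "((nat \<Rightarrow> nat) \<Rightarrow> 'f::field_char_0) \<Rightarrow> (nat \<Rightarrow> nat) \<Rightarrow> 'f"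
  assumes \<mu>: "\<mu> \<in> partitions" and T: "group_op (psize \<mu>) T"
  shows "\<exists>c. \<forall>f. col_op \<mu> (T (row_op \<mu> f)) = (\<lambda>u. c * col_op \<mu> (row_op \<mu> f) u)"
proof (rule group_op_sandwich[OF group_op_col_op[OF \<mu>] T])
  fix g assume g: "g \<in> perms (psize \<mu>)"
  show "\<exists>c. \<forall>f. col_op \<mu> (act g (row_op \<mu> f)) = (\<lambda>u. (c::'f) * col_op \<mu> (row_op \<mu> f) u)"
  proof (cases rule: column_row_factorization[OF \<mu> g, case_names pair factor])
    case (pair x y)
    then show ?thesis using col_op_zero_of_pair[OF \<mu> \<mu> refl g] by (intro exI[of _ 0]) auto
  next
    case (factor q p)
    then show ?thesis
      by (intro exI[of _ "of_int (sign q)"]) (simp add: act_act[symmetric] act_row_op[OF \<mu>] col_op_act[OF \<mu>])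
  qed
qed

text \<open>The mirror image of the preceding lemma. Since the row group now stands on the left, the
  factorization is applied to the inverse of \<open>g\<close>.\<close>

lemma row_col_sandwich:
  fixes T :: "((nat \<Rightarrow> nat) \<Rightarrow> 'f::field_char_0) \<Rightarrow> (nat \<Rightarrow> nat) \<Rightarrow> 'f"
  assumes \<mu>: "\<mu> \<in> partitions" and T: "group_op (psize \<mu>) T"
  shows "\<exists>c. \<forall>f. row_op \<mu> (T (col_op \<mu> f)) = (\<lambda>u. c * row_op \<mu> (col_op \<mu> f) u)"
proof (rule group_op_sandwich[OF group_op_row_op[OF \<mu>] T])
  fix g assume g: "g \<in> perms (psize \<mu>)"
  show "\<exists>c. \<forall>f. row_op \<mu> (act g (col_op \<mu> f)) = (\<lambda>u. (c::'f) * row_op \<mu> (col_op \<mu> f) u)"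
  proof (cases rule: column_row_factorization[OF \<mu> perms_inv[OF g], case_names pair factor])
    case (pair x y)
    have t: "transpose x y \<in> column_group \<mu>" by (rule transpose_column_group[OF \<mu>]) (use pair in auto)
    have *: "act (transpose (g x) (g y)) (act g (col_op \<mu> f)) = (\<lambda>u. - act g (col_op \<mu> f) u)"
      for f :: "(nat \<Rightarrow> nat) \<Rightarrow> 'f"
      unfolding act_act transpose_conj(2)[OF g, symmetric]
      by (simp add: act_act[symmetric] act_col_op[OF \<mu> t] sign_swap_id pair) (simp add: act_def)
    have "row_op \<mu> (act g (col_op \<mu> f)) = (\<lambda>u. 0)" for f :: "(nat \<Rightarrow> nat) \<Rightarrow> 'f"
      by (rule row_op_alternating_zero[OF \<mu> _ _ _ *]) (use pair g in \<open>auto simp: perms_less\<close>)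
    then show ?thesis by (intro exI[of _ 0]) auto
  next
    case (factor q p)
    have "g = pinv (q \<circ> p)" using factor g by (metis perms_inv_inv)
    then have "g = pinv p \<circ> pinv q"
      using factor perms_inv_comp row_group_perms[OF \<mu>] column_group_perms[OF \<mu>] by metis
    moreover have "pinv q \<in> column_group \<mu>" "pinv p \<in> row_group \<mu>"
      using factor perm_group_column[OF \<mu>] perm_group_row[OF \<mu>] by (auto simp: perm_group_def)
    ultimately show ?thesis
      by (intro exI[of _ "of_int (sign (pinv q))"])
         (simp add: act_act[symmetric] act_col_op[OF \<mu>] row_op_act[OF \<mu>] group_op_scale[OF group_op_row_op[OF \<mu>]]
            group_op_scale[OF group_op_act[OF row_group_perms[OF \<mu>]]])
  qed
qed

section \<open>The eigenvalue of the central operator\<close>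

definition delta_id :: "(nat \<Rightarrow> nat) \<Rightarrow> 'f::field_char_0" where
  "delta_id = (\<lambda>u. if u = id then 1 else 0)"

context
  fixes \<mu> :: "nat \<Rightarrow> nat"
  assumes \<mu>: "\<mu> \<in> partitions"
begin

lemma central_op_act:
  assumes h: "h \<in> perms (psize \<mu>)"
  shows "central_op \<mu> (act h f) = act h (central_op \<mu> f)"
proof
  fix u
  have "central_op \<mu> (act h f) u =
    (\<Sum>g\<in>perms (psize \<mu>). row_op \<mu> (col_op \<mu> (act (pinv g \<circ> h) f)) (u \<circ> g))"
    by (simp add: central_op_def act_act)
  also have "\<dots> = (\<Sum>g\<in>perms (psize \<mu>). row_op \<mu> (col_op \<mu> (act (pinv (h \<circ> g) \<circ> h) f)) (u \<circ> (h \<circ> g)))"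
    by (rule sum_left_translate[OF perm_group_perms h, symmetric])
  also have "\<dots> = act h (central_op \<mu> f) u"
    unfolding act_def[of h] central_op_def
    by (rule sum.cong) (use h in \<open>simp_all add: perms_inv_comp comp_assoc\<close>)
  finally show "central_op \<mu> (act h f) u = act h (central_op \<mu> f) u" .
qed

lemma central_op_commute: "group_op (psize \<mu>) T \<Longrightarrow> central_op \<mu> (T f) = T (central_op \<mu> f)"
  by (rule group_op_commute[OF group_op_central_op[OF \<mu>] central_op_act])

text \<open>The two orders of the symmetrizers become equal after averaging: replacing g by g p
  turns g q p g^-1 into g p q g^-1. In the new form the row sum meets the argument first and the
  column sum meets the word last, as the vanishing criteria require.\<close>

lemma central_op_col_row:
  "central_op \<mu> f u = (\<Sum>g\<in>perms (psize \<mu>). col_op \<mu> (row_op \<mu> (act (pinv g) f)) (u \<circ> g))"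
proof -
  let ?G = "perms (psize \<mu>)"
  have "central_op \<mu> f u = (\<Sum>p\<in>row_group \<mu>. \<Sum>q\<in>column_group \<mu>. of_int (sign q) *
      (\<Sum>g\<in>?G. f (u \<circ> (g \<circ> p \<circ> q \<circ> pinv g))))"
    unfolding central_op_def row_op_def col_op_def sum_distrib_left
    by (subst sum.swap, rule sum.cong[OF refl], subst sum.swap) (simp add: act_def comp_assoc)
  also have "\<dots> = (\<Sum>p\<in>row_group \<mu>. \<Sum>q\<in>column_group \<mu>. of_int (sign q) *
      (\<Sum>g\<in>?G. f (u \<circ> (g \<circ> q \<circ> p \<circ> pinv g))))"
  proof (rule sum.cong[OF refl], rule sum.cong[OF refl], rule arg_cong[where f = "(*) _"])
    fix p q assume "p \<in> row_group \<mu>"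
    then have p: "p \<in> ?G" using row_group_perms \<mu> by blast
    have "(\<Sum>g\<in>?G. f (u \<circ> (g \<circ> q \<circ> p \<circ> pinv g))) = (\<Sum>g\<in>?G. f (u \<circ> ((g \<circ> p) \<circ> q \<circ> p \<circ> pinv (g \<circ> p))))"
      by (rule sum_right_translate[OF perm_group_perms p, symmetric])
    also have "\<dots> = (\<Sum>g\<in>?G. f (u \<circ> (g \<circ> p \<circ> q \<circ> pinv g)))"
    proof (rule sum.cong)
      fix g assume g: "g \<in> ?G"
      have "p \<circ> pinv (g \<circ> p) = pinv g"
        using g p by (simp add: perms_inv_comp comp_assoc[symmetric])
      then show "f (u \<circ> ((g \<circ> p) \<circ> q \<circ> p \<circ> pinv (g \<circ> p))) = f (u \<circ> (g \<circ> p \<circ> q \<circ> pinv g))"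
        by (simp add: comp_assoc)
    qed simp
    finally show "(\<Sum>g\<in>?G. f (u \<circ> (g \<circ> p \<circ> q \<circ> pinv g))) = (\<Sum>g\<in>?G. f (u \<circ> (g \<circ> q \<circ> p \<circ> pinv g)))" by simp
  qed
  also have "\<dots> = (\<Sum>g\<in>?G. col_op \<mu> (row_op \<mu> (act (pinv g) f)) (u \<circ> g))"
    unfolding row_op_def col_op_def sum_distrib_left
    by (subst sum_rotate) (simp add: act_def comp_assoc)
  finally show ?thesis .
qed

lemma central_op_eq_sum_young:
  "central_op \<mu> f = (\<lambda>u. \<Sum>g\<in>perms (psize \<mu>). 1 * act g (row_op \<mu> (col_op \<mu> (act (pinv g) f))) u)"
  by (rule ext) (simp add: central_op_def act_def)

lemma central_op_eq_sum_young':
  "central_op \<mu> f = (\<lambda>u. \<Sum>g\<in>perms (psize \<mu>). 1 * act g (col_op \<mu> (row_op \<mu> (act (pinv g) f))) u)"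
  by (rule ext) (simp add: central_op_col_row act_def)

lemma central_op_square_of_young:
  fixes c :: "'f::field_char_0"
  assumes rep: "\<And>f. central_op \<mu> f = (\<lambda>u. \<Sum>g\<in>perms (psize \<mu>). 1 * act g (Y (act (pinv g) f)) u)"
    and Y: "\<And>f. central_op \<mu> (Y f) = (\<lambda>u. c * Y f u)"
  shows "central_op \<mu> (central_op \<mu> f) = (\<lambda>u. c * central_op \<mu> f u)"
proof -
  have "central_op \<mu> (central_op \<mu> f) =
      central_op \<mu> (\<lambda>u. \<Sum>g\<in>perms (psize \<mu>). 1 * act g (Y (act (pinv g) f)) u)"
    by (rule arg_cong[OF rep])
  also have "\<dots> = (\<lambda>u. \<Sum>g\<in>perms (psize \<mu>). 1 * central_op \<mu> (act g (Y (act (pinv g) f))) u)"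
    by (rule group_op_linear[OF group_op_central_op[OF \<mu>]])
  also have "\<dots> = (\<lambda>u. \<Sum>g\<in>perms (psize \<mu>). c * (1 * act g (Y (act (pinv g) f)) u))"
    by (intro ext sum.cong refl) (simp add: central_op_act Y, simp add: act_def)
  also have "\<dots> = (\<lambda>u. c * central_op \<mu> f u)"
    unfolding rep[of f] sum_distrib_left ..
  finally show ?thesis .
qed

lemma delta_row_col:
  assumes "p \<in> row_group \<mu>" "q \<in> column_group \<mu>" "p \<circ> q = id"
  shows "p = id \<and> q = id"
proof -
  have perm: "p \<in> perms (psize \<mu>)" "q \<in> perms (psize \<mu>)" using assms row_group_perms column_group_perms \<mu> by auto
  have "q x = x" for x
  proof (cases "x < psize \<mu>")
    case True
    have "p (q x) = x" using assms(3) by (metis comp_apply id_apply)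
    then have "row_of \<mu> (q x) = row_of \<mu> x" "col_of \<mu> (q x) = col_of \<mu> x"
      using assms \<mu> True perms_less[OF perm(2), of x] by (auto simp: row_group_eq column_group_eq)
    then show ?thesis using row_col_inj[OF \<mu>] True perms_less[OF perm(2), of x] by auto
  next
    case False
    then show ?thesis using perm(2) by (auto simp: perms_def permutes_def)
  qed
  then have "q = id" by auto
  then show ?thesis using assms(3) by auto
qed

lemma young_delta_id: "row_op \<mu> (col_op \<mu> delta_id) id = (1::'f::field_char_0)"
proof -
  have "row_op \<mu> (col_op \<mu> delta_id) id = (\<Sum>p\<in>row_group \<mu>. \<Sum>q\<in>column_group \<mu>.
      (if p = id then if q = id then (1::'f) else 0 else 0))"
    unfolding row_op_def col_op_def delta_id_def
    by (intro sum.cong refl) (auto simp: sign_id dest: delta_row_col)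
  also have "\<dots> = (\<Sum>p\<in>row_group \<mu>. if p = id then 1 else 0)"
    using perm_group_column[OF \<mu>] perm_group_finite[OF perm_group_column[OF \<mu>]]
    by (intro sum.cong refl) (auto simp: perm_group_def)
  also have "\<dots> = 1"
    using perm_group_row[OF \<mu>] perm_group_finite[OF perm_group_row[OF \<mu>]] by (auto simp: perm_group_def)
  finally show ?thesis .
qed

text \<open>The identity has coefficient 1 in the Young symmetrizer and conjugation does not change
  it. This is the trace argument showing that the central operator is not 0.\<close>

lemma central_delta_id: "central_op \<mu> delta_id id = (of_nat (card (perms (psize \<mu>))) :: 'f::field_char_0)"
proof -
  have "row_op \<mu> (col_op \<mu> (act (pinv g) delta_id)) (id \<circ> g) = (1::'f)" if g: "g \<in> perms (psize \<mu>)" for g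
  proof -
    have "g \<circ> p \<circ> q \<circ> pinv g = id \<longleftrightarrow> p \<circ> q = id" for p q :: "nat \<Rightarrow> nat"
    proof
      assume "g \<circ> p \<circ> q \<circ> pinv g = id"
      then have "pinv g \<circ> (g \<circ> p \<circ> q \<circ> pinv g) \<circ> g = pinv g \<circ> id \<circ> g" by simp
      then have "(pinv g \<circ> g) \<circ> (p \<circ> q) \<circ> (pinv g \<circ> g) = pinv g \<circ> g" by (simp only: comp_assoc comp_id id_comp)
      then show "p \<circ> q = id" using g by simp
    next
      assume "p \<circ> q = id"
      then have "g \<circ> p \<circ> q \<circ> pinv g = g \<circ> pinv g" by (simp add: comp_assoc)
      then show "g \<circ> p \<circ> q \<circ> pinv g = id" using g by simp
    qed
    then have "delta_id (g \<circ> p \<circ> q \<circ> pinv g) = (delta_id (id \<circ> p \<circ> q) :: 'f)" for p q :: "nat \<Rightarrow> nat"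
      by (simp add: delta_id_def)
    then show ?thesis
      unfolding young_delta_id[symmetric] by (simp add: row_op_def col_op_def act_def)
  qed
  then show ?thesis by (simp add: central_op_def)
qed

lemma central_op_nonzero: "central_op \<mu> delta_id id \<noteq> (0 :: 'f::field_char_0)"
  using perms_id by (auto simp: central_delta_id)

text \<open>The two sandwich lemmas give one scalar for each order of row and column sum. Both
  describe the square of the nonzero central operator, hence they agree. If the scalar were 0, this
  operator would have square 0, which is impossible for a self-adjoint operator with integer
  coefficients.\<close>

lemma ex_central_const:
  "\<exists>c::'f::field_char_0. c \<noteq> 0 \<and> (\<forall>f. central_op \<mu> (central_op \<mu> f) = (\<lambda>u. c * central_op \<mu> f u)) \<and>
    (\<forall>f. central_op \<mu> (row_op \<mu> (col_op \<mu> f)) = (\<lambda>u. c * row_op \<mu> (col_op \<mu> f) u)) \<and>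
    (\<forall>f. central_op \<mu> (col_op \<mu> (row_op \<mu> f)) = (\<lambda>u. c * col_op \<mu> (row_op \<mu> f) u))"
proof -
  obtain c :: 'f where c: "\<And>f. col_op \<mu> (central_op \<mu> (row_op \<mu> f)) = (\<lambda>u. c * col_op \<mu> (row_op \<mu> f) u)"
    using col_row_sandwich[OF \<mu> group_op_central_op[OF \<mu>]] by blast
  obtain d :: 'f where d: "\<And>f. row_op \<mu> (central_op \<mu> (col_op \<mu> f)) = (\<lambda>u. d * row_op \<mu> (col_op \<mu> f) u)"
    using row_col_sandwich[OF \<mu> group_op_central_op[OF \<mu>]] by blast
  note c' = c[folded central_op_commute[OF group_op_col_op[OF \<mu>]]]
  note d' = d[folded central_op_commute[OF group_op_row_op[OF \<mu>]]]
  have sqc: "central_op \<mu> (central_op \<mu> f) = (\<lambda>u. c * central_op \<mu> f u)" for f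
    by (rule central_op_square_of_young[OF central_op_eq_sum_young' c'])
  have sqd: "central_op \<mu> (central_op \<mu> f) = (\<lambda>u. d * central_op \<mu> f u)" for f
    by (rule central_op_square_of_young[OF central_op_eq_sum_young d'])
  have "c * central_op \<mu> delta_id id = d * central_op \<mu> delta_id id"
    using sqc[of delta_id] sqd[of delta_id] by metis
  then have cd: "c = d" using central_op_nonzero[where 'f = 'f] by simp
  \<comment> \<open>Permutations are orthogonal for this form. Row and column sums are self-adjoint,
    but a Young symmetrizer is not: its adjoint has the two factors exchanged. After averaging,
    \<open>central_op_col_row\<close> repairs this.\<close>
  define ip :: "((nat \<Rightarrow> nat) \<Rightarrow> 'f) \<Rightarrow> ((nat \<Rightarrow> nat) \<Rightarrow> 'f) \<Rightarrow> 'f"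
    where "ip f g = (\<Sum>\<sigma>\<in>perms (psize \<mu>). f \<sigma> * g \<sigma>)" for f g
  have ip_act: "ip (act \<sigma> f) g = ip f (act (pinv \<sigma>) g)" if "\<sigma> \<in> perms (psize \<mu>)" for \<sigma> f g
  proof -
    have "ip f (act (pinv \<sigma>) g) = (\<Sum>\<tau>\<in>perms (psize \<mu>). f (\<tau> \<circ> \<sigma>) * g (\<tau> \<circ> \<sigma> \<circ> pinv \<sigma>))"
      unfolding ip_def act_def
      by (rule sum_right_translate[OF perm_group_perms that, where F = "\<lambda>\<tau>. f \<tau> * g (\<tau> \<circ> pinv \<sigma>)", symmetric])
    then show ?thesis using that by (simp add: ip_def act_def comp_assoc)
  qed
  have ip_sum: "ip (\<lambda>u. \<Sum>i\<in>I. a i * F i u) g = (\<Sum>i\<in>I. a i * ip (F i) g)"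
    "ip g (\<lambda>u. \<Sum>i\<in>I. a i * F i u) = (\<Sum>i\<in>I. a i * ip g (F i))" for g F and a :: "(nat \<Rightarrow> nat) \<Rightarrow> 'f" and I
    unfolding ip_def sum_distrib_left sum_distrib_right
    by (subst sum.swap, simp add: mult_ac)+
  have ip_row: "ip (row_op \<mu> f) g = ip f (row_op \<mu> g)" for f g
  proof -
    have *: "row_op \<mu> f = (\<lambda>u. \<Sum>p\<in>row_group \<mu>. 1 * act p f u)" for f :: "(nat \<Rightarrow> nat) \<Rightarrow> 'f"
      by (simp add: row_op_def act_def)
    have "(\<Sum>p\<in>row_group \<mu>. 1 * ip (act p f) g) = (\<Sum>p\<in>row_group \<mu>. 1 * ip f (act (pinv p) g))"
      by (intro sum.cong refl) (simp add: ip_act row_group_perms[OF \<mu>])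
    also have "\<dots> = (\<Sum>p\<in>row_group \<mu>. 1 * ip f (act p g))"
      by (rule sum_inverse[OF perm_group_row[OF \<mu>], where F = "\<lambda>p. 1 * ip f (act p g)"])
    finally show ?thesis unfolding * ip_sum .
  qed
  have ip_col: "ip (col_op \<mu> f) g = ip f (col_op \<mu> g)" for f g
  proof -
    have *: "col_op \<mu> f = (\<lambda>u. \<Sum>p\<in>column_group \<mu>. of_int (sign p) * act p f u)" for f :: "(nat \<Rightarrow> nat) \<Rightarrow> 'f"
      by (simp add: col_op_def act_def)
    have "(\<Sum>p\<in>column_group \<mu>. of_int (sign p) * ip (act p f) g) =
        (\<Sum>p\<in>column_group \<mu>. of_int (sign (pinv p)) * ip f (act (pinv p) g))"
      by (intro sum.cong refl) (simp add: ip_act column_group_perms[OF \<mu>] sign_inv_perms[OF column_group_perms[OF \<mu>]])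
    also have "\<dots> = (\<Sum>p\<in>column_group \<mu>. of_int (sign p) * ip f (act p g))"
      by (rule sum_inverse[OF perm_group_column[OF \<mu>], where F = "\<lambda>p. of_int (sign p) * ip f (act p g)"])
    finally show ?thesis unfolding * ip_sum .
  qed
  have ip_central: "ip (central_op \<mu> f) g = ip f (central_op \<mu> g)" for f g
    by (subst central_op_eq_sum_young, subst central_op_eq_sum_young', unfold ip_sum, intro sum.cong refl)
       (simp add: ip_act ip_row ip_col perms_inv)
  have "c \<noteq> 0"
  proof
    assume "c = 0"
    then have "ip (central_op \<mu> delta_id) (central_op \<mu> delta_id) = 0"
      by (simp add: ip_central sqc) (simp add: ip_def)
    \<comment> \<open>A sum of squares in the field may vanish without its terms vanishing. The
      values here are integers, where this cannot happen.\<close>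
    moreover have ints: "central_op \<mu> delta_id u \<in> (\<int> :: 'f set)" for u
      unfolding central_op_def row_op_def col_op_def act_def delta_id_def
      by (intro Ints_sum Ints_mult Ints_of_int) auto
    have "\<forall>u. \<exists>i::int. central_op \<mu> delta_id u = (of_int i :: 'f)" using ints Ints_cases by metis
    then obtain i :: "(nat \<Rightarrow> nat) \<Rightarrow> int" where i: "\<And>u. central_op \<mu> delta_id u = (of_int (i u) :: 'f)" by metis
    ultimately have "of_int (\<Sum>\<sigma>\<in>perms (psize \<mu>). i \<sigma> * i \<sigma>) = (0::'f)" by (simp add: ip_def)
    then have "(\<Sum>\<sigma>\<in>perms (psize \<mu>). i \<sigma> * i \<sigma>) = 0" unfolding of_int_eq_0_iff .
    then have "i id = 0" using perms_id by (subst (asm) sum_nonneg_eq_0_iff) auto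
    then show False using central_op_nonzero[where 'f = 'f] i by simp
  qed
  then show ?thesis using c' d' sqc cd by blast
qed

end

text \<open>This scalar is the square of the product of the hook lengths of \<mu>.\<close>

definition central_const :: "(nat \<Rightarrow> nat) \<Rightarrow> 'f::field_char_0" where
  "central_const \<mu> = (SOME c. c \<noteq> 0 \<and> (\<forall>f. central_op \<mu> (central_op \<mu> f) = (\<lambda>u. c * central_op \<mu> f u)) \<and>
    (\<forall>f. central_op \<mu> (row_op \<mu> (col_op \<mu> f)) = (\<lambda>u. c * row_op \<mu> (col_op \<mu> f) u)) \<and>
    (\<forall>f. central_op \<mu> (col_op \<mu> (row_op \<mu> f)) = (\<lambda>u. c * col_op \<mu> (row_op \<mu> f) u)))"

lemma central_const:
  assumes "\<mu> \<in> partitions"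
  shows central_const_nonzero: "central_const \<mu> \<noteq> (0 :: 'f::field_char_0)"
    and central_op_central_op: "central_op \<mu> (central_op \<mu> f) = (\<lambda>u. central_const \<mu> * central_op \<mu> f u :: 'f)"
    and central_op_row_col: "central_op \<mu> (row_op \<mu> (col_op \<mu> f)) = (\<lambda>u. central_const \<mu> * row_op \<mu> (col_op \<mu> f) u :: 'f)"
    and central_op_col_row_op: "central_op \<mu> (col_op \<mu> (row_op \<mu> f)) = (\<lambda>u. central_const \<mu> * col_op \<mu> (row_op \<mu> f) u :: 'f)"
  using someI_ex[OF ex_central_const[OF assms, where 'f = 'f], folded central_const_def] by blast+

text \<open>\<open>col_op_row_op_zero\<close> applies when \<nu> is the smaller partition at the
  first difference, which is the case treated in \<open>main\<close>. The other case follows because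
  the two operators commute.\<close>

lemma central_op_orthogonal:
  fixes f :: "(nat \<Rightarrow> nat) \<Rightarrow> 'f::field_char_0"
  assumes "\<nu> \<in> partitions" "\<mu> \<in> partitions" "psize \<nu> = psize \<mu>" "\<nu> \<noteq> \<mu>"
  shows "central_op \<nu> (central_op \<mu> f) = (\<lambda>u. 0)"
proof -
  have main: "central_op \<nu> (central_op \<mu> f) = (\<lambda>u. 0)"
    if part: "\<nu> \<in> partitions" "\<mu> \<in> partitions" "psize \<nu> = psize \<mu>"
      and l: "\<And>l'. l' < l \<Longrightarrow> \<mu> l' = \<nu> l'" "\<nu> l < \<mu> l" for \<nu> \<mu> l and f :: "(nat \<Rightarrow> nat) \<Rightarrow> 'f"
  proof -
    have z: "col_op \<nu> (act g (act h (row_op \<mu> f'))) = (\<lambda>u. 0)"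
      if "g \<in> perms (psize \<mu>)" "h \<in> perms (psize \<mu>)" for g h and f' :: "(nat \<Rightarrow> nat) \<Rightarrow> 'f"
      unfolding act_act by (rule col_op_row_op_zero[OF part perms_comp[OF that] l])
    have op: "group_op (psize \<nu>) (\<lambda>f. row_op \<nu> (col_op \<nu> (act g f)))" if "g \<in> perms (psize \<nu>)" for g
      by (rule group_op_comp[OF group_op_young[OF part(1)] group_op_act[OF that]])
    have "row_op \<nu> (col_op \<nu> (act (pinv g) (central_op \<mu> f))) = (\<lambda>u. 0)" if "g \<in> perms (psize \<nu>)" for g
      unfolding central_op_eq_sum_young[OF part(2)] group_op_linear[OF op[OF perms_inv[OF that]]]
      using that part(3) by (simp add: z perms_inv group_op_zero[OF group_op_row_op[OF part(1)]])
    then show ?thesis by (intro ext) (simp add: central_op_def[of \<nu>])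
  qed
  obtain l0 where "\<nu> l0 \<noteq> \<mu> l0" using assms(4) by (meson ext)
  then obtain l where l: "\<nu> l \<noteq> \<mu> l" "\<And>l'. l' < l \<Longrightarrow> \<nu> l' = \<mu> l'"
    using exists_least_iff[of "\<lambda>l. \<nu> l \<noteq> \<mu> l"] by blast
  consider "\<nu> l < \<mu> l" | "\<mu> l < \<nu> l" using l(1) by linarith
  then show ?thesis
  proof cases
    case 1
    then show ?thesis using main[OF assms(1-3), of l] l by metis
  next
    case 2
    have "central_op \<nu> (central_op \<mu> f) = central_op \<mu> (central_op \<nu> f)"
      by (rule central_op_commute[OF assms(1)]) (simp add: assms group_op_central_op)
    then show ?thesis using main[OF assms(2,1) assms(3)[symmetric], of l] l 2 by metis
  qed
qed

section \<open>Raising operators and highest weight functions\<close>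

text \<open>Words are infinite so that tensors of all degrees have coordinates of one type; this
  predicate ties a function to degree \<open>n\<close>.\<close>

definition local_fn :: "nat \<Rightarrow> ((nat \<Rightarrow> nat) \<Rightarrow> 'f) \<Rightarrow> bool" where
  "local_fn n f \<longleftrightarrow> (\<forall>u v. (\<forall>x<n. u x = v x) \<longrightarrow> f u = f v)"

definition letter_count :: "nat \<Rightarrow> (nat \<Rightarrow> nat) \<Rightarrow> nat \<Rightarrow> nat" where
  "letter_count n u i = card {p. p < n \<and> u p = i}"

text \<open>The coordinate form of the derivation of the tensor algebra that replaces a letter \<open>b\<close> by \<open>a\<close>.\<close>
definition raise :: "nat \<Rightarrow> nat \<Rightarrow> nat \<Rightarrow> ((nat \<Rightarrow> nat) \<Rightarrow> 'f) \<Rightarrow> (nat \<Rightarrow> nat) \<Rightarrow> 'f::comm_ring_1" where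
  "raise n a b f = (\<lambda>u. \<Sum>p | p < n \<and> u p = a. f (u(p := b)))"

text \<open>\<open>raise n i (Suc i)\<close> is the matrix unit E_(i,i+1) of gl, so these are the
  highest weight vectors of weight \<nu>, together with 0.\<close>

definition highest :: "nat \<Rightarrow> (nat \<Rightarrow> nat) \<Rightarrow> ((nat \<Rightarrow> nat) \<Rightarrow> 'f::comm_ring_1) \<Rightarrow> bool" where
  "highest n \<nu> f \<longleftrightarrow> local_fn n f \<and> (\<forall>u. f u \<noteq> 0 \<longrightarrow> letter_count n u = \<nu>) \<and> (\<forall>i. raise n i (Suc i) f = (\<lambda>u. 0))"

lemma local_fnD: "local_fn n f \<Longrightarrow> (\<And>x. x < n \<Longrightarrow> u x = v x) \<Longrightarrow> f u = f v"
  unfolding local_fn_def by blast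

lemma local_fn_group_op:
  assumes "group_op n T" "local_fn n f" shows "local_fn n (T f)"
proof -
  obtain a where a: "\<And>f u. T f u = (\<Sum>\<sigma>\<in>perms n. a \<sigma> * f (u \<circ> \<sigma>))"
    using assms unfolding group_op_def by blast
  show ?thesis
    unfolding local_fn_def a
    by (intro allI impI sum.cong refl arg_cong[where f = "(*) _"] local_fnD[OF assms(2)]) (auto simp: perms_less)
qed

lemma local_fn_raise: "local_fn n f \<Longrightarrow> local_fn n (raise n a b f)"
  unfolding raise_def local_fn_def by (intro allI impI sum.cong) auto

lemma letter_count_cong: "(\<And>x. x < n \<Longrightarrow> u x = v x) \<Longrightarrow> letter_count n u = letter_count n v"
  unfolding letter_count_def by (intro ext arg_cong[where f = card]) auto

lemma letter_count_comp_perm: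
  assumes "\<sigma> \<in> perms n" shows "letter_count n (u \<circ> \<sigma>) = letter_count n u"
proof
  fix i
  have "bij_betw \<sigma> {x. x < n \<and> u (\<sigma> x) = i} {x. x < n \<and> u x = i}"
    by (rule bij_betw_byWitness[where f' = "pinv \<sigma>"])
       (use assms perms_less[OF assms] perms_less[OF perms_inv[OF assms]] pinv_apply[OF assms] in auto)
  then show "letter_count n (u \<circ> \<sigma>) i = letter_count n u i" by (simp add: letter_count_def bij_betw_same_card)
qed

lemma letter_count_Suc: "letter_count (Suc n) u i = letter_count n u i + (if u n = i then 1 else 0)"
proof -
  have "{p. p < Suc n \<and> u p = i} = (if u n = i then insert n {p. p < n \<and> u p = i} else {p. p < n \<and> u p = i})"
    by (auto simp: less_Suc_eq)
  then show ?thesis by (simp add: letter_count_def)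
qed

lemma letter_count_0 [simp]: "letter_count 0 u = (\<lambda>i. 0)"
  by (auto simp: letter_count_def)

lemma letter_count_upd:
  assumes "p < n"
  shows "letter_count n (u(p := b)) i + (if u p = i then 1 else 0) = letter_count n u i + (if b = i then 1 else 0)"
proof -
  have 1: "card {x. x < n \<and> (u(p := c)) x = i} = card {x. x < n \<and> x \<noteq> p \<and> u x = i} + (if c = i then 1 else 0)" for c
  proof -
    have "{x. x < n \<and> (u(p := c)) x = i} = {x. x < n \<and> x \<noteq> p \<and> u x = i} \<union> (if c = i then {p} else {})"
      using assms by auto
    then show ?thesis by (auto simp: card_insert_if)
  qed
  show ?thesis using 1[of b] 1[of "u p"] by (simp add: letter_count_def)
qed

lemma raise_act:
  assumes "\<sigma> \<in> perms n" shows "raise n a b (act \<sigma> f) = act \<sigma> (raise n a b f)"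
proof
  fix u
  have "(\<Sum>p | p < n \<and> u p = a. f (u(p := b) \<circ> \<sigma>)) = (\<Sum>p | p < n \<and> u (\<sigma> p) = a. f ((u \<circ> \<sigma>)(p := b)))"
  proof (rule sum.reindex_bij_witness[where i = \<sigma> and j = "pinv \<sigma>"])
    fix p assume "p \<in> {p. p < n \<and> u p = a}"
    have "(u \<circ> \<sigma>)(pinv \<sigma> p := b) = u(p := b) \<circ> \<sigma>"
      using pinv_apply[OF assms] by (auto simp: fun_eq_iff)
    then show "f ((u \<circ> \<sigma>)(pinv \<sigma> p := b)) = f (u(p := b) \<circ> \<sigma>)" by simp
  qed (use assms perms_less[OF assms] perms_less[OF perms_inv[OF assms]] pinv_apply[OF assms] in auto)
  then show "raise n a b (act \<sigma> f) u = act \<sigma> (raise n a b f) u"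
    by (simp add: raise_def act_def)
qed

lemma raise_linear: "raise n a b (\<lambda>u. \<Sum>i\<in>I. c i * f i u) = (\<lambda>u. \<Sum>i\<in>I. c i * raise n a b (f i) u)"
  unfolding raise_def sum_distrib_left by (rule ext, rule sum.swap)

lemma raise_scale: "raise n a b (\<lambda>u. c * f u) = (\<lambda>u. c * raise n a b f u)"
  unfolding raise_def sum_distrib_left ..

lemma raise_diff: "raise n a b (\<lambda>u. f u - g u) = (\<lambda>u. raise n a b f u - raise n a b g u)"
  unfolding raise_def by (simp add: sum_subtractf)

lemma raise_group_op:
  assumes "group_op n T" shows "raise n a b (T f) = T (raise n a b f)"
proof -
  obtain c where c: "\<And>f u. T f u = (\<Sum>\<sigma>\<in>perms n. c \<sigma> * f (u \<circ> \<sigma>))"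
    using assms unfolding group_op_def by blast
  have T: "T f = (\<lambda>u. \<Sum>\<sigma>\<in>perms n. c \<sigma> * act \<sigma> f u)" for f by (rule ext) (simp add: c act_def)
  show ?thesis unfolding T raise_linear by (rule ext, rule sum.cong) (simp_all add: raise_act)
qed

lemma letter_count_restrict_group_op:
  assumes "group_op n T"
  shows "T (\<lambda>u. if letter_count n u = \<nu> then f u else 0) = (\<lambda>u. if letter_count n u = \<nu> then T f u else 0)"
proof -
  obtain c where c: "\<And>f u. T f u = (\<Sum>\<sigma>\<in>perms n. c \<sigma> * f (u \<circ> \<sigma>))"
    using assms unfolding group_op_def by blast
  show ?thesis by (rule ext) (auto simp: c letter_count_comp_perm intro!: sum.neutral)
qed

text \<open>This is [E_ab, E_ba] = E_aa - E_bb. Changes at two different places commute. The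
  difference comes from changing one place there and back, which is possible once per letter
  \<open>a\<close> in one order and once per letter \<open>b\<close> in the other.\<close>

lemma raise_commutator:
  assumes "a \<noteq> b"
  shows "raise n a b (raise n b a f) u =
    raise n b a (raise n a b f) u + (of_nat (letter_count n u a) - of_nat (letter_count n u b)) * f u"
proof -
  have half: "raise n a b (raise n b a f) u = of_nat (letter_count n u a) * f u +
      (\<Sum>p | p < n \<and> u p = a. \<Sum>q | q < n \<and> u q = b. f (u(p := b, q := a)))" if "a \<noteq> b" for a b
  proof -
    have "(\<Sum>q | q < n \<and> (u(p := b)) q = b. f (u(p := b, q := a))) =
        f u + (\<Sum>q | q < n \<and> u q = b. f (u(p := b, q := a)))" if p: "p < n" "u p = a" for p
    proof -
      have "{q. q < n \<and> (u(p := b)) q = b} = insert p {q. q < n \<and> u q = b}" using p by auto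
      moreover have "u(p := a) = u" using p by auto
      ultimately show ?thesis using p \<open>a \<noteq> b\<close> by simp
    qed
    then show ?thesis by (simp add: raise_def letter_count_def sum.distrib)
  qed
  have "(\<Sum>p | p < n \<and> u p = a. \<Sum>q | q < n \<and> u q = b. f (u(p := b, q := a))) =
      (\<Sum>q | q < n \<and> u q = b. \<Sum>p | p < n \<and> u p = a. f (u(q := a, p := b)))"
    by (subst sum.swap, intro sum.cong refl arg_cong[where f = f]) (use assms in \<open>auto simp: fun_eq_iff\<close>)
  then show ?thesis using half[of a b] half[of b a] assms by (simp add: algebra_simps)
qed

text \<open>The weight of a highest weight vector of \<open>sl\<^sub>2\<close> is dominant.\<close>
lemma raise_zero_dominant:
  fixes f :: "(nat \<Rightarrow> nat) \<Rightarrow> 'f::field_char_0"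
  assumes ab: "a \<noteq> b" and ker: "raise n a b f = (\<lambda>u. 0)"
    and supp: "\<And>u. f u \<noteq> 0 \<Longrightarrow> letter_count n u a = A \<and> letter_count n u b = B" and AB: "A < B"
  shows "f = (\<lambda>u. 0)"
proof -
  \<comment> \<open>The lowering chain of \<open>f\<close>: each step turns one letter
    \<open>a\<close> of the tensor into \<open>b\<close>.\<close>
  define F where "F k = (raise n b a ^^ k) f" for k
  have F_Suc: "F (Suc k) = raise n b a (F k)" for k by (simp add: F_def)
  have suppF: "letter_count n u a + k = A \<and> letter_count n u b = B + k" if "F k u \<noteq> 0" for k u
    using that
  proof (induction k arbitrary: u)
    case 0
    then show ?case using supp by (simp add: F_def)
  next
    case (Suc k)
    then have "(\<Sum>p | p < n \<and> u p = b. F k (u(p := a))) \<noteq> 0" by (simp add: F_Suc raise_def)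
    then obtain p where p: "p < n" "u p = b" "F k (u(p := a)) \<noteq> 0"
      by (rule sum.not_neutral_contains_not_neutral) auto
    have "letter_count n (u(p := a)) a = letter_count n u a + 1" "letter_count n (u(p := a)) b + 1 = letter_count n u b"
      using letter_count_upd[OF p(1), of u a a] letter_count_upd[OF p(1), of u a b] p(2) ab by auto
    then show ?case using Suc.IH[OF p(3)] by linarith
  qed
  \<comment> \<open>The standard formula for sl2. Because of A < B the factor A - B - k is a
    negative integer, so going back up the chain never loses information.\<close>
  have EF: "raise n a b (F (Suc k)) u = of_nat (Suc k) * (of_nat A - of_nat B - of_nat k) * F k u" for k u
  proof (induction k arbitrary: u)
    case 0
    have "raise n b a (raise n a b f) u = 0" by (simp add: ker) (simp add: raise_def)
    then show ?case
      using raise_commutator[OF ab, of n f u] supp[of u] by (cases "f u = 0") (simp_all add: F_def)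
  next
    case (Suc k)
    have *: "raise n a b (F (Suc k)) = (\<lambda>u. of_nat (Suc k) * (of_nat A - of_nat B - of_nat k) * F k u)"
      using Suc.IH by blast
    have "raise n a b (F (Suc (Suc k))) u = raise n b a (raise n a b (F (Suc k))) u +
        (of_nat (letter_count n u a) - of_nat (letter_count n u b)) * F (Suc k) u"
      unfolding F_Suc[of "Suc k"] by (rule raise_commutator[OF ab])
    also have "raise n b a (raise n a b (F (Suc k))) u = raise n b a (\<lambda>u. of_nat (Suc k) * (of_nat A - of_nat B - of_nat k) * F k u) u"
      by (simp only: *)
    also have "\<dots> =
        of_nat (Suc k) * (of_nat A - of_nat B - of_nat k) * F (Suc k) u"
      by (simp only: raise_scale F_Suc)
    also have "(of_nat (letter_count n u a) - of_nat (letter_count n u b)) * F (Suc k) u =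
        (of_nat A - of_nat B - 2 * of_nat (Suc k)) * F (Suc k) u"
    proof (cases "F (Suc k) u = 0")
      case False
      have "letter_count n u a + Suc k = A" "letter_count n u b = B + Suc k" using suppF[OF False] by auto
      then have "(of_nat (letter_count n u a) :: 'f) = of_nat A - of_nat (Suc k)"
        "(of_nat (letter_count n u b) :: 'f) = of_nat B + of_nat (Suc k)" by auto
      then show ?thesis by (simp only:) (simp add: algebra_simps)
    qed simp
    finally show ?case by (simp add: algebra_simps)
  qed
  have step: "F k = (\<lambda>u. 0)" if "F (Suc k) = (\<lambda>u. 0)" for k
  proof
    fix u
    have "of_nat (Suc k) * (of_nat A - of_nat B - of_nat k) * F k u = 0"
      using EF[of k u] that by (simp add: raise_def)
    moreover have "(of_nat A - of_nat B - of_nat k :: 'f) = - of_nat (B + k - A)"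
      using AB by (simp add: of_nat_diff)
    moreover have "(of_nat (B + k - A) :: 'f) \<noteq> 0" "(of_nat (Suc k) :: 'f) \<noteq> 0"
      using AB unfolding of_nat_eq_0_iff by auto
    ultimately show "F k u = 0" by simp
  qed
  \<comment> \<open>After A + 1 lowerings a word would have to contain fewer than zero letters
    \<open>a\<close>.\<close>
  have top: "F (Suc A) = (\<lambda>u. 0)" using suppF[of "Suc A"] by fastforce
  have "F (Suc A - j) = (\<lambda>u. 0)" if "j \<le> Suc A" for j
    using that
  proof (induction j)
    case (Suc j)
    then show ?case using step[of "A - j"] by (simp add: Suc_diff_le)
  qed (simp add: top)
  from this[of "Suc A"] show ?thesis by (simp add: F_def)
qed

section \<open>Leading words\<close>

text \<open>The last differing place decides. With this choice, freezing the end of a leading word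
  leaves a function of the beginning that is still killed by the raising operators.\<close>

definition word_less :: "nat \<Rightarrow> (nat \<Rightarrow> nat) \<Rightarrow> (nat \<Rightarrow> nat) \<Rightarrow> bool" where
  "word_less n u v \<longleftrightarrow> (\<exists>p<n. u p < v p \<and> (\<forall>x. p < x \<and> x < n \<longrightarrow> u x = v x))"

text \<open>Reading words as numbers in base \<open>B\<close> embeds the order into the natural
  numbers, which provides maxima and a measure for induction.\<close>

definition word_code :: "nat \<Rightarrow> nat \<Rightarrow> (nat \<Rightarrow> nat) \<Rightarrow> nat" where
  "word_code B n u = (\<Sum>p<n. u p * B ^ p)"

lemma word_code_bound: "(\<And>x. x < n \<Longrightarrow> u x < B) \<Longrightarrow> word_code B n u < B ^ n"
proof (induction n)
  case (Suc n)
  then have "word_code B n u < B ^ n" "Suc (u n) \<le> B" by (auto simp: Suc_le_eq)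
  moreover from this(2) have "Suc (u n) * B ^ n \<le> B * B ^ n" by (rule mult_right_mono) simp
  ultimately show ?case by (simp add: word_code_def)
qed (simp add: word_code_def)

lemma word_less_code:
  assumes "word_less n u v" "\<And>x. x < n \<Longrightarrow> u x < B"
  shows "word_code B n u < word_code B n v"
  using assms
proof (induction n)
  case (Suc n)
  show ?case
  proof (cases "u n = v n")
    case True
    have "word_less n u v" using Suc.prems(1) True unfolding word_less_def by (metis less_Suc_eq nat_neq_iff)
    then show ?thesis using Suc True by (simp add: word_code_def)
  next
    case False
    then have "u n < v n" using Suc.prems(1) unfolding word_less_def by (metis less_Suc_eq)
    then have "Suc (u n) * B ^ n \<le> v n * B ^ n" by (intro mult_right_mono) auto
    moreover have "word_code B n u < B ^ n" by (rule word_code_bound) (use Suc.prems in auto)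
    ultimately show ?thesis by (simp add: word_code_def)
  qed
qed (simp add: word_less_def)

lemma word_less_linear:
  assumes "\<not> (\<forall>x<n. u x = v x)" shows "word_less n u v \<or> word_less n v u"
  using assms
proof (induction n)
  case (Suc n)
  show ?case
  proof (cases "u n = v n")
    case True
    then have "word_less n u v \<or> word_less n v u" using Suc by (auto simp: less_Suc_eq)
    then show ?thesis using True unfolding word_less_def by (metis less_Suc_eq)
  next
    case False
    then have "u n < v n \<or> v n < u n" by auto
    then show ?thesis unfolding word_less_def by (metis less_Suc_eq not_less_eq)
  qed
qed simp

lemma word_less_irrefl: "\<not> word_less n u u"
  by (auto simp: word_less_def)

definition yamanouchi :: "nat \<Rightarrow> (nat \<Rightarrow> nat) \<Rightarrow> bool" where
  "yamanouchi n y \<longleftrightarrow> (\<forall>m\<le>n. \<forall>i. letter_count m y (Suc i) \<le> letter_count m y i)"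

lemma letter_count_split:
  assumes "m \<le> n"
  shows "letter_count n u i = letter_count m u i + card {p. m \<le> p \<and> p < n \<and> u p = i}"
proof -
  have "{p. p < n \<and> u p = i} = {p. p < m \<and> u p = i} \<union> {p. m \<le> p \<and> p < n \<and> u p = i}" using assms by auto
  moreover have "{p. p < m \<and> u p = i} \<inter> {p. m \<le> p \<and> p < n \<and> u p = i} = {}" by auto
  moreover have "finite {p. p < m \<and> u p = i}" "finite {p. m \<le> p \<and> p < n \<and> u p = i}" by auto
  ultimately show ?thesis unfolding letter_count_def by (simp only: card_Un_disjoint)
qed

text \<open>Freeze the letters of \<open>y\<close> from place \<open>m\<close> on. The remaining
  function is killed by the raising operators, because a change at a frozen place would lead to a
  word above \<open>y\<close>. Its weight is the content of the first \<open>m\<close> letters of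
  \<open>y\<close>, and \<open>raise_zero_dominant\<close> compares two adjacent letters in
  it.\<close>

lemma leading_word_yamanouchi:
  fixes f :: "(nat \<Rightarrow> nat) \<Rightarrow> 'f::field_char_0"
  assumes hw: "highest n \<nu> f" and y: "f y \<noteq> 0" and max: "\<And>u. f u \<noteq> 0 \<Longrightarrow> \<not> word_less n y u"
  shows "yamanouchi n y"
  unfolding yamanouchi_def
proof (intro allI impI)
  fix m i assume m: "m \<le> n"
  define mer where "mer u = (\<lambda>x. if x < m then u x else y x)" for u :: "nat \<Rightarrow> nat"
  have cn: "letter_count n (mer u) j = letter_count m u j + card {p. m \<le> p \<and> p < n \<and> y p = j}" for u j
  proof -
    have "{p. m \<le> p \<and> p < n \<and> mer u p = j} = {p. m \<le> p \<and> p < n \<and> y p = j}" by (auto simp: mer_def)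
    then show ?thesis using letter_count_split[OF m, of "mer u" j] letter_count_cong[of m "mer u" u] by (simp add: mer_def)
  qed
  have "raise m i (Suc i) (\<lambda>u. f (mer u)) u = 0" for u
  proof -
    have z: "f ((mer u)(p := Suc i)) = 0" if p: "m \<le> p" "p < n" "mer u p = i" for p
    proof (rule ccontr)
      assume "f ((mer u)(p := Suc i)) \<noteq> 0"
      moreover have "word_less n y ((mer u)(p := Suc i))"
        unfolding word_less_def using p by (intro exI[of _ p]) (auto simp: mer_def)
      ultimately show False using max by blast
    qed
    have "0 = raise n i (Suc i) f (mer u)" using hw unfolding highest_def by simp
    also have "\<dots> = (\<Sum>p | p < m \<and> mer u p = i. f ((mer u)(p := Suc i)))"
      unfolding raise_def by (rule sum.mono_neutral_right) (use m z in \<open>auto intro: ccontr simp: not_less\<close>)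
    also have "\<dots> = raise m i (Suc i) (\<lambda>u. f (mer u)) u"
      unfolding raise_def by (intro sum.cong arg_cong[where f = f]) (auto simp: mer_def fun_eq_iff)
    finally show ?thesis by simp
  qed
  then have ker: "raise m i (Suc i) (\<lambda>u. f (mer u)) = (\<lambda>u. 0)" by blast
  have my: "mer y = y" by (auto simp: mer_def)
  have "letter_count m u j = letter_count m y j" if "f (mer u) \<noteq> 0" for u j
  proof -
    have "letter_count n (mer u) = letter_count n (mer y)" using hw that y my unfolding highest_def by metis
    then show ?thesis using cn[of u j] cn[of y j] by simp
  qed
  then have "\<not> letter_count m y i < letter_count m y (Suc i)"
    using raise_zero_dominant[OF _ ker, of "letter_count m y i" "letter_count m y (Suc i)"] my y by (metis n_not_Suc_n)
  then show "letter_count m y (Suc i) \<le> letter_count m y i" by simp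
qed

lemma sum_letter_count:
  assumes "\<And>x. x < n \<Longrightarrow> u x < B" shows "(\<Sum>i<B. letter_count n u i) = n"
  using assms by (induction n) (simp_all add: letter_count_Suc sum.distrib)

lemma letter_count_eq_0:
  assumes "\<And>x. x < n \<Longrightarrow> u x < B" "B \<le> i" shows "letter_count n u i = 0"
proof -
  have "{p. p < n \<and> u p = i} = {}" using assms by fastforce
  then show ?thesis by (simp add: letter_count_def)
qed

lemma word_letters_bound:
  fixes u :: "nat \<Rightarrow> nat"
  obtains B where "\<And>x. x < n \<Longrightarrow> u x < (B::nat)"
proof -
  have "finite (u ` {..<n})" by simp
  then obtain B where "\<forall>i\<in>u ` {..<n}. i < B" using finite_nat_set_iff_bounded by blast
  then show ?thesis using that by auto
qed

lemma letter_count_psize: "psize (letter_count n u) = n"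
proof -
  obtain B where B: "\<And>x. x < n \<Longrightarrow> u x < B" using word_letters_bound[of n u] by blast
  show ?thesis using psize_eq_sum[of B "letter_count n u"] letter_count_eq_0[OF B] sum_letter_count[OF B] by simp
qed

lemma antimono_letter_count:
  assumes "\<And>i. letter_count n u (Suc i) \<le> letter_count n u i" shows "letter_count n u \<in> partitions"
proof -
  obtain B where B: "\<And>x. x < n \<Longrightarrow> u x < B" using word_letters_bound[of n u] by blast
  have "{i. letter_count n u i \<noteq> 0} \<subseteq> {..<B}" using letter_count_eq_0[OF B] by (intro subsetI) (force simp: not_le intro: ccontr)
  then have "finite {i. letter_count n u i \<noteq> 0}" by (rule finite_subset) simp
  moreover have "antimono (letter_count n u)" using assms by (rule decseq_SucI)
  ultimately show ?thesis by (simp add: partitions_def)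
qed

lemma letter_count_mono: "m \<le> n \<Longrightarrow> letter_count m u i \<le> letter_count n u i"
  using letter_count_split[of m n u i] by simp

lemma letter_count_strict: "p < n \<Longrightarrow> letter_count p u (u p) < letter_count n u (u p)"
  using letter_count_mono[of "Suc p" n u "u p"] by (simp add: letter_count_Suc)

lemma yamanouchi_antimono: "yamanouchi n y \<Longrightarrow> m \<le> n \<Longrightarrow> i \<le> j \<Longrightarrow> letter_count m y j \<le> letter_count m y i"
  unfolding yamanouchi_def using decseq_SucI[of "letter_count m y"] by (auto simp: antimono_def)

text \<open>A Yamanouchi word is read as a standard tableau: the position of the \<open>j\<close>-th letter \<open>i\<close> is the
  entry of the cell \<open>(i, j)\<close>.\<close>
lemma yamanouchi_standard_tableau:
  assumes y: "yamanouchi n y"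
  obtains g where "g \<in> perms n" "\<And>x. x < n \<Longrightarrow> y (g x) = row_of (letter_count n y) x"
    "\<And>x x'. x < n \<Longrightarrow> x' < n \<Longrightarrow> col_of (letter_count n y) x = col_of (letter_count n y) x' \<Longrightarrow>
       row_of (letter_count n y) x < row_of (letter_count n y) x' \<Longrightarrow> g x < g x'"
proof -
  define \<nu> where "\<nu> = letter_count n y"
  have \<nu>: "\<nu> \<in> partitions" unfolding \<nu>_def by (rule antimono_letter_count) (use y in \<open>auto simp: yamanouchi_def\<close>)
  have ps: "psize \<nu> = n" by (simp add: \<nu>_def letter_count_psize)
  define h where "h p = (if p < n then tableau \<nu> (y p) (letter_count p y (y p)) else p)" for p
  have c: "letter_count p y (y p) < \<nu> (y p)" if "p < n" for p
    using letter_count_strict[OF that] by (simp add: \<nu>_def)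
  have rc: "row_of \<nu> (h p) = y p" "col_of \<nu> (h p) = letter_count p y (y p)" if "p < n" for p
    using c[OF that] that by (simp_all add: h_def row_col_tableau)
  have "inj_on h {..<n}"
  proof (rule inj_onI, simp)
    fix p p' assume p: "p < n" "p' < n" "h p = h p'"
    then have e: "y p = y p'" "letter_count p y (y p) = letter_count p' y (y p)" using rc by metis+
    show "p = p'" using letter_count_strict[of p p' y] letter_count_strict[of p' p y] e by (cases p p' rule: linorder_cases) auto
  qed
  moreover have "h ` {..<n} \<subseteq> {..<n}" using c tableau_less[OF \<nu>] by (auto simp: h_def ps)
  ultimately have "bij_betw h {..<n} {..<n}" by (simp add: bij_betw_def endo_inj_surj)
  then have h: "h \<in> perms n" unfolding perms_def using bij_imp_permutes[of h "{..<n}"] by (auto simp: h_def)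
  have gl: "pinv h x < n" if "x < n" for x using perms_less[OF perms_inv[OF h]] that by simp
  show ?thesis
  proof (rule that[of "pinv h"])
    show "pinv h \<in> perms n" using h by (rule perms_inv)
    show "y (pinv h x) = row_of (letter_count n y) x" if "x < n" for x
      using rc(1)[OF gl[OF that]] pinv_apply[OF h] by (simp add: \<nu>_def)
    fix x x' assume x: "x < n" "x' < n" and cr: "col_of (letter_count n y) x = col_of (letter_count n y) x'"
      "row_of (letter_count n y) x < row_of (letter_count n y) x'"
    define p p' where pp: "p = pinv h x" "p' = pinv h x'"
    have l: "p < n" "p' < n" using gl x by (auto simp: pp)
    have hx: "h p = x" "h p' = x'" using pinv_apply[OF h] by (auto simp: pp)
    have e: "letter_count p y (y p) = letter_count p' y (y p')" "y p < y p'"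
      using cr rc[OF l(1)] rc[OF l(2)] unfolding hx \<nu>_def[symmetric] by auto
    \<comment> \<open>\<open>y p'\<close> is the larger letter, so by the Yamanouchi condition it
      occurs before \<open>p\<close> at most as often as \<open>y p\<close>. An occurrence at a
      place \<open>p'\<close> before \<open>p\<close> would be one too many.\<close>
    have "\<not> p' \<le> p"
    proof
      assume "p' \<le> p"
      moreover have "p \<noteq> p'" using e by auto
      ultimately have "p' < p" by simp
      then have "letter_count p' y (y p') < letter_count p y (y p')" by (rule letter_count_strict)
      also have "\<dots> \<le> letter_count p y (y p)" by (rule yamanouchi_antimono[OF y]) (use l e in auto)
      finally show False using e by simp
    qed
    then show "pinv h x < pinv h x'" by (simp add: pp)
  qed
qed

section \<open>Polytabloids\<close>

lemma sum_filter_less: "(\<Sum>p | p < n \<and> P p. g p) = (\<Sum>p<(n::nat). if P p then g p else 0)"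
  by (subst sum.inter_filter[symmetric]) (auto intro: sum.cong)

definition word_delta :: "nat \<Rightarrow> (nat \<Rightarrow> nat) \<Rightarrow> (nat \<Rightarrow> nat) \<Rightarrow> 'f::field_char_0" where
  "word_delta n w = (\<lambda>u. if \<forall>x<n. u x = w x then 1 else 0)"

lemma word_delta_upd:
  assumes "p < n"
  shows "(if u p = i then word_delta n w (u(p := j)) else 0) = (if w p = j then word_delta n (w(p := i)) u else (0::'f::field_char_0))"
proof -
  have "(u p = i \<and> (\<forall>x<n. (u(p := j)) x = w x)) \<longleftrightarrow> (w p = j \<and> (\<forall>x<n. u x = (w(p := i)) x))"
    using assms by (metis fun_upd_same fun_upd_other)
  then show ?thesis unfolding word_delta_def by argo
qed

lemma local_word_delta: "local_fn n (word_delta n w)"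
  by (auto simp: local_fn_def word_delta_def)

lemma act_word_delta:
  assumes "\<sigma> \<in> perms n" shows "act \<sigma> (word_delta n w) = word_delta n (w \<circ> pinv \<sigma>)"
proof
  fix u
  have "(\<forall>x<n. u (\<sigma> x) = w x) \<longleftrightarrow> (\<forall>x<n. u x = w (pinv \<sigma> x))"
    using pinv_apply[OF assms] perms_less[OF assms] perms_less[OF perms_inv[OF assms]] by metis
  then show "act \<sigma> (word_delta n w) u = word_delta n (w \<circ> pinv \<sigma>) u"
    by (simp add: act_def word_delta_def)
qed

context
  fixes \<mu> :: "nat \<Rightarrow> nat"
  assumes \<mu>: "\<mu> \<in> partitions"
begin

text \<open>Raising turns a letter i + 1 of the row word into i, which then occurs twice in its
  column, and the column sum kills such a word.\<close>

lemma raise_col_op_row_word: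
  "raise (psize \<mu>) i (Suc i) (col_op \<mu> (word_delta (psize \<mu>) (row_of \<mu>))) = (\<lambda>u. 0 :: 'f::field_char_0)"
proof -
  let ?n = "psize \<mu>" and ?w = "row_of \<mu>"
  have r: "raise ?n i (Suc i) (word_delta ?n ?w :: (nat \<Rightarrow> nat) \<Rightarrow> 'f) = (\<lambda>u. \<Sum>p | p < ?n \<and> ?w p = Suc i. 1 * word_delta ?n (?w(p := i)) u)"
  proof
    fix u
    have *: "(if u p = i then word_delta ?n ?w (u(p := Suc i)) else 0) =
      (if ?w p = Suc i then 1 * word_delta ?n (?w(p := i)) u else (0::'f))" if "p < ?n" for p
      using word_delta_upd[OF that, of u i ?w, where 'f = 'f] by simp
    have "raise ?n i (Suc i) (word_delta ?n ?w) u = (\<Sum>p<?n. if u p = i then word_delta ?n ?w (u(p := Suc i)) else (0::'f))"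
      unfolding raise_def by (rule sum_filter_less)
    also have "\<dots> = (\<Sum>p<?n. if ?w p = Suc i then 1 * word_delta ?n (?w(p := i)) u else 0)"
      by (rule sum.cong) (simp_all add: *)
    also have "\<dots> = (\<Sum>p | p < ?n \<and> ?w p = Suc i. 1 * word_delta ?n (?w(p := i)) u)"
      by (rule sum_filter_less[symmetric])
    finally show "raise ?n i (Suc i) (word_delta ?n ?w) u = (\<Sum>p | p < ?n \<and> ?w p = Suc i. 1 * word_delta ?n (?w(p := i)) u :: 'f)" .
  qed
  have z: "col_op \<mu> (word_delta ?n (?w(p := i))) = (\<lambda>u. 0 :: 'f)" if p: "p < ?n" "?w p = Suc i" for p
  proof -
    define p' where "p' = tableau \<mu> i (col_of \<mu> p)"
    have cl: "col_of \<mu> p < \<mu> i"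
      using col_of_less[OF \<mu> p(1)] p(2) partitions_antimono[OF \<mu>, of i "Suc i"] by auto
    have p': "p' < ?n" "?w p' = i" "col_of \<mu> p' = col_of \<mu> p"
      using cl tableau_less[OF \<mu> cl] by (simp_all add: p'_def row_col_tableau)
    have "act (transpose p p') (word_delta ?n (?w(p := i))) = word_delta ?n (?w(p := i) \<circ> pinv (transpose p p'))"
      by (rule act_word_delta) (use p p' permutes_swap_id[of p "{..<?n}" p'] in \<open>auto simp: perms_def\<close>)
    also have "?w(p := i) \<circ> pinv (transpose p p') = ?w(p := i)"
      using p p' by (auto simp: fun_eq_iff transpose_def)
    finally have "act (transpose p p') (word_delta ?n (?w(p := i))) = (word_delta ?n (?w(p := i)) :: _ \<Rightarrow> 'f)" .
    then show ?thesis using col_op_symmetric_zero[OF \<mu>, of p p'] p p' by force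
  qed
  show ?thesis
    unfolding raise_group_op[OF group_op_col_op[OF \<mu>]] r group_op_linear[OF group_op_col_op[OF \<mu>]]
    by (rule ext) (simp add: z)
qed

text \<open>The row word is fixed by the row group. Up to the order of this group it is therefore
  its own row sum, and \<open>central_op_col_row_op\<close> applies.\<close>

lemma central_op_col_row_word:
  "central_op \<mu> (col_op \<mu> (word_delta (psize \<mu>) (row_of \<mu>))) =
    (\<lambda>u. central_const \<mu> * col_op \<mu> (word_delta (psize \<mu>) (row_of \<mu>)) u :: 'f::field_char_0)"
proof -
  let ?n = "psize \<mu>" and ?w = "row_of \<mu>"
  let ?d = "word_delta ?n ?w :: (nat \<Rightarrow> nat) \<Rightarrow> 'f"
  let ?k = "of_nat (card (row_group \<mu>)) :: 'f"
  have "?d (u \<circ> p) = ?d u" if p: "p \<in> row_group \<mu>" for p u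
  proof -
    have pp: "p \<in> perms ?n" using p row_group_perms[OF \<mu>] by blast
    have *: "\<And>x. x < ?n \<Longrightarrow> ?w (p x) = ?w x" using p by (auto simp: row_group_eq[OF \<mu>])
    have "(\<forall>x<?n. u (p x) = ?w x) \<longleftrightarrow> (\<forall>x<?n. u x = ?w x)"
      using pinv_apply[OF pp] perms_less[OF pp] perms_less[OF perms_inv[OF pp]] * by metis
    then show ?thesis by (simp add: word_delta_def)
  qed
  then have r: "row_op \<mu> ?d = (\<lambda>u. ?k * ?d u)" by (simp add: row_op_def)
  have k: "?k \<noteq> 0"
    using perm_group_row[OF \<mu>] perm_group_finite[OF perm_group_row[OF \<mu>]] by (auto simp: perm_group_def)
  have "(\<lambda>u. ?k * central_op \<mu> (col_op \<mu> ?d) u) = (\<lambda>u. ?k * (central_const \<mu> * col_op \<mu> ?d u))"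
    using central_op_col_row_op[OF \<mu>, of ?d] unfolding r
    by (simp add: group_op_scale[OF group_op_col_op[OF \<mu>]] group_op_scale[OF group_op_central_op[OF \<mu>]] mult.left_commute)
  then have "?k * central_op \<mu> (col_op \<mu> ?d) u = ?k * (central_const \<mu> * col_op \<mu> ?d u)" for u by metis
  then show ?thesis using k by auto
qed

end

text \<open>\<open>e\<close> is the polytabloid of the standard tableau that belongs to
  \<open>y\<close>. Standardness makes \<open>y\<close> its leading word: among the cells moved by a
  column permutation take the one with the largest tableau entry; the letter it receives comes from
  a row further up and is therefore smaller.\<close>

lemma polytabloid:
  assumes y: "yamanouchi n y"
  obtains e :: "(nat \<Rightarrow> nat) \<Rightarrow> 'f::field_char_0" where
    "highest n (letter_count n y) e" "central_op (letter_count n y) e = (\<lambda>u. central_const (letter_count n y) * e u)"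
    "e y = 1" "\<And>u. e u \<noteq> 0 \<Longrightarrow> (\<forall>x<n. u x = y x) \<or> word_less n u y"
proof -
  define \<nu> where "\<nu> = letter_count n y"
  have \<nu>: "\<nu> \<in> partitions" unfolding \<nu>_def by (rule antimono_letter_count) (use y in \<open>auto simp: yamanouchi_def\<close>)
  have ps: "psize \<nu> = n" by (simp add: \<nu>_def letter_count_psize)
  obtain g where g: "g \<in> perms n" "\<And>x. x < n \<Longrightarrow> y (g x) = row_of \<nu> x"
    "\<And>x x'. x < n \<Longrightarrow> x' < n \<Longrightarrow> col_of \<nu> x = col_of \<nu> x' \<Longrightarrow> row_of \<nu> x < row_of \<nu> x' \<Longrightarrow> g x < g x'"
    using yamanouchi_standard_tableau[OF y] unfolding \<nu>_def by blast
  define d where "d = (word_delta n (row_of \<nu>) :: (nat \<Rightarrow> nat) \<Rightarrow> 'f)"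
  define e where "e = act g (col_op \<nu> d)"
  have opg: "group_op n (act g)" by (rule group_op_act[OF g(1)])
  have opc: "group_op n (\<lambda>f. act g (col_op \<nu> f))"
    by (rule group_op_comp[OF opg]) (use group_op_col_op[OF \<nu>] ps in simp)
  have e_eq: "e u = (\<Sum>q\<in>column_group \<nu>. of_int (sign q) * d (u \<circ> g \<circ> q))" for u
    by (simp add: e_def act_def col_op_def)
  have lead: "(q = id \<and> (\<forall>x<n. u x = y x)) \<or> (q \<noteq> id \<and> word_less n u y)"
    if q: "q \<in> column_group \<nu>" and du: "\<And>x. x < n \<Longrightarrow> u (g (q x)) = row_of \<nu> x" for q u
  proof (cases "q = id")
    case True
    have "u x = y x" if "x < n" for x
    proof -
      have x: "pinv g x < n" using perms_less[OF perms_inv[OF g(1)]] that by simp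
      then show ?thesis using du[OF x] g(2)[OF x] True pinv_apply[OF g(1)] by simp
    qed
    then show ?thesis using True by simp
  next
    case False
    have qp: "q \<in> perms n" using q column_group_perms[OF \<nu>] ps by auto
    define r where "r = pinv q"
    have r: "r \<in> column_group \<nu>" using q perm_group_column[OF \<nu>] by (auto simp: perm_group_def r_def)
    have rp: "r \<in> perms n" by (simp add: r_def perms_inv qp)
    have rc: "col_of \<nu> (r x) = col_of \<nu> x" if "x < n" for x using r that by (auto simp: column_group_eq[OF \<nu>] ps)
    have rinj: "r x = r x' \<longleftrightarrow> x = x'" for x x' using perms_bij[OF rp] by (auto simp: bij_def inj_def)
    have u: "u (g x) = row_of \<nu> (r x)" if "x < n" for x
      using du[of "r x"] perms_less[OF rp] that pinv_apply[OF qp] by (simp add: r_def)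
    define D where "D = {x. x < n \<and> r x \<noteq> x}"
    have "D \<noteq> {}"
    proof
      assume "D = {}"
      then have "r x = x" for x using rp by (cases "x < n") (auto simp: D_def perms_def permutes_def)
      then have "r = id" by auto
      then have "q = id" using perms_inv_inv[OF qp] by (simp add: r_def)
      then show False using False by simp
    qed
    moreover have "finite D" by (simp add: D_def)
    ultimately have "Max (g ` D) \<in> g ` D" by (intro Max_in) auto
    then obtain x where "x \<in> D" "g x = Max (g ` D)" by auto
    then have x: "x \<in> D" "\<And>x'. x' \<in> D \<Longrightarrow> g x' \<le> g x" using \<open>finite D\<close> by auto
    have xn: "x < n" "r x < n" "r x \<in> D" using x perms_less[OF rp] rinj by (auto simp: D_def)
    have "g (r x) \<noteq> g x" using x perms_bij[OF g(1)] by (auto simp: D_def bij_def inj_def)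
    then have "g (r x) < g x" using x(2)[OF xn(3)] by simp
    then have "\<not> row_of \<nu> x < row_of \<nu> (r x)" using g(3)[OF xn(1,2)] rc[OF xn(1)] by auto
    moreover have "row_of \<nu> x \<noteq> row_of \<nu> (r x)"
      using row_col_inj[OF \<nu>, of x "r x"] rc[OF xn(1)] xn x(1) by (auto simp: ps D_def)
    ultimately have "u (g x) < y (g x)" using u[OF xn(1)] g(2)[OF xn(1)] by simp
    moreover have "u p = y p" if p: "g x < p" "p < n" for p
    proof -
      have pn: "pinv g p < n" using perms_less[OF perms_inv[OF g(1)]] p by simp
      have gp: "g (pinv g p) = p" using pinv_apply[OF g(1)] by simp
      then have "pinv g p \<notin> D" using x(2)[of "pinv g p"] p by auto
      then have "r (pinv g p) = pinv g p" using pn by (simp add: D_def)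
      then show ?thesis using u[OF pn] g(2)[OF pn] gp by simp
    qed
    ultimately have "word_less n u y" unfolding word_less_def using perms_less[OF g(1)] xn by blast
    then show ?thesis using False by simp
  qed
  have ecl: "(\<forall>x<n. u x = y x) \<or> word_less n u y" if "e u \<noteq> 0" for u
  proof -
    obtain q where "q \<in> column_group \<nu>" "d (u \<circ> g \<circ> q) \<noteq> 0"
      using \<open>e u \<noteq> 0\<close> unfolding e_eq by (rule sum.not_neutral_contains_not_neutral) auto
    then show ?thesis using lead[of q u] by (auto simp: d_def word_delta_def split: if_splits)
  qed
  have "of_int (sign q) * d (y \<circ> g \<circ> q) = (if q = id then 1 else 0)" if "q \<in> column_group \<nu>" for q
    using lead[OF that, of y] word_less_irrefl[of n y] g(2) by (auto simp: d_def word_delta_def sign_id)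
  then have "e y = (\<Sum>q\<in>column_group \<nu>. if q = id then 1 else 0)" unfolding e_eq by (rule sum.cong[OF refl])
  also have "\<dots> = 1"
    using perm_group_column[OF \<nu>] perm_group_finite[OF perm_group_column[OF \<nu>]] by (auto simp: perm_group_def)
  finally have ey: "e y = 1" .
  have "letter_count n u = \<nu>" if "e u \<noteq> 0" for u
  proof -
    obtain q where q: "q \<in> column_group \<nu>" "d (u \<circ> g \<circ> q) \<noteq> 0"
      using \<open>e u \<noteq> 0\<close> unfolding e_eq by (rule sum.not_neutral_contains_not_neutral) auto
    then have "\<And>x. x < n \<Longrightarrow> (u \<circ> g \<circ> q) x = row_of \<nu> x" by (auto simp: d_def word_delta_def split: if_splits)
    then have "letter_count n (u \<circ> g \<circ> q) = letter_count n (row_of \<nu>)" by (rule letter_count_cong)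
    also have "\<dots> = \<nu>" using card_row[OF \<nu>] by (auto simp: letter_count_def ps)
    finally show ?thesis
      using letter_count_comp_perm[OF g(1)] letter_count_comp_perm[of q n "u \<circ> g"] q(1) column_group_perms[OF \<nu>, of q] ps by auto
  qed
  moreover have "local_fn n e"
    unfolding e_def d_def by (rule local_fn_group_op[OF opc local_word_delta])
  moreover have "raise n i (Suc i) e = (\<lambda>u. 0)" for i
    using raise_col_op_row_word[OF \<nu>, of i, where 'f = 'f] group_op_zero[OF opg]
    unfolding e_def raise_group_op[OF opg] ps d_def by simp
  ultimately have "highest n \<nu> e" by (simp add: highest_def)
  moreover have "central_op \<nu> e = (\<lambda>u. central_const \<nu> * e u)"
    using central_op_col_row_word[OF \<nu>, where 'f = 'f] central_op_act[OF \<nu>, of g "col_op \<nu> d"] g(1)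
    by (simp add: e_def d_def ps) (simp add: act_def)
  ultimately show ?thesis using that[of e] ey ecl by (simp add: \<nu>_def)
qed

text \<open>All words of the support have the same content, hence the same letters as
  \<open>y\<close>.\<close>

lemma highest_bounded:
  assumes "highest n \<nu> f" "f y \<noteq> 0"
  obtains B where "\<And>u x. f u \<noteq> 0 \<Longrightarrow> x < n \<Longrightarrow> u x < B"
proof -
  obtain B where B: "\<And>x. x < n \<Longrightarrow> y x < B" using word_letters_bound[of n y] by blast
  have "u x < B" if "f u \<noteq> 0" "x < n" for u x
  proof (rule ccontr)
    assume "\<not> u x < B"
    then have "letter_count n y (u x) = 0" using letter_count_eq_0[OF B] by simp
    moreover have "letter_count n y = letter_count n u" using assms that unfolding highest_def by metis
    moreover have "letter_count n u (u x) > 0" using letter_count_strict[OF that(2), of u] by simp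
    ultimately show False by simp
  qed
  then show ?thesis using that by blast
qed

lemma highest_weight_partition:
  fixes f :: "(nat \<Rightarrow> nat) \<Rightarrow> 'f::field_char_0"
  assumes hw: "highest n \<nu> f" and f: "f \<noteq> (\<lambda>u. 0)"
  shows "\<exists>y B. f y \<noteq> 0 \<and> yamanouchi n y \<and> letter_count n y = \<nu> \<and>
    (\<forall>u. f u \<noteq> 0 \<longrightarrow> (\<forall>x<n. u x < B)) \<and> (\<forall>u. f u \<noteq> 0 \<longrightarrow> word_code B n u \<le> word_code B n y)"
proof -
  obtain y0 where y0: "f y0 \<noteq> 0" using f by blast
  obtain B where B: "\<And>u x. f u \<noteq> 0 \<Longrightarrow> x < n \<Longrightarrow> u x < B" using highest_bounded[OF hw y0] by blast
  have bd: "word_code B n u < B ^ n" if "f u \<noteq> 0" for u using word_code_bound[of n u B] B[OF that] by blast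
  have "\<forall>u. f u \<noteq> 0 \<longrightarrow> word_code B n u < B ^ n" using bd by blast
  from ex_has_greatest_nat[of "\<lambda>u. f u \<noteq> 0", OF y0 this]
  obtain y where y: "f y \<noteq> 0" "\<And>u. f u \<noteq> 0 \<Longrightarrow> word_code B n u \<le> word_code B n y"
    by blast
  have "\<not> word_less n y u" if "f u \<noteq> 0" for u
    using word_less_code[of n y u B] B[OF y(1)] y(2)[OF that] by auto
  then have "yamanouchi n y" by (rule leading_word_yamanouchi[OF hw y(1)])
  moreover have "letter_count n y = \<nu>" using hw y(1) by (auto simp: highest_def)
  ultimately show ?thesis using y B by blast
qed

lemma highest_partition:
  assumes "highest n \<nu> f" "f \<noteq> (\<lambda>u. 0 :: 'f::field_char_0)"
  shows "\<nu> \<in> partitions" "psize \<nu> = n"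
  using highest_weight_partition[OF assms] antimono_letter_count[of n] letter_count_psize[of n] by (auto simp: yamanouchi_def)

text \<open>Successively subtracting polytabloids with the same leading word exhausts a highest weight function.\<close>
theorem central_op_highest:
  fixes f :: "(nat \<Rightarrow> nat) \<Rightarrow> 'f::field_char_0"
  assumes hw: "highest n \<nu> f"
  shows "central_op \<nu> f = (\<lambda>u. central_const \<nu> * f u)"
proof (cases "f = (\<lambda>u. 0)")
  case True
  then show ?thesis by (simp add: central_op_def row_op_def col_op_def act_def)
next
  case False
  obtain y0 where y0: "f y0 \<noteq> 0" using False by blast
  obtain B where B: "\<And>u x. f u \<noteq> 0 \<Longrightarrow> x < n \<Longrightarrow> u x < B" using highest_bounded[OF hw y0] by blast
  note part = highest_partition[OF hw False]
  note lin = group_op_central_op[OF part(1)]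
  \<comment> \<open>Induction on a strict bound \<open>N\<close> for the codes of the support. The
    alphabet bound \<open>B\<close> stays fixed, since all words involved have content
    \<nu>.\<close>
  have main: "central_op \<nu> f = (\<lambda>u. central_const \<nu> * f u)"
    if "highest n \<nu> f" "\<And>u x. f u \<noteq> 0 \<Longrightarrow> x < n \<Longrightarrow> u x < B" "\<And>u. f u \<noteq> 0 \<Longrightarrow> word_code B n u < N"
    for f :: "(nat \<Rightarrow> nat) \<Rightarrow> 'f" and N
    using that
  proof (induction N arbitrary: f)
    case 0
    then have "f = (\<lambda>u. 0)" by auto
    then show ?case by (simp add: group_op_zero[OF lin])
  next
    case (Suc N)
    show ?case
    proof (cases "\<exists>y. f y \<noteq> 0 \<and> word_code B n y = N")
      case False
      then have "word_code B n u < N" if "f u \<noteq> 0" for u using Suc.prems(3)[OF that] that by (metis less_SucE)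
      then show ?thesis using Suc.IH[of f] Suc.prems(1,2) by blast
    next
      case True
      then obtain y where y: "f y \<noteq> 0" "word_code B n y = N" by blast
      have "\<not> word_less n y u" if "f u \<noteq> 0" for u
        using word_less_code[of n y u B] Suc.prems(2)[OF y(1)] Suc.prems(3)[OF that] y(2) by fastforce
      then have yam: "yamanouchi n y" by (rule leading_word_yamanouchi[OF Suc.prems(1) y(1)])
      have cy: "letter_count n y = \<nu>" using Suc.prems(1) y by (auto simp: highest_def)
      obtain e :: "(nat \<Rightarrow> nat) \<Rightarrow> 'f" where e: "highest n \<nu> e" "central_op \<nu> e = (\<lambda>u. central_const \<nu> * e u)"
        "e y = 1" "\<And>u. e u \<noteq> 0 \<Longrightarrow> (\<forall>x<n. u x = y x) \<or> word_less n u y"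
        using polytabloid[OF yam] unfolding cy by blast
      \<comment> \<open>The subtraction removes the word \<open>y\<close> of code \<open>N\<close>
        from the support. Whatever \<open>e\<close> adds lies below \<open>y\<close>, so
        \<open>N\<close> becomes a strict bound.\<close>
      define f' where "f' = (\<lambda>u. f u - f y * e u)"
      have hw': "highest n \<nu> f'"
        unfolding highest_def
      proof (intro conjI allI impI)
        show "local_fn n f'"
          using Suc.prems(1) e(1) unfolding highest_def f'_def local_fn_def by metis
        show "letter_count n u = \<nu>" if "f' u \<noteq> 0" for u
          using that Suc.prems(1) e(1) unfolding highest_def f'_def by (cases "f u = 0") auto
        show "raise n i (Suc i) f' = (\<lambda>u. 0)" for i
          using Suc.prems(1) e(1) unfolding highest_def f'_def raise_diff raise_scale by simp
      qed
      have bd': "u x < B" if "f' u \<noteq> 0" "x < n" for u x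
      proof -
        have "letter_count n u = letter_count n y" using hw' that cy by (auto simp: highest_def)
        moreover have "letter_count n u (u x) > 0" using letter_count_strict[OF that(2), of u] by simp
        ultimately have "letter_count n y (u x) > 0" by simp
        then show ?thesis using letter_count_eq_0[of n y B "u x"] Suc.prems(2)[OF y(1)] by (metis neq0_conv not_less)
      qed
      have "word_code B n u < N" if u: "f' u \<noteq> 0" for u
      proof (cases "\<forall>x<n. u x = y x")
        case True
        then have "f' u = f' y" using hw' by (auto simp: highest_def intro: local_fnD)
        then show ?thesis using u e(3) by (simp add: f'_def)
      next
        case ne: False
        show ?thesis
        proof (cases "word_less n u y")
          case True
          then show ?thesis using word_less_code[OF True] bd'[OF u] y(2) by blast
        next
          case False
          then have "e u = 0" using e(4) ne by blast
          then have fu: "f u \<noteq> 0" using u by (auto simp: f'_def)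
          have "word_less n y u" using word_less_linear[OF ne] False by blast
          then have "word_code B n y < word_code B n u" by (rule word_less_code) (rule Suc.prems(2)[OF y(1)])
          then show ?thesis using Suc.prems(3)[OF fu] y(2) by simp
        qed
      qed
      then have IH: "central_op \<nu> f' = (\<lambda>u. central_const \<nu> * f' u)" using Suc.IH[of f'] hw' bd' by blast
      have "central_op \<nu> f' = (\<lambda>u. central_op \<nu> f u - f y * (central_const \<nu> * e u))"
        unfolding f'_def by (simp add: group_op_diff[OF lin] group_op_scale[OF lin] e(2))
      then have "central_op \<nu> f u - f y * (central_const \<nu> * e u) = central_const \<nu> * (f u - f y * e u)" for u
        using IH unfolding f'_def by metis
      then have "central_op \<nu> f u = central_const \<nu> * f u" for u
        by (metis (no_types, lifting) diff_add_cancel mult.left_commute right_diff_distrib)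
      then show ?thesis by blast
    qed
  qed
  show ?thesis
    by (rule main[of f "B ^ n"]) (auto intro: word_code_bound B hw)
qed

lemma sum_letters:
  assumes "\<And>x. x < n \<Longrightarrow> u x < B" shows "(\<Sum>x<n. u x) = (\<Sum>i<B. i * letter_count n u i)"
  using assms
proof (induction n)
  case (Suc n)
  have "(\<Sum>i<B. i * (if u n = i then 1 else 0)) = u n"
    using Suc.prems[of n] by (simp add: if_distrib[of "\<lambda>x. _ * x"] cong: if_cong)
  then show ?case using Suc by (simp add: letter_count_Suc distrib_left sum.distrib)
qed simp

text \<open>Raising operators lower the letter sum by one. \<open>exists_highest\<close> minimizes
  this sum within one content, on which it therefore has to be constant.\<close>

lemma sum_letters_cong:
  assumes "letter_count n u = letter_count n v" shows "(\<Sum>x<n. u x) = (\<Sum>x<n. v x)"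
proof -
  obtain B C where "\<And>x. x < n \<Longrightarrow> u x < B" "\<And>x. x < n \<Longrightarrow> v x < C"
    using word_letters_bound[of n u] word_letters_bound[of n v] by metis
  then have "\<And>x. x < n \<Longrightarrow> u x < max B C" "\<And>x. x < n \<Longrightarrow> v x < max B C" by (auto simp: less_max_iff_disj)
  then show ?thesis using sum_letters assms by metis
qed

text \<open>A nonzero element of minimal letter sum is annihilated by all raising operators.\<close>
lemma exists_highest:
  fixes G :: "((nat \<Rightarrow> nat) \<Rightarrow> 'f::field_char_0) set"
  assumes f: "f \<in> G" "f \<noteq> (\<lambda>u. 0)" and loc: "\<And>f. f \<in> G \<Longrightarrow> local_fn n f"
    and raise: "\<And>f i. f \<in> G \<Longrightarrow> raise n i (Suc i) f \<in> G"
    and restr: "\<And>f \<nu>. f \<in> G \<Longrightarrow> (\<lambda>u. if letter_count n u = \<nu> then f u else 0) \<in> G"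
  obtains h \<nu> where "h \<in> G" "h \<noteq> (\<lambda>u. 0)" "highest n \<nu> h"
proof -
  define S where "S = (\<lambda>(f, u). f \<in> G \<and> f u \<noteq> 0)"
  define w where "w = (\<lambda>(f :: (nat \<Rightarrow> nat) \<Rightarrow> 'f, u :: nat \<Rightarrow> nat). \<Sum>x<n. u x)"
  obtain u0 where "f u0 \<noteq> 0" using f(2) by blast
  then have "S (f, u0)" using f(1) by (simp add: S_def)
  then have min: "S (arg_min w S)" "\<And>s. S s \<Longrightarrow> w (arg_min w S) \<le> w s"
    by (auto intro: arg_min_natI arg_min_nat_le)
  define h u where "h = fst (arg_min w S)" and "u = snd (arg_min w S)"
  have hu: "arg_min w S = (h, u)" by (simp add: h_def u_def)
  have h: "h \<in> G" "h u \<noteq> 0" using min(1)[unfolded hu] by (auto simp: S_def)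
  have min: "(\<Sum>x<n. u x) \<le> (\<Sum>x<n. v x)" if "g \<in> G" "g v \<noteq> 0" for g v
  proof -
    have "S (g, v)" using that by (simp add: S_def)
    from min(2)[OF this, unfolded hu] show ?thesis by (simp add: w_def)
  qed
  \<comment> \<open>Keeping only the words with the content of \<open>u\<close> produces a weight
    vector, and its letter sum is still the minimal one.\<close>
  define h' where "h' = (\<lambda>v. if letter_count n v = letter_count n u then h v else 0)"
  have h': "h' \<in> G" "h' u \<noteq> 0" using restr h by (auto simp: h'_def)
  have "raise n i (Suc i) h' v = 0" for i v
  proof (rule ccontr)
    assume nz: "raise n i (Suc i) h' v \<noteq> 0"
    then have "(\<Sum>p | p < n \<and> v p = i. h' (v(p := Suc i))) \<noteq> 0" by (simp add: raise_def)
    then obtain p where p: "p < n" "v p = i" "h' (v(p := Suc i)) \<noteq> 0"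
      by (rule sum.not_neutral_contains_not_neutral) auto
    then have "letter_count n (v(p := Suc i)) = letter_count n u" by (auto simp: h'_def split: if_splits)
    \<comment> \<open>A value of the raised function at \<open>v\<close> comes from a word whose
      letter sum exceeds that of \<open>v\<close> by one, so \<open>v\<close> would undercut the
      minimum.\<close>
    then have "(\<Sum>x<n. (v(p := Suc i)) x) = (\<Sum>x<n. u x)" by (rule sum_letters_cong)
    moreover have "(\<Sum>x<n. (v(p := Suc i)) x) = Suc (\<Sum>x<n. v x)"
    proof -
      have pn: "p \<in> {..<n}" using p by simp
      have "(\<Sum>x\<in>{..<n} - {p}. (v(p := Suc i)) x) = (\<Sum>x\<in>{..<n} - {p}. v x)" by (rule sum.cong) auto
      then show ?thesis
        using sum.remove[OF finite_lessThan pn, of v] sum.remove[OF finite_lessThan pn, of "v(p := Suc i)"] p(2) by simp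
    qed
    ultimately show False using min[of "raise n i (Suc i) h'" v] raise[of h' i] h'(1) nz by simp
  qed
  then have "highest n (letter_count n u) h'"
    using loc[OF h'(1)] by (auto simp: highest_def h'_def)
  then show ?thesis using that h' by (metis)
qed

section \<open>Completeness and branching\<close>

definition partitions_of :: "nat \<Rightarrow> (nat \<Rightarrow> nat) set" where
  "partitions_of n = {\<mu> \<in> partitions. psize \<mu> = n}"

lemma partition_le_psize:
  assumes "\<mu> \<in> partitions" shows "\<mu> i \<le> psize \<mu>" and "i \<ge> psize \<mu> \<Longrightarrow> \<mu> i = 0"
proof -
  have le: "(\<Sum>j<Suc i. \<mu> j) \<le> psize \<mu>" for i
  proof -
    obtain N where N: "\<And>i. i \<ge> N \<Longrightarrow> \<mu> i = 0" using partitions_bound[OF assms] by blast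
    have "psize \<mu> = (\<Sum>j<max N (Suc i). \<mu> j)" by (rule psize_eq_sum) (use N in auto)
    also have "\<dots> \<ge> (\<Sum>j<Suc i. \<mu> j)" by (rule sum_mono2) auto
    finally show ?thesis .
  qed
  show "\<mu> i \<le> psize \<mu>" using le[of i, unfolded sum.lessThan_Suc] by (rule add_leD2)
  show "\<mu> i = 0" if "i \<ge> psize \<mu>"
  proof (rule ccontr)
    assume "\<mu> i \<noteq> 0"
    then have "\<mu> j \<ge> 1" if "j < Suc i" for j using partitions_antimono[OF assms, of j i] that by auto
    then have "(\<Sum>j<Suc i. 1) \<le> (\<Sum>j<Suc i. \<mu> j)" by (intro sum_mono) auto
    then show False using le[of i] that by simp
  qed
qed

lemma finite_partitions_of [simp]: "finite (partitions_of n)"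
proof (rule finite_subset)
  show "partitions_of n \<subseteq> {f. \<forall>x. (x \<in> {..<n} \<longrightarrow> f x \<in> {..n}) \<and> (x \<notin> {..<n} \<longrightarrow> f x = 0)}"
    using partition_le_psize by (auto simp: partitions_of_def)
  show "finite {f :: nat \<Rightarrow> nat. \<forall>x. (x \<in> {..<n} \<longrightarrow> f x \<in> {..n}) \<and> (x \<notin> {..<n} \<longrightarrow> f x = 0)}"
    by (rule finite_set_of_finite_funs) auto
qed

lemma group_op_central: "\<mu> \<in> partitions_of n \<Longrightarrow> group_op n (central_op \<mu>)"
  using group_op_central_op by (auto simp: partitions_of_def)

text \<open>The defect \<open>R f\<close> commutes with raising operators and with restriction to a
  content. If it were not always 0, some defect would be a nonzero highest weight vector. The
  operator of its weight multiplies it by a nonzero scalar, but by orthogonality it also kills every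
  defect.\<close>

theorem central_op_complete:
  fixes f :: "(nat \<Rightarrow> nat) \<Rightarrow> 'f::field_char_0"
  assumes "local_fn n f"
  shows "f = (\<lambda>u. \<Sum>\<mu>\<in>partitions_of n. inverse (central_const \<mu>) * central_op \<mu> f u)"
proof (rule ccontr)
  define E :: "((nat \<Rightarrow> nat) \<Rightarrow> 'f) \<Rightarrow> (nat \<Rightarrow> nat) \<Rightarrow> 'f"
    where "E f = (\<lambda>u. \<Sum>\<mu>\<in>partitions_of n. inverse (central_const \<mu>) * central_op \<mu> f u)" for f
  define R where "R f = (\<lambda>u. f u - E f u)" for f :: "(nat \<Rightarrow> nat) \<Rightarrow> 'f"
  have E: "group_op n E"
    by (rule group_op_cong[OF group_op_sum[where I = "partitions_of n" and T = central_op]])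
       (auto simp: E_def intro: group_op_central)
  define G where "G = {R f | f. local_fn n f}"
  assume "\<not> ?thesis"
  then have nz: "R f \<noteq> (\<lambda>u. 0)" by (auto simp: R_def E_def fun_eq_iff)
  have "R f \<in> G" using assms by (auto simp: G_def)
  moreover note nz
  moreover have "local_fn n h" if hG: "h \<in> G" for h
  proof -
    obtain f where f: "h = R f" "local_fn n f" using hG by (auto simp: G_def)
    then show ?thesis using local_fn_group_op[OF E f(2)] unfolding R_def local_fn_def by metis
  qed
  moreover have "raise n i (Suc i) h \<in> G" if hG: "h \<in> G" for h i
  proof -
    obtain f where f: "h = R f" "local_fn n f" using hG by (auto simp: G_def)
    have "raise n i (Suc i) h = R (raise n i (Suc i) f)" by (simp add: f(1) R_def raise_diff raise_group_op[OF E])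
    then show ?thesis using local_fn_raise[OF f(2)] by (auto simp: G_def)
  qed
  moreover have "(\<lambda>u. if letter_count n u = \<nu> then h u else 0) \<in> G" if hG: "h \<in> G" for h \<nu>
  proof -
    obtain f where f: "h = R f" "local_fn n f" using hG by (auto simp: G_def)
    have "(\<lambda>u. if letter_count n u = \<nu> then h u else 0) = R (\<lambda>u. if letter_count n u = \<nu> then f u else 0)"
      unfolding f(1) R_def letter_count_restrict_group_op[OF E] by (rule ext) simp
    moreover have "local_fn n (\<lambda>u. if letter_count n u = \<nu> then f u else 0)"
      unfolding local_fn_def using letter_count_cong local_fnD[OF f(2)] by metis
    ultimately show ?thesis by (auto simp: G_def)
  qed
  ultimately obtain h \<nu> where h: "h \<in> G" "h \<noteq> (\<lambda>u. 0)" "highest n \<nu> h" by (rule exists_highest)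
  obtain f where f: "h = R f" "local_fn n f" using h(1) unfolding G_def by blast
  have \<nu>: "\<nu> \<in> partitions" "psize \<nu> = n" using highest_partition[OF h(3,2)] by auto
  note z = group_op_central_op[OF \<nu>(1)]
  have orth: "central_op \<nu> (central_op \<mu> f) = (\<lambda>u. if \<mu> = \<nu> then central_const \<nu> * central_op \<nu> f u else 0)"
    if "\<mu> \<in> partitions_of n" for \<mu>
    using that \<nu> central_op_orthogonal[of \<nu> \<mu> f] central_op_central_op[OF \<nu>(1), of f] by (auto simp: partitions_of_def)
  have nin: "\<nu> \<in> partitions_of n" using \<nu> by (simp add: partitions_of_def)
  have "central_op \<nu> h u = 0" for u
  proof -
    have "central_op \<nu> (E f) u = (\<Sum>\<mu>\<in>partitions_of n. inverse (central_const \<mu>) * central_op \<nu> (central_op \<mu> f) u)"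
      unfolding E_def group_op_linear[OF z] ..
    also have "\<dots> = (\<Sum>\<mu>\<in>partitions_of n. if \<mu> = \<nu> then inverse (central_const \<nu>) * (central_const \<nu> * central_op \<nu> f u) else 0)"
      by (rule sum.cong) (simp_all add: orth)
    also have "\<dots> = central_op \<nu> f u"
      using nin central_const_nonzero[OF \<nu>(1), where 'f = 'f] by (simp add: mult.assoc[symmetric])
    finally show ?thesis by (simp add: f(1) R_def group_op_diff[OF z])
  qed
  moreover have "central_op \<nu> h = (\<lambda>u. central_const \<nu> * h u)" by (rule central_op_highest[OF h(3)])
  ultimately have "h = (\<lambda>u. 0)" using central_const_nonzero[OF \<nu>(1), where 'f = 'f] by (metis mult_eq_0_iff)
  then show False using h(2) by simp
qed

text \<open>If the product is nonzero, its image contains a nonzero highest weight vector, whose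
  weight must be \<mu>. Freezing the largest possible last letter gives a highest weight vector of
  degree \<open>n\<close> whose weight is \<mu> minus one cell. The operator of \<nu> acts on it by
  a nonzero scalar, which forces this weight to be \<nu>.\<close>

theorem central_op_branching:
  fixes f :: "(nat \<Rightarrow> nat) \<Rightarrow> 'f::field_char_0"
  assumes \<nu>: "\<nu> \<in> partitions_of n" and \<mu>: "\<mu> \<in> partitions_of (Suc n)" and nle: "\<not> \<nu> \<le> \<mu>"
    and f: "local_fn (Suc n) f"
  shows "central_op \<mu> (central_op \<nu> f) = (\<lambda>u. 0)"
proof (rule ccontr)
  have p\<nu>: "\<nu> \<in> partitions" "psize \<nu> = n" and p\<mu>: "\<mu> \<in> partitions" "psize \<mu> = Suc n"
    using \<nu> \<mu> by (auto simp: partitions_of_def)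
  have z\<nu>: "group_op (Suc n) (central_op \<nu>)" by (rule group_op_mono[OF _ group_op_central[OF \<nu>]]) simp
  define T :: "((nat \<Rightarrow> nat) \<Rightarrow> 'f) \<Rightarrow> (nat \<Rightarrow> nat) \<Rightarrow> 'f" where "T f = central_op \<mu> (central_op \<nu> f)" for f
  have T: "group_op (Suc n) T" unfolding T_def[abs_def] by (rule group_op_comp[OF group_op_central[OF \<mu>] z\<nu>])
  define G where "G = {T f | f. local_fn (Suc n) f}"
  assume "\<not> ?thesis"
  then have nz: "T f \<noteq> (\<lambda>u. 0)" by (simp add: T_def)
  have "T f \<in> G" using f by (auto simp: G_def)
  moreover note nz
  moreover have "local_fn (Suc n) h" if hG: "h \<in> G" for h using that local_fn_group_op[OF T] by (auto simp: G_def)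
  moreover have "raise (Suc n) i (Suc i) h \<in> G" if hG: "h \<in> G" for h i
    using that raise_group_op[OF T] local_fn_raise unfolding G_def by blast
  moreover have "(\<lambda>u. if letter_count (Suc n) u = \<kappa> then h u else 0) \<in> G" if hG: "h \<in> G" for h \<kappa>
  proof -
    obtain f where f: "h = T f" "local_fn (Suc n) f" using hG by (auto simp: G_def)
    have "local_fn (Suc n) (\<lambda>u. if letter_count (Suc n) u = \<kappa> then f u else 0)"
      unfolding local_fn_def using letter_count_cong local_fnD[OF f(2)] by metis
    then show ?thesis unfolding f(1) letter_count_restrict_group_op[OF T, symmetric] by (auto simp: G_def)
  qed
  ultimately obtain h \<kappa> where h: "h \<in> G" "h \<noteq> (\<lambda>u. 0)" "highest (Suc n) \<kappa> h" by (rule exists_highest)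
  obtain f where f: "h = T f" using h(1) unfolding G_def by blast
  have \<kappa>: "\<kappa> \<in> partitions" "psize \<kappa> = Suc n" using highest_partition[OF h(3,2)] by auto
  have "\<kappa> = \<mu>"
  proof (rule ccontr)
    assume "\<kappa> \<noteq> \<mu>"
    then have "central_op \<kappa> h = (\<lambda>u. 0)"
      unfolding f T_def using central_op_orthogonal[OF \<kappa>(1) p\<mu>(1)] \<kappa>(2) p\<mu>(2) by simp
    then have "h = (\<lambda>u. 0)"
      using central_op_highest[OF h(3)] central_const_nonzero[OF \<kappa>(1), where 'f = 'f] by (metis mult_eq_0_iff)
    then show False using h(2) by simp
  qed
  have "h = central_op \<nu> (central_op \<mu> f)"
    unfolding f T_def using central_op_commute[OF p\<mu>(1)] z\<nu> p\<mu>(2) by metis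
  then have \<nu>h: "central_op \<nu> h = (\<lambda>u. central_const \<nu> * h u)" using central_op_central_op[OF p\<nu>(1)] by metis
  obtain u0 where u0: "h u0 \<noteq> 0" using h(2) by blast
  obtain B where B: "\<And>u x. h u \<noteq> 0 \<Longrightarrow> x < Suc n \<Longrightarrow> u x < B" using highest_bounded[OF h(3) u0] by blast
  have J0: "\<exists>u. h (u(n := u0 n)) \<noteq> 0" using u0 by (intro exI[of _ u0]) simp
  have "j < B" if "\<exists>u. h (u(n := j)) \<noteq> 0" for j
  proof -
    from that obtain u where "h (u(n := j)) \<noteq> 0" by blast
    then have "(u(n := j)) n < B" by (rule B) simp
    then show ?thesis by simp
  qed
  then have "\<forall>j. (\<exists>u. h (u(n := j)) \<noteq> 0) \<longrightarrow> j < B" by blast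
  from ex_has_greatest_nat[of "\<lambda>j. \<exists>u. h (u(n := j)) \<noteq> 0" "u0 n" "\<lambda>j. j", OF J0 this]
  obtain J where J: "\<exists>u. h (u(n := J)) \<noteq> 0" "\<And>j. \<exists>u. h (u(n := j)) \<noteq> 0 \<Longrightarrow> j \<le> J" by blast
  define hJ where "hJ = (\<lambda>u. h (u(n := J)))"
  \<comment> \<open>The truncated subtraction is harmless, as the letter \<open>J\<close> occurs in
    the words concerned.\<close>
  define \<rho> where "\<rho> = (\<lambda>i. \<mu> i - (if J = i then 1 else 0))"
  have "highest n \<rho> hJ"
    unfolding highest_def
  proof (intro conjI allI impI)
    show "local_fn n hJ"
      unfolding local_fn_def hJ_def
    proof (intro allI impI)
      fix u v :: "nat \<Rightarrow> nat" assume uv: "\<forall>x<n. u x = v x"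
      have "local_fn (Suc n) h" using h(3) by (simp add: highest_def)
      then show "h (u(n := J)) = h (v(n := J))" by (rule local_fnD) (use uv in \<open>auto simp: less_Suc_eq\<close>)
    qed
    show "letter_count n u = \<rho>" if "hJ u \<noteq> 0" for u
    proof
      fix i
      have "letter_count (Suc n) (u(n := J)) = \<mu>" using h(3) that \<open>\<kappa> = \<mu>\<close> by (auto simp: highest_def hJ_def)
      then have "\<mu> i = letter_count n u i + (if J = i then 1 else 0)"
        using letter_count_Suc[of n "u(n := J)" i] letter_count_cong[of n "u(n := J)" u] by auto
      then show "letter_count n u i = \<rho> i" by (simp add: \<rho>_def)
    qed
    fix i
    show "raise n i (Suc i) hJ = (\<lambda>u. 0)"
    proof
      fix u
      have zero: "h (u(n := Suc J)) = 0" using J(2)[of "Suc J"] by auto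
      have "0 = raise (Suc n) i (Suc i) h (u(n := J))" using h(3) by (auto simp: highest_def)
      also have "\<dots> = (\<Sum>p | p < n \<and> (u(n := J)) p = i. h (u(n := J, p := Suc i)))"
        unfolding raise_def
        by (rule sum.mono_neutral_right) (use zero in \<open>auto simp: less_Suc_eq\<close>)
      also have "\<dots> = raise n i (Suc i) hJ u"
        unfolding raise_def hJ_def by (intro sum.cong) (auto simp: fun_upd_twist)
      finally show "raise n i (Suc i) hJ u = 0" by simp
    qed
  qed
  note hw = this
  have nz: "hJ \<noteq> (\<lambda>u. 0)" using J(1) by (auto simp: hJ_def fun_eq_iff)
  note \<rho>p = highest_partition[OF hw nz]
  note z\<rho> = central_op_highest[OF hw]
  have "central_op \<nu> hJ = (\<lambda>u. central_const \<nu> * hJ u)"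
  proof -
    obtain a where a: "\<And>f u. central_op \<nu> f u = (\<Sum>\<sigma>\<in>perms n. a \<sigma> * (f :: _ \<Rightarrow> 'f) (u \<circ> \<sigma>))"
      using group_op_central[OF \<nu>] unfolding group_op_def by blast
    \<comment> \<open>Permutations of the first \<open>n\<close> places fix place \<open>n\<close>,
      so they commute with freezing it.\<close>
    have "(u \<circ> \<sigma>)(n := J) = u(n := J) \<circ> \<sigma>" if "\<sigma> \<in> perms n" for u :: "nat \<Rightarrow> nat" and \<sigma>
    proof
      fix x
      have "\<sigma> n = n" using that by (auto simp: perms_def permutes_def)
      moreover have "\<sigma> x = n \<longleftrightarrow> x = n" using calculation perms_bij[OF that] by (metis bij_def inj_eq)
      ultimately show "((u \<circ> \<sigma>)(n := J)) x = (u(n := J) \<circ> \<sigma>) x" by auto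
    qed
    then have "central_op \<nu> hJ u = central_op \<nu> h (u(n := J))" for u
      by (simp add: a hJ_def)
    then show ?thesis using \<nu>h by (auto simp: hJ_def)
  qed
  moreover have "\<nu> \<noteq> \<rho>" using nle by (auto simp: \<rho>_def le_fun_def)
  then have "central_op \<nu> (central_op \<rho> hJ) = (\<lambda>u. 0)"
    using central_op_orthogonal[OF p\<nu>(1) \<rho>p(1)] p\<nu>(2) \<rho>p(2) by simp
  ultimately have "central_const \<rho> * (central_const \<nu> * hJ u) = 0" for u
    unfolding z\<rho> using group_op_scale[OF group_op_central_op[OF p\<nu>(1)], of "central_const \<rho>" hJ] by metis
  then have "hJ = (\<lambda>u. 0)"
    using central_const_nonzero[OF p\<nu>(1), where 'f = 'f] central_const_nonzero[OF \<rho>p(1), where 'f = 'f] by (auto simp: fun_eq_iff)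
  then show False using nz by simp
qed

section \<open>Vanishing criteria\<close>

definition skew_pairs :: "nat \<Rightarrow> nat \<Rightarrow> ((nat \<Rightarrow> nat) \<Rightarrow> 'f::ring) \<Rightarrow> bool" where
  "skew_pairs m n f \<longleftrightarrow> (\<exists>a b :: nat \<Rightarrow> nat. (\<forall>i<m. a i < n \<and> b i < n \<and> act (transpose (a i) (b i)) f = (\<lambda>u. - f u)) \<and>
     (\<forall>i<m. \<forall>j<m. a i \<noteq> b j \<and> (i \<noteq> j \<longrightarrow> a i \<noteq> a j \<and> b i \<noteq> b j)))"

text \<open>In \<open>central_op_col_row\<close> the row sums act first. Fewer than \<open>m\<close>
  cells lie below the first row, so for every \<open>g\<close> one of the \<open>m\<close> skew
  pairs falls into the first row entirely, and the row sum vanishes.\<close>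

lemma central_op_skew_zero:
  fixes f :: "(nat \<Rightarrow> nat) \<Rightarrow> 'f::field_char_0"
  assumes \<mu>: "\<mu> \<in> partitions_of n" and m: "n < \<mu> 0 + m" and f: "skew_pairs m n f"
  shows "central_op \<mu> f = (\<lambda>u. 0)"
proof -
  have p: "\<mu> \<in> partitions" "psize \<mu> = n" using \<mu> by (auto simp: partitions_of_def)
  obtain a b where ab: "\<And>i. i < m \<Longrightarrow> a i < n \<and> b i < n \<and> act (transpose (a i) (b i)) f = (\<lambda>u. - f u)"
    and dis: "\<And>i j. i < m \<Longrightarrow> j < m \<Longrightarrow> a i \<noteq> b j \<and> (i \<noteq> j \<longrightarrow> a i \<noteq> a j \<and> b i \<noteq> b j)"
    using f unfolding skew_pairs_def by blast
  have "row_op \<mu> (act (pinv g) f) = (\<lambda>u. 0)" if g: "g \<in> perms n" for g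
  proof -
    have gi: "pinv g \<in> perms n" using g by (rule perms_inv)
    have inj: "pinv g x = pinv g y \<longleftrightarrow> x = y" for x y using perms_bij[OF gi] by (metis bij_def inj_eq)
    \<comment> \<open>If every pair had a member below the first row, this would choose one for each
      pair, injectively because the pairs are disjoint.\<close>
    define c where "c i = (if row_of \<mu> (pinv g (a i)) \<noteq> 0 then pinv g (a i) else pinv g (b i))" for i
    have "\<exists>i<m. row_of \<mu> (pinv g (a i)) = 0 \<and> row_of \<mu> (pinv g (b i)) = 0"
    proof (rule ccontr)
      assume no: "\<not> ?thesis"
      have "c ` {..<m} \<subseteq> {x. x < n \<and> row_of \<mu> x \<noteq> 0}"
        using no ab perms_less[OF gi] by (auto simp: c_def)
      moreover have "inj_on c {..<m}"
      proof (rule inj_onI, rule ccontr)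
        fix i j assume ij: "i \<in> {..<m}" "j \<in> {..<m}" "c i = c j" "i \<noteq> j"
        then show False using dis[of i j] dis[of j i] by (auto simp: c_def inj split: if_splits)
      qed
      ultimately have "m \<le> card {x. x < n \<and> row_of \<mu> x \<noteq> 0}"
        using card_inj_on_le[of c "{..<m}"] by simp
      moreover have "{..<n} = {x. x < n \<and> row_of \<mu> x \<noteq> 0} \<union> {x. x < n \<and> row_of \<mu> x = 0}" by auto
      then have "n = card ({x. x < n \<and> row_of \<mu> x \<noteq> 0} \<union> {x. x < n \<and> row_of \<mu> x = 0})" by (metis card_lessThan)
      then have "n = card {x. x < n \<and> row_of \<mu> x \<noteq> 0} + card {x. x < n \<and> row_of \<mu> x = 0}"
        by (subst (asm) card_Un_disjoint) auto
      moreover have "card {x. x < n \<and> row_of \<mu> x = 0} = \<mu> 0" using card_row[OF p(1), of 0] p(2) by simp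
      ultimately show False using m by simp
    qed
    then obtain i where i: "i < m" "row_of \<mu> (pinv g (a i)) = 0" "row_of \<mu> (pinv g (b i)) = 0" by blast
    have "act (transpose (pinv g (a i)) (pinv g (b i))) (act (pinv g) f) = act (pinv g) (act (transpose (a i) (b i)) f)"
      unfolding act_act using transpose_conj(2)[OF gi] by metis
    also have "\<dots> = (\<lambda>u. - act (pinv g) f u)" using ab[OF i(1)] by (simp add: act_def)
    finally show ?thesis
      by (intro row_op_alternating_zero[OF p(1)]) (use i ab[OF i(1)] perms_less[OF gi] p(2) in auto)
  qed
  then show ?thesis
    by (intro ext) (simp add: central_op_col_row[OF p(1)] p(2) group_op_zero[OF group_op_col_op[OF p(1)]])
qed

text \<open>Here it matters that the column sums act last. The first column has at least three
  cells, and a word in two letters repeats a letter among them.\<close>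

lemma central_op_two_letters:
  fixes f :: "(nat \<Rightarrow> nat) \<Rightarrow> 'f::field_char_0"
  assumes \<mu>: "\<mu> \<in> partitions" and row: "\<mu> 2 \<noteq> 0" and u: "\<And>x. x < psize \<mu> \<Longrightarrow> u x < 2"
  shows "central_op \<mu> f u = 0"
proof -
  have c: "0 < \<mu> i" if "i \<le> 2" for i using partitions_antimono[OF \<mu> that] row by simp
  have "col_op \<mu> h (u \<circ> g) = 0" if g: "g \<in> perms (psize \<mu>)" for g and h :: "(nat \<Rightarrow> nat) \<Rightarrow> 'f"
  proof -
    let ?t = "\<lambda>i. tableau \<mu> i 0"
    have t: "?t i < psize \<mu>" "row_of \<mu> (?t i) = i" "col_of \<mu> (?t i) = 0" if "i \<le> 2" for i
      using c[OF that] tableau_less[OF \<mu>] by (simp_all add: row_col_tableau)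
    have "(u \<circ> g) (?t i) < 2" if "i \<le> 2" for i using u t(1)[OF that] perms_less[OF g] by simp
    from this[of 0] this[of 1] this[of 2]
    have "(u \<circ> g) (?t 0) = (u \<circ> g) (?t 1) \<or> (u \<circ> g) (?t 0) = (u \<circ> g) (?t 2) \<or> (u \<circ> g) (?t 1) = (u \<circ> g) (?t 2)"
      by linarith
    then have "\<exists>i j. i \<le> 2 \<and> j \<le> 2 \<and> i \<noteq> j \<and> (u \<circ> g) (?t i) = (u \<circ> g) (?t j)"
    proof (elim disjE)
      show ?thesis if "(u \<circ> g) (?t 0) = (u \<circ> g) (?t 1)" using that by (intro exI[of _ 0] exI[of _ 1]) simp
      show ?thesis if "(u \<circ> g) (?t 0) = (u \<circ> g) (?t 2)" using that by (intro exI[of _ 0] exI[of _ 2]) simp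
      show ?thesis if "(u \<circ> g) (?t 1) = (u \<circ> g) (?t 2)" using that by (intro exI[of _ 1] exI[of _ 2]) simp
    qed
    then obtain i j where ij: "i \<le> 2" "j \<le> 2" "i \<noteq> j" "(u \<circ> g) (?t i) = (u \<circ> g) (?t j)" by blast
    have "?t i \<noteq> ?t j" using t(2)[OF ij(1)] t(2)[OF ij(2)] ij(3) by metis
    then show ?thesis by (intro col_op_repeated_letter[OF \<mu>, of "?t i" "?t j"]) (use t ij in auto)
  qed
  then show ?thesis by (simp add: central_op_col_row[OF \<mu>])
qed

section \<open>Parametrized quotient spaces and algebras\<close>

text \<open>The record \<open>A\<close> is a copy of \<open>H / K\<close>; all spaces and algebras of the theorem arise from the
  free algebra in this way, and iterated quotients only change \<open>K\<close>.\<close>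
locale param_space = vector_space \<sigma>
  for \<sigma> :: "'f::field \<Rightarrow> 'a::ab_group_add \<Rightarrow> 'a" +
  fixes A :: "('f, 'b) module" and \<pi> :: "'a \<Rightarrow> 'b" and H K :: "'a set"
  assumes subspace_H: "subspace H" and subspace_K: "subspace K" and K_H: "K \<subseteq> H"
    and carrier_eq: "carrier A = \<pi> ` H"
    and add_eq: "x \<in> H \<Longrightarrow> y \<in> H \<Longrightarrow> \<pi> x \<oplus>\<^bsub>A\<^esub> \<pi> y = \<pi> (x + y)"
    and smult_eq: "x \<in> H \<Longrightarrow> c \<odot>\<^bsub>A\<^esub> \<pi> x = \<pi> (\<sigma> c x)"
    and zero_eq: "\<zero>\<^bsub>A\<^esub> = \<pi> 0"
    and pi_eq_iff: "x \<in> H \<Longrightarrow> y \<in> H \<Longrightarrow> \<pi> x = \<pi> y \<longleftrightarrow> x - y \<in> K"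
begin

lemma H_closed: "0 \<in> H" "x \<in> H \<Longrightarrow> y \<in> H \<Longrightarrow> x + y \<in> H" "x \<in> H \<Longrightarrow> \<sigma> c x \<in> H" "x \<in> H \<Longrightarrow> - x \<in> H"
    "x \<in> H \<Longrightarrow> y \<in> H \<Longrightarrow> x - y \<in> H"
  using subspace_H by (auto simp: subspace_0 subspace_add subspace_scale subspace_neg subspace_diff)

lemma pi_zero_iff: "x \<in> H \<Longrightarrow> \<pi> x = \<zero>\<^bsub>A\<^esub> \<longleftrightarrow> x \<in> K"
  using pi_eq_iff[of x 0] H_closed by (simp add: zero_eq)

lemma abelian_group: "abelian_group A"
proof (rule abelian_groupI)
  fix x assume "x \<in> carrier A"
  then obtain a where a: "a \<in> H" "x = \<pi> a" by (auto simp: carrier_eq)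
  show "\<exists>y\<in>carrier A. y \<oplus>\<^bsub>A\<^esub> x = \<zero>\<^bsub>A\<^esub>"
    by (rule bexI[of _ "\<pi> (- a)"]) (use a H_closed in \<open>auto simp: add_eq zero_eq carrier_eq\<close>)
  show "\<zero>\<^bsub>A\<^esub> \<oplus>\<^bsub>A\<^esub> x = x" using a H_closed by (simp add: add_eq zero_eq)
next
  fix x y assume "x \<in> carrier A" "y \<in> carrier A"
  then obtain a b where a: "a \<in> H" "b \<in> H" "x = \<pi> a" "y = \<pi> b" by (auto simp: carrier_eq)
  then show "x \<oplus>\<^bsub>A\<^esub> y \<in> carrier A" "x \<oplus>\<^bsub>A\<^esub> y = y \<oplus>\<^bsub>A\<^esub> x"
    using H_closed by (auto simp: add_eq carrier_eq add.commute)
  fix z assume "z \<in> carrier A"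
  then obtain c where "c \<in> H" "z = \<pi> c" by (auto simp: carrier_eq)
  then show "x \<oplus>\<^bsub>A\<^esub> y \<oplus>\<^bsub>A\<^esub> z = x \<oplus>\<^bsub>A\<^esub> (y \<oplus>\<^bsub>A\<^esub> z)" using a H_closed by (simp add: add_eq add.assoc)
qed (auto simp: zero_eq carrier_eq H_closed)

lemma a_inv_eq: assumes "x \<in> H" shows "\<ominus>\<^bsub>A\<^esub> \<pi> x = \<pi> (- x)"
proof -
  interpret abelian_group A by (rule abelian_group)
  show ?thesis by (rule minus_equality) (use assms H_closed in \<open>auto simp: carrier_eq add_eq zero_eq\<close>)
qed

lemma a_minus_eq: "x \<in> H \<Longrightarrow> y \<in> H \<Longrightarrow> \<pi> x \<ominus>\<^bsub>A\<^esub> \<pi> y = \<pi> (x - y)"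
  by (simp add: a_minus_def a_inv_eq add_eq H_closed)

lemma subspace_ofI:
  assumes "subspace L" "L \<subseteq> H" shows "subspace_of (\<pi> ` L) A"
proof (unfold_locales)
  note L = subspace_0[OF assms(1)] subspace_add[OF assms(1)] subspace_scale[OF assms(1)] subspace_neg[OF assms(1)]
  show "\<pi> ` L \<subseteq> carrier (add_monoid A)" using assms by (auto simp: carrier_eq)
  show "x \<otimes>\<^bsub>add_monoid A\<^esub> y \<in> \<pi> ` L" if "x \<in> \<pi> ` L" "y \<in> \<pi> ` L" for x y
    using that L assms by (auto simp: add_eq subset_iff)
  show "\<one>\<^bsub>add_monoid A\<^esub> \<in> \<pi> ` L" using L by (simp add: zero_eq)
  show "inv\<^bsub>add_monoid A\<^esub> x \<in> \<pi> ` L" if "x \<in> \<pi> ` L" for x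
    using that L assms a_inv_eq by (auto simp: a_inv_def[symmetric] subset_iff)
  show "a \<odot>\<^bsub>A\<^esub> x \<in> \<pi> ` L" if "x \<in> \<pi> ` L" for a x
    using that L assms by (auto simp: smult_eq subset_iff)
qed

lemma subspace_ofD:
  assumes "subspace_of U A"
  shows "subspace {x \<in> H. \<pi> x \<in> U}" "U = \<pi> ` {x \<in> H. \<pi> x \<in> U}"
proof -
  interpret submodule U "ring_of_type_algebra :: 'f ring" A by (rule assms)
  show "subspace {x \<in> H. \<pi> x \<in> U}"
    unfolding subspace_def
  proof safe
    show "0 \<in> H" by (rule H_closed)
    show "\<pi> 0 \<in> U" using one_closed by (simp add: zero_eq)
    fix x y assume xy: "x \<in> H" "\<pi> x \<in> U" "y \<in> H" "\<pi> y \<in> U"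
    show "x + y \<in> H" using xy by (simp add: H_closed)
    show "\<pi> (x + y) \<in> U" using m_closed[of "\<pi> x" "\<pi> y"] xy by (simp add: add_eq)
  next
    fix c x assume x: "x \<in> H" "\<pi> x \<in> U"
    show "\<sigma> c x \<in> H" using x by (simp add: H_closed)
    show "\<pi> (\<sigma> c x) \<in> U" using smult_closed[of c "\<pi> x"] x by (simp add: smult_eq ring_of_type_algebra_def)
  qed
  show "U = \<pi> ` {x \<in> H. \<pi> x \<in> U}" using subset by (auto simp: carrier_eq)
qed

text \<open>Carries spans in the record back to spans of representatives, where ordinary vector
  space theory is available.\<close>

lemma lin_span_eq:
  assumes "S \<subseteq> H" shows "lin_span A (\<pi> ` S) = \<pi> ` span S"
proof
  have SH: "span S \<subseteq> H" using assms subspace_H by (rule span_minimal)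
  have "subspace_of (\<pi> ` span S) A" by (rule subspace_ofI[OF subspace_span SH])
  then show "lin_span A (\<pi> ` S) \<subseteq> \<pi> ` span S" unfolding lin_span_def using span_superset by blast
  show "\<pi> ` span S \<subseteq> lin_span A (\<pi> ` S)"
    unfolding lin_span_def
  proof (intro Inter_greatest)
    fix U assume "U \<in> {U. subspace_of U A \<and> \<pi> ` S \<subseteq> U}"
    then have U: "subspace_of U A" "\<pi> ` S \<subseteq> U" by auto
    have "span S \<subseteq> {x \<in> H. \<pi> x \<in> U}"
      by (rule span_minimal[OF _ subspace_ofD(1)[OF U(1)]]) (use U assms in auto)
    then show "\<pi> ` span S \<subseteq> U" by auto
  qed
qed

lemma param_restrict:
  assumes "subspace H'" "H' \<subseteq> H"
  shows "param_space \<sigma> (A \<lparr> carrier := \<pi> ` H' \<rparr>) \<pi> H' (K \<inter> H')"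
proof unfold_locales
  show "subspace (K \<inter> H')" by (rule subspace_inter[OF subspace_K assms(1)])
  fix x y assume "x \<in> H'" "y \<in> H'"
  then show "\<pi> x = \<pi> y \<longleftrightarrow> x - y \<in> K \<inter> H'"
    using assms pi_eq_iff[of x y] subspace_diff[OF assms(1)] by auto
qed (use assms in \<open>auto simp: add_eq smult_eq zero_eq subset_iff\<close>)

lemma coset_eq:
  assumes L: "subspace L" "K \<subseteq> L" "L \<subseteq> H" and x: "x \<in> H"
  shows "\<pi> ` L +>\<^bsub>A\<^esub> \<pi> x = \<pi> ` {y \<in> H. y - x \<in> L}"
proof -
  have "\<pi> ` L +>\<^bsub>A\<^esub> \<pi> x = {d \<oplus>\<^bsub>A\<^esub> \<pi> x | d. d \<in> \<pi> ` L}" by (auto simp: a_r_coset_def')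
  also have "\<dots> = \<pi> ` {y \<in> H. y - x \<in> L}"
  proof safe
    fix d assume d: "d \<in> L"
    then have "\<pi> d \<oplus>\<^bsub>A\<^esub> \<pi> x = \<pi> (d + x)" "d + x \<in> H" using L x by (auto simp: add_eq H_closed)
    then show "\<pi> d \<oplus>\<^bsub>A\<^esub> \<pi> x \<in> \<pi> ` {y \<in> H. y - x \<in> L}" using d by auto
  next
    fix y assume y: "y \<in> H" "y - x \<in> L"
    then have "\<pi> y = \<pi> (y - x) \<oplus>\<^bsub>A\<^esub> \<pi> x" using L x by (subst add_eq) auto
    then show "\<exists>d. \<pi> y = d \<oplus>\<^bsub>A\<^esub> \<pi> x \<and> d \<in> \<pi> ` L" using y by blast
  qed
  finally show ?thesis .
qed

lemma quotient_carrier: "carrier (quotient_algebra A I) = (\<lambda>x. I +>\<^bsub>A\<^esub> \<pi> x) ` H"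
  by (auto simp: quotient_algebra_def ring.defs FactRing_def A_RCOSETS_def' carrier_eq)

lemma coset_eq_iff:
  assumes L: "subspace L" "K \<subseteq> L" "L \<subseteq> H" and x: "x \<in> H" "y \<in> H"
  shows "\<pi> ` L +>\<^bsub>A\<^esub> \<pi> x = \<pi> ` L +>\<^bsub>A\<^esub> \<pi> y \<longleftrightarrow> x - y \<in> L"
proof
  assume e: "\<pi> ` L +>\<^bsub>A\<^esub> \<pi> x = \<pi> ` L +>\<^bsub>A\<^esub> \<pi> y"
  have "\<pi> x \<in> \<pi> ` {z \<in> H. z - x \<in> L}" using x subspace_0[OF L(1)] by auto
  then obtain z where z: "z \<in> H" "z - y \<in> L" "\<pi> x = \<pi> z"
    using e coset_eq[OF L x(1)] coset_eq[OF L x(2)] by auto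
  then have "x - z \<in> L" using pi_eq_iff[OF x(1) z(1)] L by auto
  then show "x - y \<in> L" using subspace_add[OF L(1) _ z(2), of "x - z"] by simp
next
  assume xy: "x - y \<in> L"
  have "z - x \<in> L \<longleftrightarrow> z - y \<in> L" for z
    using subspace_add[OF L(1) _ xy, of "z - x"] subspace_diff[OF L(1) _ xy, of "z - y"] by auto
  then show "\<pi> ` L +>\<^bsub>A\<^esub> \<pi> x = \<pi> ` L +>\<^bsub>A\<^esub> \<pi> y"
    using coset_eq[OF L x(1)] coset_eq[OF L x(2)] by simp
qed

lemma param_quotient:
  assumes L: "subspace L" "K \<subseteq> L" "L \<subseteq> H"
  shows "param_space \<sigma> (quotient_algebra A (\<pi> ` L)) (\<lambda>x. \<pi> ` L +>\<^bsub>A\<^esub> \<pi> x) H L"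
proof unfold_locales
  let ?I = "\<pi> ` L"
  note c = coset_eq[OF L]
  note L_closed = subspace_0[OF L(1)] subspace_add[OF L(1)] subspace_scale[OF L(1)] subspace_diff[OF L(1)]
  show "carrier (quotient_algebra A ?I) = (\<lambda>x. ?I +>\<^bsub>A\<^esub> \<pi> x) ` H" by (rule quotient_carrier)
  show "(?I +>\<^bsub>A\<^esub> \<pi> x) \<oplus>\<^bsub>quotient_algebra A ?I\<^esub> (?I +>\<^bsub>A\<^esub> \<pi> y) = ?I +>\<^bsub>A\<^esub> \<pi> (x + y)"
    if x: "x \<in> H" "y \<in> H" for x y
  proof -
    have "(?I +>\<^bsub>A\<^esub> \<pi> x) \<oplus>\<^bsub>quotient_algebra A ?I\<^esub> (?I +>\<^bsub>A\<^esub> \<pi> y) =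
        {a \<oplus>\<^bsub>A\<^esub> b | a b. a \<in> \<pi> ` {z \<in> H. z - x \<in> L} \<and> b \<in> \<pi> ` {z \<in> H. z - y \<in> L}}"
      unfolding c[OF x(1)] c[OF x(2)]
      by (auto simp: quotient_algebra_def ring.defs FactRing_def set_add_def' )
    also have "\<dots> = \<pi> ` {z \<in> H. z - (x + y) \<in> L}"
    proof safe
      fix a b assume ab: "a \<in> H" "a - x \<in> L" "b \<in> H" "b - y \<in> L"
      then have "(a - x) + (b - y) \<in> L" using L_closed by blast
      moreover have "(a - x) + (b - y) = a + b - (x + y)" by (simp add: algebra_simps)
      ultimately show "\<pi> a \<oplus>\<^bsub>A\<^esub> \<pi> b \<in> \<pi> ` {z \<in> H. z - (x + y) \<in> L}"
        using ab by (auto simp: add_eq H_closed)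
    next
      fix z assume z: "z \<in> H" "z - (x + y) \<in> L"
      then have "\<pi> z = \<pi> (z - y) \<oplus>\<^bsub>A\<^esub> \<pi> y" "z - y - x \<in> L"
        using x by (simp_all add: add_eq H_closed algebra_simps)
      then show "\<exists>a b. \<pi> z = a \<oplus>\<^bsub>A\<^esub> b \<and> a \<in> \<pi> ` {z \<in> H. z - x \<in> L} \<and> b \<in> \<pi> ` {z \<in> H. z - y \<in> L}"
        using z x L_closed(1) by (intro exI[of _ "\<pi> (z - y)"] exI[of _ "\<pi> y"]) (auto simp: H_closed)
    qed
    finally show ?thesis using c[OF H_closed(2)[OF x]] by simp
  qed
  \<comment> \<open>The union in \<open>quotient_algebra\<close> runs over cosets that are all
    equal, and over at least one of them because 0 lies in \<open>L\<close>.\<close>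
  show "k \<odot>\<^bsub>quotient_algebra A ?I\<^esub> (?I +>\<^bsub>A\<^esub> \<pi> x) = ?I +>\<^bsub>A\<^esub> \<pi> (\<sigma> k x)" if x: "x \<in> H" for k x
  proof -
    have "k \<odot>\<^bsub>quotient_algebra A ?I\<^esub> (?I +>\<^bsub>A\<^esub> \<pi> x) = (\<Union>y\<in>{z \<in> H. z - x \<in> L}. ?I +>\<^bsub>A\<^esub> (k \<odot>\<^bsub>A\<^esub> \<pi> y))"
      unfolding c[OF x] by (simp add: quotient_algebra_def ring.defs module.defs)
    also have "\<dots> = (\<Union>y\<in>{z \<in> H. z - x \<in> L}. ?I +>\<^bsub>A\<^esub> \<pi> (\<sigma> k x))"
    proof (rule SUP_cong[OF refl])
      fix y assume y: "y \<in> {z \<in> H. z - x \<in> L}"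
      then have "\<sigma> k y - \<sigma> k x \<in> L" using L_closed(3)[of "y - x" k] by (simp add: scale_right_diff_distrib)
      then show "?I +>\<^bsub>A\<^esub> (k \<odot>\<^bsub>A\<^esub> \<pi> y) = ?I +>\<^bsub>A\<^esub> \<pi> (\<sigma> k x)"
        using y x coset_eq_iff[OF L, of "\<sigma> k y" "\<sigma> k x"] by (simp add: smult_eq H_closed)
    qed
    also have "\<dots> = ?I +>\<^bsub>A\<^esub> \<pi> (\<sigma> k x)" using x L_closed(1) by auto
    finally show ?thesis .
  qed
  show "\<zero>\<^bsub>quotient_algebra A ?I\<^esub> = ?I +>\<^bsub>A\<^esub> \<pi> 0"
    using c[OF H_closed(1)] L by (auto simp: quotient_algebra_def ring.defs FactRing_def)
qed (use L subspace_H coset_eq_iff[OF L] in auto)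

lemma finsum_eq:
  assumes "finite S" "\<And>i. i \<in> S \<Longrightarrow> g i \<in> H"
  shows "(\<Oplus>\<^bsub>A\<^esub>i\<in>S. \<pi> (g i)) = \<pi> (\<Sum>i\<in>S. g i)"
proof -
  interpret abelian_group A by (rule abelian_group)
  have sum_H: "(\<Sum>i\<in>T. g i) \<in> H" if "finite T" "T \<subseteq> S" for T
    using that assms(2) by (induction T rule: finite_induct) (auto simp: H_closed)
  have "(\<Oplus>\<^bsub>A\<^esub>i\<in>T. \<pi> (g i)) = \<pi> (\<Sum>i\<in>T. g i)" if "finite T" "T \<subseteq> S" for T
    using that
  proof (induction T rule: finite_induct)
    case (insert i T)
    then have "(\<lambda>i. \<pi> (g i)) \<in> T \<rightarrow> carrier A" "\<pi> (g i) \<in> carrier A" "g i \<in> H" "sum g T \<in> H"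
      using assms(2) sum_H[of T] by (auto simp: carrier_eq Pi_def)
    then show ?case using insert finsum_insert[of T i "\<lambda>i. \<pi> (g i)"] by (simp add: add_eq)
  qed (simp add: zero_eq)
  then show ?thesis using assms(1) by blast
qed

end

locale param_ring = param_space \<sigma> A \<pi> UNIV K
  for \<sigma> :: "'f::field \<Rightarrow> 'a::ab_group_add \<Rightarrow> 'a" and A :: "('f, 'b) module" and \<pi> K +
  fixes mul :: "'a \<Rightarrow> 'a \<Rightarrow> 'a" and e :: 'a
  assumes mul_assoc: "mul (mul x y) z = mul x (mul y z)"
    and mul_e: "mul x e = x" "mul e x = x"
    and mul_distrib: "mul (x + y) z = mul x z + mul y z" "mul z (x + y) = mul z x + mul z y"
    and mul_scale: "mul (\<sigma> c x) y = \<sigma> c (mul x y)" "mul x (\<sigma> c y) = \<sigma> c (mul x y)"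
    and mult_eq: "\<pi> x \<otimes>\<^bsub>A\<^esub> \<pi> y = \<pi> (mul x y)"
    and one_eq: "\<one>\<^bsub>A\<^esub> = \<pi> e"
begin

lemma mul_minus: "mul (- x) y = - mul x y" "mul x (- y) = - mul x y"
  using mul_scale(1)[where c = "-1"] mul_scale(2)[where c = "-1"] by simp_all

lemma mul_diff: "mul (x - y) z = mul x z - mul y z" "mul z (x - y) = mul z x - mul z y"
  using mul_distrib(1)[of x "- y" z] mul_distrib(2)[where x = x and y = "- y" and z = z] by (simp_all add: mul_minus)

lemma is_ring: "ring A"
proof (rule ringI)
  show "abelian_group A" by (rule abelian_group)
  show "Group.monoid A"
    by (rule monoidI) (auto simp: carrier_eq mult_eq one_eq mul_assoc mul_e)
qed (auto simp: carrier_eq mult_eq add_eq mul_distrib)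

lemma ideal_image:
  assumes L: "subspace L" and two_sided: "\<And>x y. x \<in> L \<Longrightarrow> mul x y \<in> L \<and> mul y x \<in> L"
  shows "ideal (\<pi> ` L) A"
proof (rule idealI[OF is_ring])
  interpret s: submodule "\<pi> ` L" "ring_of_type_algebra :: 'f ring" A
    by (rule subspace_ofI[OF L]) simp
  show "subgroup (\<pi> ` L) (add_monoid A)" by (rule s.subgroup_axioms)
qed (use two_sided in \<open>auto simp: carrier_eq mult_eq\<close>)

text \<open>An ideal is a notion of the ring alone, so closure under scalars enters as an
  assumption.\<close>

lemma ideal_preimage:
  assumes I: "ideal I A" and scale: "\<And>c x. \<pi> x \<in> I \<Longrightarrow> \<pi> (\<sigma> c x) \<in> I"
  shows "subspace {x. \<pi> x \<in> I}" "\<pi> x \<in> I \<Longrightarrow> \<pi> (mul x y) \<in> I \<and> \<pi> (mul y x) \<in> I"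
proof -
  note I' = additive_subgroup.a_closed[OF ideal.axioms(1)[OF I]] additive_subgroup.zero_closed[OF ideal.axioms(1)[OF I]]
  show "subspace {x. \<pi> x \<in> I}"
    unfolding subspace_def using I' scale
    by (auto simp: add_eq[symmetric] zero_eq[symmetric])
  show "\<pi> x \<in> I \<Longrightarrow> \<pi> (mul x y) \<in> I \<and> \<pi> (mul y x) \<in> I"
    using ideal.I_l_closed[OF I, of "\<pi> x" "\<pi> y"] ideal.I_r_closed[OF I, of "\<pi> x" "\<pi> y"] by (auto simp: mult_eq carrier_eq)
qed

lemma param_ring_quotient:
  assumes L: "subspace L" "K \<subseteq> L" and two_sided: "\<And>x y. x \<in> L \<Longrightarrow> mul x y \<in> L \<and> mul y x \<in> L"
  shows "param_ring \<sigma> (quotient_algebra A (\<pi> ` L)) (\<lambda>x. \<pi> ` L +>\<^bsub>A\<^esub> \<pi> x) L mul e"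
proof -
  interpret Q: param_space \<sigma> "quotient_algebra A (\<pi> ` L)" "\<lambda>x. \<pi> ` L +>\<^bsub>A\<^esub> \<pi> x" UNIV L
    by (rule param_quotient[OF L]) simp
  have "ideal (\<pi> ` L) A" by (rule ideal_image[OF L(1) two_sided])
  note rcoset = ideal.rcoset_mult_add[OF this]
  show ?thesis
    by unfold_locales
       (auto simp: mul_assoc mul_e mul_distrib mul_scale quotient_algebra_def ring.defs FactRing_def
          rcoset carrier_eq mult_eq one_eq)
qed

end

section \<open>The free algebra\<close>

definition scale :: "'f::field \<Rightarrow> ('x \<Rightarrow>\<^sub>0 'f) \<Rightarrow> 'x \<Rightarrow>\<^sub>0 'f" where
  "scale c = Poly_Mapping.map ((*) c)"

definition fmul :: "('x list \<Rightarrow>\<^sub>0 'f::field) \<Rightarrow> ('x list \<Rightarrow>\<^sub>0 'f) \<Rightarrow> 'x list \<Rightarrow>\<^sub>0 'f" where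
  "fmul a b = a \<otimes>\<^bsub>free_algebra\<^esub> b"

lemma lookup_scale [simp]: "Poly_Mapping.lookup (scale c a) k = c * Poly_Mapping.lookup a k"
  by (simp add: scale_def Poly_Mapping.map.rep_eq when_def)

lemma scale_single [simp]: "scale c (Poly_Mapping.single w d) = Poly_Mapping.single w (c * d)"
  by (rule poly_mapping_eqI) (simp add: lookup_single when_def)

lemma vector_space_scale: "vector_space (scale :: 'f::field \<Rightarrow> ('x \<Rightarrow>\<^sub>0 'f) \<Rightarrow> _)"
  by unfold_locales (auto intro!: poly_mapping_eqI simp: lookup_add algebra_simps)

lemma poly_mapping_sum_single:
  fixes a :: "'x \<Rightarrow>\<^sub>0 'f::comm_monoid_add"
  shows "(\<Sum>k\<in>Poly_Mapping.keys a. Poly_Mapping.single k (Poly_Mapping.lookup a k)) = a"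
  by (rule poly_mapping_eqI) (simp add: lookup_sum lookup_single when_def not_in_keys_iff_lookup_eq_zero)

lemma poly_mapping_add_induct [case_names zero single add]:
  fixes a :: "'x \<Rightarrow>\<^sub>0 'f::comm_monoid_add"
  assumes "P 0" "\<And>k c. P (Poly_Mapping.single k c)" "\<And>a b. P a \<Longrightarrow> P b \<Longrightarrow> P (a + b)"
  shows "P a"
proof -
  have "P (\<Sum>k\<in>S. Poly_Mapping.single k (Poly_Mapping.lookup a k))" if "finite S" for S
    using that by (induction S rule: finite_induct) (auto intro: assms)
  from this[of "Poly_Mapping.keys a"] show ?thesis by (simp add: poly_mapping_sum_single)
qed

lemma free_algebra_simps:
  "carrier free_algebra = UNIV" "\<one>\<^bsub>free_algebra\<^esub> = Poly_Mapping.single [] 1" "\<zero>\<^bsub>free_algebra\<^esub> = 0"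
  "a \<oplus>\<^bsub>free_algebra\<^esub> b = a + b" "a \<otimes>\<^bsub>free_algebra\<^esub> b = fmul a b" "c \<odot>\<^bsub>free_algebra\<^esub> a = scale c a"
  by (simp_all add: free_algebra_def monoid_algebra_def scale_def fmul_def)

text \<open>Index sets larger than the supports allow products with \<open>a\<close>,
  \<open>b\<close> and \<open>a + b\<close> to be compared term by term.\<close>

lemma fmul_eq:
  assumes "finite S" "Poly_Mapping.keys a \<subseteq> S" "finite T" "Poly_Mapping.keys b \<subseteq> T"
  shows "fmul a b = (\<Sum>g\<in>S. \<Sum>h\<in>T. Poly_Mapping.single (g @ h) (Poly_Mapping.lookup a g * Poly_Mapping.lookup b h))"
proof -
  have "fmul a b = (\<Sum>g\<in>Poly_Mapping.keys a. \<Sum>h\<in>Poly_Mapping.keys b. Poly_Mapping.single (g @ h) (Poly_Mapping.lookup a g * Poly_Mapping.lookup b h))"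
    by (simp add: fmul_def free_algebra_def monoid_algebra_def)
  also have "\<dots> = (\<Sum>g\<in>Poly_Mapping.keys a. \<Sum>h\<in>T. Poly_Mapping.single (g @ h) (Poly_Mapping.lookup a g * Poly_Mapping.lookup b h))"
    by (intro sum.cong refl sum.mono_neutral_left) (use assms in \<open>auto simp: not_in_keys_iff_lookup_eq_zero\<close>)
  also have "\<dots> = (\<Sum>g\<in>S. \<Sum>h\<in>T. Poly_Mapping.single (g @ h) (Poly_Mapping.lookup a g * Poly_Mapping.lookup b h))"
    by (intro sum.mono_neutral_left) (use assms in \<open>auto simp: not_in_keys_iff_lookup_eq_zero\<close>)
  finally show ?thesis .
qed

lemma fmul_single [simp]:
  "fmul (Poly_Mapping.single u c) (Poly_Mapping.single v d) = Poly_Mapping.single (u @ v) (c * d)"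
  by (subst fmul_eq[of "{u}" _ "{v}"]) (auto simp: lookup_single)

lemma fmul_add_left: "fmul (a + b) c = fmul a c + fmul b c"
proof -
  let ?S = "Poly_Mapping.keys a \<union> Poly_Mapping.keys b"
  have "Poly_Mapping.keys (a + b) \<subseteq> ?S" by (rule Poly_Mapping.keys_add)
  then show ?thesis
    using fmul_eq[of ?S "a + b" "Poly_Mapping.keys c" c] fmul_eq[of ?S a "Poly_Mapping.keys c" c]
      fmul_eq[of ?S b "Poly_Mapping.keys c" c]
    by (simp add: sum.distrib lookup_add distrib_right single_add)
qed

lemma fmul_add_right: "fmul c (a + b) = fmul c a + fmul c b"
proof -
  let ?S = "Poly_Mapping.keys a \<union> Poly_Mapping.keys b"
  have "Poly_Mapping.keys (a + b) \<subseteq> ?S" by (rule Poly_Mapping.keys_add)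
  then show ?thesis
    using fmul_eq[of "Poly_Mapping.keys c" c ?S "a + b"] fmul_eq[of "Poly_Mapping.keys c" c ?S a]
      fmul_eq[of "Poly_Mapping.keys c" c ?S b]
    by (simp add: sum.distrib lookup_add distrib_left single_add)
qed

lemma fmul_zero [simp]: "fmul 0 a = 0" "fmul a 0 = 0"
  using fmul_add_left[of 0 0 a] fmul_add_right[of a 0 0] by simp_all

lemma fmul_scale: "fmul (scale c a) b = scale c (fmul a b)" "fmul a (scale c b) = scale c (fmul a b)"
proof -
  interpret vector_space scale by (rule vector_space_scale)
  show "fmul (scale c a) b = scale c (fmul a b)"
  proof (induction a rule: poly_mapping_add_induct)
    case (single u x)
    show ?case by (induction b rule: poly_mapping_add_induct)
      (simp_all add: fmul_add_right scale_right_distrib mult.assoc)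
  qed (simp_all add: fmul_add_left scale_right_distrib)
  show "fmul a (scale c b) = scale c (fmul a b)"
  proof (induction a rule: poly_mapping_add_induct)
    case (single u x)
    show ?case by (induction b rule: poly_mapping_add_induct)
      (simp_all add: fmul_add_right scale_right_distrib mult.left_commute)
  qed (simp_all add: fmul_add_left scale_right_distrib)
qed

lemma fmul_assoc: "fmul (fmul a b) c = fmul a (fmul b c)"
proof (induction a rule: poly_mapping_add_induct)
  case (single u x)
  show ?case
  proof (induction b rule: poly_mapping_add_induct)
    case (single v y)
    show ?case
      by (induction c rule: poly_mapping_add_induct) (simp_all add: fmul_add_right mult.assoc)
  qed (simp_all add: fmul_add_left fmul_add_right)
qed (simp_all add: fmul_add_left)

lemma fmul_one: "fmul a (Poly_Mapping.single [] 1) = a" "fmul (Poly_Mapping.single [] 1) a = a"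
  by (induction a rule: poly_mapping_add_induct; simp add: fmul_add_left fmul_add_right)+

lemma param_ring_free_algebra:
  "param_ring scale (free_algebra :: ('f::field, 'x list \<Rightarrow>\<^sub>0 'f) module) (\<lambda>a. a) {0} fmul (Poly_Mapping.single [] 1)"
proof -
  interpret vector_space "scale :: 'f \<Rightarrow> ('x list \<Rightarrow>\<^sub>0 'f) \<Rightarrow> _" by (rule vector_space_scale)
  show ?thesis
    by unfold_locales
       (auto simp: free_algebra_simps fmul_assoc fmul_one fmul_add_left fmul_add_right fmul_scale subspace_def)
qed

lemma subspace_scale_eq:
  fixes L :: "('x \<Rightarrow>\<^sub>0 'f::field) set"
  shows "Modules.module.subspace scale L \<longleftrightarrow> 0 \<in> L \<and> (\<forall>x\<in>L. \<forall>y\<in>L. x + y \<in> L) \<and> (\<forall>c. \<forall>x\<in>L. scale c x \<in> L)"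
proof -
  interpret vector_space "scale :: 'f \<Rightarrow> ('x \<Rightarrow>\<^sub>0 'f) \<Rightarrow> _" by (rule vector_space_scale)
  show ?thesis by (rule subspace_def)
qed

lemma keys_fmul: "Poly_Mapping.keys (fmul a b) \<subseteq> (\<lambda>(g, h). g @ h) ` (Poly_Mapping.keys a \<times> Poly_Mapping.keys b)"
proof -
  have "Poly_Mapping.keys (fmul a b) \<subseteq> (\<Union>g\<in>Poly_Mapping.keys a. \<Union>h\<in>Poly_Mapping.keys b. {g @ h})"
    unfolding fmul_eq[OF finite_keys subset_refl finite_keys subset_refl]
    by (rule order_trans[OF keys_sum], rule UN_mono[OF subset_refl], rule order_trans[OF keys_sum], rule UN_mono[OF subset_refl]) auto
  then show ?thesis by auto
qed

lemma single_Cons: "Poly_Mapping.single (x # w) c = fmul (Poly_Mapping.single [x] 1) (Poly_Mapping.single w c)"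
  by simp

lemma single_snoc: "Poly_Mapping.single (w @ [x]) c = fmul (Poly_Mapping.single w c) (Poly_Mapping.single [x] 1)"
  by simp

lemma subspace_homogeneous: "Modules.module.subspace scale (homogeneous n)"
  unfolding subspace_scale_eq homogeneous_def using Poly_Mapping.keys_add
  by (auto simp: in_keys_iff lookup_add)

definition lin_ext :: "('x \<Rightarrow> 'f) \<Rightarrow> ('x \<Rightarrow>\<^sub>0 'f) \<Rightarrow> 'f::field" where
  "lin_ext g a = (\<Sum>w\<in>Poly_Mapping.keys a. Poly_Mapping.lookup a w * g w)"

lemma lin_ext_superset: "finite S \<Longrightarrow> Poly_Mapping.keys a \<subseteq> S \<Longrightarrow> lin_ext g a = (\<Sum>w\<in>S. Poly_Mapping.lookup a w * g w)"
  unfolding lin_ext_def by (rule sum.mono_neutral_left) (auto simp: not_in_keys_iff_lookup_eq_zero)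

lemma lin_ext_add: "lin_ext g (a + b) = lin_ext g a + lin_ext g b"
proof -
  let ?S = "Poly_Mapping.keys a \<union> Poly_Mapping.keys b"
  have "Poly_Mapping.keys (a + b) \<subseteq> ?S" by (rule Poly_Mapping.keys_add)
  then show ?thesis
    using lin_ext_superset[of ?S "a + b" g] lin_ext_superset[of ?S a g] lin_ext_superset[of ?S b g]
    by (simp add: lookup_add distrib_right sum.distrib)
qed

lemma lin_ext_single [simp]: "lin_ext g (Poly_Mapping.single w c) = c * g w"
  by (subst lin_ext_superset[of "{w}"]) auto

lemma lin_ext_zero [simp]: "lin_ext g 0 = 0"
  by (simp add: lin_ext_def)

lemma lin_ext_scale: "lin_ext g (scale c a) = c * lin_ext g a"
proof -
  have "Poly_Mapping.keys (scale c a) \<subseteq> Poly_Mapping.keys a" by (auto simp: in_keys_iff)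
  then show ?thesis
    using lin_ext_superset[of "Poly_Mapping.keys a" "scale c a" g] lin_ext_superset[of "Poly_Mapping.keys a" a g]
    by (simp add: sum_distrib_left mult.assoc)
qed

text \<open>With \<open>permute_list\<close> this is the sum inside
  \<open>place_action\<close>.\<close>

definition relabel :: "('x \<Rightarrow> 'y) \<Rightarrow> ('x \<Rightarrow>\<^sub>0 'f) \<Rightarrow> 'y \<Rightarrow>\<^sub>0 'f::comm_monoid_add" where
  "relabel h a = (\<Sum>w\<in>Poly_Mapping.keys a. Poly_Mapping.single (h w) (Poly_Mapping.lookup a w))"

section \<open>Coordinates on the tensor algebra\<close>

text \<open>A basis of \<open>V\<close> with its dual coordinates. Letters from \<open>k\<close> on
  get the coordinate 0, so tensors over \<open>V\<close> become functions on words over the infinite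
  alphabet.\<close>

locale tensor_coords =
  fixes s :: "'f::field_char_0 \<Rightarrow> 'v::ab_group_add \<Rightarrow> 'v" and k :: nat and b :: "nat \<Rightarrow> 'v" and coord :: "'v \<Rightarrow> nat \<Rightarrow> 'f"
  assumes vector_space_s: "vector_space s"
    and coord_add: "coord (v + w) i = coord v i + coord w i"
    and coord_scale: "coord (s c v) i = c * coord v i"
    and coord_ge: "i \<ge> k \<Longrightarrow> coord v i = 0"
    and coord_basis: "i < k \<Longrightarrow> coord (b i) j = (if i = j then 1 else 0)"
    and coord_expand: "v = (\<Sum>i<k. s (coord v i) (b i))"
begin

text \<open>The value 0 for other lengths makes \<open>tcoord n\<close> pick out the component of
  degree \<open>n\<close> of an inhomogeneous element.\<close>

definition word_coord :: "nat \<Rightarrow> (nat \<Rightarrow> nat) \<Rightarrow> 'v list \<Rightarrow> 'f" where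
  "word_coord n u w = (if length w = n then \<Prod>p<n. coord (w ! p) (u p) else 0)"

definition tcoord :: "nat \<Rightarrow> ('v list \<Rightarrow>\<^sub>0 'f) \<Rightarrow> (nat \<Rightarrow> nat) \<Rightarrow> 'f" where
  "tcoord n a = (\<lambda>u. lin_ext (word_coord n u) a)"

lemma tcoord_add: "tcoord n (x + y) = (\<lambda>u. tcoord n x u + tcoord n y u)"
  by (simp add: tcoord_def lin_ext_add)

lemma tcoord_scale: "tcoord n (scale c x) = (\<lambda>u. c * tcoord n x u)"
  by (simp add: tcoord_def lin_ext_scale)

lemma tcoord_zero [simp]: "tcoord n 0 = (\<lambda>u. 0)"
  by (simp add: tcoord_def)

lemma tcoord_minus: "tcoord n (- x) = (\<lambda>u. - tcoord n x u)"
  using tcoord_add[of n x "- x"] by (auto simp: fun_eq_iff eq_neg_iff_add_eq_0 add.commute)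

lemma tcoord_diff: "tcoord n (x - y) = (\<lambda>u. tcoord n x u - tcoord n y u)"
  using tcoord_add[of n x "- y"] by (simp add: tcoord_minus)

lemma tcoord_sum: "tcoord n (\<Sum>i\<in>I. x i) = (\<lambda>u. \<Sum>i\<in>I. tcoord n (x i) u)"
  by (induction I rule: infinite_finite_induct) (simp_all add: tcoord_add)

lemma tcoord_single: "tcoord n (Poly_Mapping.single w c) u = c * word_coord n u w"
  by (simp add: tcoord_def)

lemma word_coord_Cons: "word_coord (Suc n) u (x # w) = coord x (u 0) * word_coord n (u \<circ> Suc) w"
  unfolding word_coord_def by (simp add: prod.lessThan_Suc_shift del: prod.lessThan_Suc)

lemma word_coord_snoc: "word_coord (Suc n) u (w @ [x]) = word_coord n u w * coord x (u n)"
  unfolding word_coord_def by (auto simp: nth_append intro!: prod.cong)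

lemma word_coord_Cons_0: "word_coord 0 u (x # w) = 0" and word_coord_snoc_0: "word_coord 0 u (w @ [x]) = 0"
  by (simp_all add: word_coord_def)

lemma tcoord_prepend: "tcoord (Suc n) (fmul (Poly_Mapping.single [x] 1) a) u = coord x (u 0) * tcoord n a (u \<circ> Suc)"
  by (induction a rule: poly_mapping_add_induct)
     (simp_all add: fmul_add_right tcoord_add tcoord_single word_coord_Cons algebra_simps o_def)

lemma tcoord_prepend_0: "tcoord 0 (fmul (Poly_Mapping.single [x] 1) a) u = 0"
  by (induction a rule: poly_mapping_add_induct)
     (simp_all add: fmul_add_right tcoord_add tcoord_single word_coord_Cons_0)

lemma tcoord_append: "tcoord (Suc n) (fmul a (Poly_Mapping.single [x] 1)) u = tcoord n a u * coord x (u n)"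
  by (induction a rule: poly_mapping_add_induct)
     (simp_all add: fmul_add_left tcoord_add tcoord_single word_coord_snoc algebra_simps)

lemma tcoord_append_0: "tcoord 0 (fmul a (Poly_Mapping.single [x] 1)) u = 0"
  by (induction a rule: poly_mapping_add_induct)
     (simp_all add: fmul_add_left tcoord_add tcoord_single word_coord_snoc_0)

lemma local_tcoord: "local_fn n (tcoord n a)"
  unfolding local_fn_def
proof (intro allI impI)
  fix u v :: "nat \<Rightarrow> nat" assume "\<forall>x<n. u x = v x"
  then have "word_coord n u = word_coord n v" by (auto simp: word_coord_def fun_eq_iff intro!: prod.cong)
  then show "tcoord n a u = tcoord n a v" by (simp add: tcoord_def)
qed

lemma tcoord_large_letter:
  assumes "x < n" "k \<le> u x" shows "tcoord n a u = 0"
proof -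
  have "word_coord n u w = 0" for w
    using assms coord_ge by (auto simp: word_coord_def intro!: bexI[of _ x])
  then show ?thesis by (simp add: tcoord_def lin_ext_def)
qed

lemma tcoord_homogeneous:
  assumes "a \<in> homogeneous n" "j \<noteq> n" shows "tcoord j a = (\<lambda>u. 0)"
  using assms unfolding tcoord_def lin_ext_def homogeneous_def word_coord_def by (auto intro!: sum.neutral)

lemma tcoord_permute:
  assumes \<sigma>: "\<sigma> \<in> perms n" and a: "a \<in> homogeneous n"
  shows "tcoord n (relabel (permute_list (pinv \<sigma>)) a) = act \<sigma> (tcoord n a)"
proof
  fix u
  have \<sigma>i: "pinv \<sigma> permutes {..<n}" using perms_inv[OF \<sigma>] by (simp add: perms_def)
  have w: "word_coord n u (permute_list (pinv \<sigma>) w) = word_coord n (u \<circ> \<sigma>) w" if "length w = n" for w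
  proof -
    have "(\<Prod>p<n. coord (permute_list (pinv \<sigma>) w ! p) (u p)) = (\<Prod>p<n. coord (w ! p) (u (\<sigma> p)))"
      by (rule prod.reindex_bij_witness[where i = \<sigma> and j = "pinv \<sigma>"])
         (use \<sigma> \<sigma>i that perms_less[OF \<sigma>] perms_less[OF perms_inv[OF \<sigma>]] pinv_apply[OF \<sigma>] in \<open>auto simp: permute_list_nth\<close>)
    then show ?thesis using that by (simp add: word_coord_def)
  qed
  have "tcoord n (relabel (permute_list (pinv \<sigma>)) a) u =
      (\<Sum>w\<in>Poly_Mapping.keys a. Poly_Mapping.lookup a w * word_coord n u (permute_list (pinv \<sigma>) w))"
    unfolding relabel_def tcoord_sum by (simp add: tcoord_single)
  also have "\<dots> = (\<Sum>w\<in>Poly_Mapping.keys a. Poly_Mapping.lookup a w * word_coord n (u \<circ> \<sigma>) w)"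
    by (rule sum.cong) (use a w in \<open>auto simp: homogeneous_def\<close>)
  finally show "tcoord n (relabel (permute_list (pinv \<sigma>)) a) u = act \<sigma> (tcoord n a) u"
    by (simp add: act_def tcoord_def lin_ext_def)
qed

lemma relabel_permute_homogeneous: "a \<in> homogeneous n \<Longrightarrow> relabel (permute_list h) a \<in> homogeneous n"
proof -
  assume a: "a \<in> homogeneous n"
  have "Poly_Mapping.keys (relabel (permute_list h) a) \<subseteq> permute_list h ` Poly_Mapping.keys a"
    unfolding relabel_def by (rule order_trans[OF keys_sum]) auto
  then show ?thesis using a by (auto simp: homogeneous_def)
qed

section \<open>The coordinate kernel and the tensor relations\<close>

definition tkernel :: "('v list \<Rightarrow>\<^sub>0 'f) set" where
  "tkernel = {a. \<forall>n. tcoord n a = (\<lambda>u. 0)}"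

lemma subspace_tkernel: "Modules.module.subspace scale tkernel"
  unfolding subspace_scale_eq by (auto simp: tkernel_def tcoord_add tcoord_scale)

text \<open>Single letters suffice because they generate the free algebra.\<close>

lemma two_sided_closed:
  fixes L :: "('v list \<Rightarrow>\<^sub>0 'f) set"
  assumes L: "Modules.module.subspace scale L"
    and pre: "\<And>x a. a \<in> L \<Longrightarrow> fmul (Poly_Mapping.single [x] 1) a \<in> L"
    and app: "\<And>x a. a \<in> L \<Longrightarrow> fmul a (Poly_Mapping.single [x] 1) \<in> L"
    and a: "a \<in> L"
  shows "fmul a c \<in> L \<and> fmul c a \<in> L"
proof -
  note L' = L[unfolded subspace_scale_eq]
  have "fmul a' (Poly_Mapping.single w d) \<in> L \<and> fmul (Poly_Mapping.single w d) a' \<in> L" if "a' \<in> L" for w d a'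
  proof
    have one: "fmul x (Poly_Mapping.single [] d) = scale d x" "fmul (Poly_Mapping.single [] d) x = scale d x"
      for d :: 'f and x :: "'v list \<Rightarrow>\<^sub>0 'f"
      using fmul_scale(1)[of d "Poly_Mapping.single [] 1" x] fmul_scale(2)[of x d "Poly_Mapping.single [] 1"] fmul_one[of x]
      by simp_all
    show "fmul a' (Poly_Mapping.single w d) \<in> L" using that
    proof (induction w arbitrary: a')
      case Nil
      then show ?case unfolding one using L' by blast
    next
      case (Cons x w)
      then show ?case unfolding single_Cons[of x w d] fmul_assoc[symmetric] using app by blast
    qed
    show "fmul (Poly_Mapping.single w d) a' \<in> L" using that
    proof (induction w arbitrary: a' rule: rev_induct)
      case Nil
      then show ?case unfolding one using L' by blast
    next
      case (snoc x w)
      then show ?case unfolding single_snoc[of w x d] fmul_assoc using pre by blast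
    qed
  qed
  then show ?thesis
    by (induction c rule: poly_mapping_add_induct) (use L' a in \<open>auto simp: fmul_add_left fmul_add_right\<close>)
qed

lemma tkernel_two_sided: "a \<in> tkernel \<Longrightarrow> fmul a c \<in> tkernel \<and> fmul c a \<in> tkernel"
proof (rule two_sided_closed[OF subspace_tkernel])
  fix x a assume a: "a \<in> tkernel"
  show "fmul (Poly_Mapping.single [x] 1) a \<in> tkernel"
    unfolding tkernel_def
  proof (safe, rule ext)
    fix n u show "tcoord n (fmul (Poly_Mapping.single [x] 1) a) u = 0"
      using a by (cases n) (simp_all add: tcoord_prepend tcoord_prepend_0 tkernel_def)
  qed
  show "fmul a (Poly_Mapping.single [x] 1) \<in> tkernel"
    unfolding tkernel_def
  proof (safe, rule ext)
    fix n u show "tcoord n (fmul a (Poly_Mapping.single [x] 1)) u = 0"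
      using a by (cases n) (simp_all add: tcoord_append tcoord_append_0 tkernel_def)
  qed
qed

lemma basis_inj: "inj_on b {..<k}"
  by (rule inj_onI) (metis coord_basis lessThan_iff zero_neq_one)

lemma word_coord_basis:
  assumes "set l \<subseteq> {..<k}"
  shows "word_coord n u (map b l) = (if l = map u [0..<n] then 1 else 0)"
proof (cases "length l = n")
  case True
  have "coord (map b l ! p) (u p) = (if l ! p = u p then 1 else 0)" if "p < n" for p
    using that assms True coord_basis[of "l ! p" "u p"] by (auto simp: subset_iff)
  then have "word_coord n u (map b l) = (\<Prod>p<n. if l ! p = u p then 1 else 0)"
    using True by (simp add: word_coord_def)
  also have "\<dots> = (if \<forall>p<n. l ! p = u p then 1 else 0)"
    by (auto intro: prod.neutral)
  also have "(\<forall>p<n. l ! p = u p) \<longleftrightarrow> l = map u [0..<n]" using True by (auto simp: list_eq_iff_nth_eq)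
  finally show ?thesis .
qed (auto simp: word_coord_def)

definition basis_words :: "'v list set" where
  "basis_words = map b ` {l. set l \<subseteq> {..<k}}"

lemma tcoord_basis_words:
  assumes a: "Poly_Mapping.keys a \<subseteq> basis_words" and u: "\<And>x. x < n \<Longrightarrow> u x < k"
  shows "tcoord n a u = Poly_Mapping.lookup a (map b (map u [0..<n]))"
proof -
  have *: "word_coord n u w = (if w = map b (map u [0..<n]) then 1 else 0)" if w: "w \<in> basis_words" for w
  proof -
    obtain l where l: "w = map b l" "set l \<subseteq> {..<k}" using w by (auto simp: basis_words_def)
    have "map b l = map b (map u [0..<n]) \<longleftrightarrow> l = map u [0..<n]"
      by (rule inj_on_map_eq_map, rule inj_on_subset[OF basis_inj]) (use l u in auto)
    then show ?thesis using word_coord_basis[OF l(2), of n u] l(1) by simp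
  qed
  have "tcoord n a u = (\<Sum>w\<in>Poly_Mapping.keys a. if w = map b (map u [0..<n]) then Poly_Mapping.lookup a w else 0)"
    unfolding tcoord_def lin_ext_def by (rule sum.cong) (use a * in auto)
  also have "\<dots> = Poly_Mapping.lookup a (map b (map u [0..<n]))"
    by (simp add: in_keys_iff)
  finally show ?thesis .
qed

lemma tkernel_basis_words:
  assumes "a \<in> tkernel" "Poly_Mapping.keys a \<subseteq> basis_words" shows "a = 0"
proof (rule poly_mapping_eqI)
  fix w show "Poly_Mapping.lookup a w = Poly_Mapping.lookup 0 w"
  proof (cases "w \<in> basis_words")
    case True
    then obtain l where l: "w = map b l" "set l \<subseteq> {..<k}" by (auto simp: basis_words_def)
    have "map ((!) l) [0..<length l] = l" by (rule map_nth)
    then have "Poly_Mapping.lookup a w = tcoord (length l) a ((!) l)"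
      using tcoord_basis_words[OF assms(2), of "length l" "(!) l"] l by (auto simp: subset_iff)
    then show ?thesis using assms(1) by (simp add: tkernel_def)
  qed (use assms(2) in \<open>auto simp: not_in_keys_iff_lookup_eq_zero[symmetric]\<close>)
qed

sublocale F: param_ring "scale :: 'f \<Rightarrow> ('v list \<Rightarrow>\<^sub>0 'f) \<Rightarrow> _" free_algebra "\<lambda>a. a" "{0}" fmul "Poly_Mapping.single [] 1"
  by (rule param_ring_free_algebra)

lemma ideal_relations: "ideal (tensor_relations s) free_algebra"
  unfolding tensor_relations_def by (rule ring.genideal_ideal[OF F.is_ring]) (simp add: free_algebra_simps)

lemma relations_subspace: "F.subspace (tensor_relations s)"
proof -
  \<comment> \<open>Scalars act as multiples of the empty word, so an ideal of the ring is a
    subspace.\<close>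
  have "scale c x \<in> tensor_relations s" if "x \<in> tensor_relations s" for c x
  proof -
    have "scale c x = fmul (Poly_Mapping.single [] c) x"
      using fmul_scale(1)[of c "Poly_Mapping.single [] 1" x] by (simp add: fmul_one)
    then show ?thesis using ideal.I_l_closed[OF ideal_relations that, of "Poly_Mapping.single [] c"]
      by (simp add: free_algebra_simps)
  qed
  then show ?thesis using F.ideal_preimage(1)[OF ideal_relations] by simp
qed

lemma relations_two_sided: "a \<in> tensor_relations s \<Longrightarrow> fmul a c \<in> tensor_relations s \<and> fmul c a \<in> tensor_relations s"
  using ideal.I_l_closed[OF ideal_relations, of a c] ideal.I_r_closed[OF ideal_relations, of a c]
  by (simp add: free_algebra_simps)

lemmas relations_closed = F.subspace_add[OF relations_subspace] F.subspace_0[OF relations_subspace]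
  F.subspace_diff[OF relations_subspace] F.subspace_scale[OF relations_subspace]

lemma relations_generators:
  "Poly_Mapping.single [v + w] 1 - Poly_Mapping.single [v] 1 - Poly_Mapping.single [w] 1 \<in> tensor_relations s"
  "Poly_Mapping.single [s c v] 1 - Poly_Mapping.single [v] c \<in> tensor_relations s"
  using ring.genideal_self[OF F.is_ring, of "({Poly_Mapping.single [v + w] 1 - Poly_Mapping.single [v] 1 - Poly_Mapping.single [w] 1 | v w. True}
      \<union> {Poly_Mapping.single [s c v] 1 - Poly_Mapping.single [v] c | c v. True})"]
  unfolding tensor_relations_def by (auto simp: free_algebra_simps)

lemma relations_subset_tkernel: "tensor_relations s \<subseteq> tkernel"
  unfolding tensor_relations_def
proof (rule ring.genideal_minimal[OF F.is_ring])
  show "ideal tkernel free_algebra"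
    using F.ideal_image[OF subspace_tkernel tkernel_two_sided] by simp
  have "word_coord n u [v + w] = word_coord n u [v] + word_coord n u [w]" for n u v w
    by (auto simp: word_coord_def coord_add)
  moreover have "word_coord n u [s c v] = c * word_coord n u [v]" for n u c v
    by (auto simp: word_coord_def coord_scale)
  ultimately show "{Poly_Mapping.single [v + w] 1 - Poly_Mapping.single [v] 1 - Poly_Mapping.single [w] 1 | v w. True}
      \<union> {Poly_Mapping.single [s c v] 1 - Poly_Mapping.single [v] c | c v. True} \<subseteq> tkernel"
    by (auto simp: tkernel_def tcoord_diff tcoord_single fun_eq_iff)
qed

lemma single_sum_relation:
  assumes "finite I"
  shows "Poly_Mapping.single [\<Sum>i\<in>I. s (c i) (v i)] 1 - (\<Sum>i\<in>I. Poly_Mapping.single [v i] (c i)) \<in> tensor_relations s"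
  using assms
proof (induction I rule: finite_induct)
  case empty
  interpret vector_space s by (rule vector_space_s)
  show ?case using relations_generators(2)[of 0 0] by simp
next
  case (insert i I)
  let ?S = "\<Sum>i\<in>I. s (c i) (v i)"
  have "Poly_Mapping.single [s (c i) (v i) + ?S] 1 - (Poly_Mapping.single [v i] (c i) + (\<Sum>i\<in>I. Poly_Mapping.single [v i] (c i))) =
    (Poly_Mapping.single [s (c i) (v i) + ?S] 1 - Poly_Mapping.single [s (c i) (v i)] 1 - Poly_Mapping.single [?S] 1) +
    ((Poly_Mapping.single [s (c i) (v i)] 1 - Poly_Mapping.single [v i] (c i)) +
     (Poly_Mapping.single [?S] 1 - (\<Sum>i\<in>I. Poly_Mapping.single [v i] (c i))))" by simp
  moreover have "\<dots> \<in> tensor_relations s"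
    by (rule relations_closed(1)[OF relations_generators(1) relations_closed(1)[OF relations_generators(2) insert.IH]])
  ultimately have "Poly_Mapping.single [s (c i) (v i) + ?S] 1 - (Poly_Mapping.single [v i] (c i) + (\<Sum>i\<in>I. Poly_Mapping.single [v i] (c i))) \<in> tensor_relations s"
    by metis
  then show ?case by (simp only: sum.insert[OF insert.hyps])
qed

text \<open>Multilinearity expands one letter at a time; in the induction \<open>Z\<close> is the
  expansion of the letter \<open>x\<close> in the basis.\<close>

lemma normal_form: "\<exists>a'. Poly_Mapping.keys a' \<subseteq> basis_words \<and> a - a' \<in> tensor_relations s"
proof (induction a rule: poly_mapping_add_induct)
  case zero
  show ?case by (rule exI[of _ 0]) (simp add: relations_closed)
next
  case (add x y)
  then obtain x' y' where xy: "Poly_Mapping.keys x' \<subseteq> basis_words" "x - x' \<in> tensor_relations s"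
    "Poly_Mapping.keys y' \<subseteq> basis_words" "y - y' \<in> tensor_relations s" by blast
  have "(x + y) - (x' + y') = (x - x') + (y - y')" by simp
  then show ?case using xy relations_closed(1) Poly_Mapping.keys_add[of x' y']
    by (intro exI[of _ "x' + y'"]) (metis (no_types, lifting) Un_least order_trans)
next
  case (single w c)
  show ?case
  proof (induction w)
    case Nil
    have "[] \<in> basis_words" by (auto simp: basis_words_def intro: image_eqI[of _ _ "[]"])
    then show ?case by (intro exI[of _ "Poly_Mapping.single [] c"]) (auto simp: relations_closed)
  next
    case (Cons x w)
    then obtain a' where a': "Poly_Mapping.keys a' \<subseteq> basis_words" "Poly_Mapping.single w c - a' \<in> tensor_relations s" by blast
    define Z where "Z = (\<Sum>i<k. Poly_Mapping.single [b i] (coord x i))"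
    have x: "Poly_Mapping.single [x] 1 - Z \<in> tensor_relations s"
      using single_sum_relation[of "{..<k}" "coord x" b] coord_expand[of x] by (simp add: Z_def)
    have kX: "Poly_Mapping.keys Z \<subseteq> (\<lambda>i. [b i]) ` {..<k}"
      unfolding Z_def by (rule order_trans[OF keys_sum]) auto
    have "g @ h \<in> basis_words" if g: "g \<in> Poly_Mapping.keys Z" and h: "h \<in> Poly_Mapping.keys a'" for g h
    proof -
      obtain i where i: "i < k" "g = [b i]" using g kX by auto
      obtain l where l: "h = map b l" "set l \<subseteq> {..<k}" using h a' by (auto simp: basis_words_def)
      have "g @ h = map b (i # l)" using i l by simp
      then show ?thesis using i l unfolding basis_words_def by (intro image_eqI[of _ _ "i # l"]) auto
    qed
    then have keys: "Poly_Mapping.keys (fmul Z a') \<subseteq> basis_words" using keys_fmul[of Z a'] by auto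
    have "Poly_Mapping.single (x # w) c - fmul Z a' =
      fmul (Poly_Mapping.single [x] 1 - Z) (Poly_Mapping.single w c) + fmul Z (Poly_Mapping.single w c - a')"
      unfolding F.mul_diff single_Cons[of x w c] by simp
    then have "Poly_Mapping.single (x # w) c - fmul Z a' \<in> tensor_relations s"
      using x a'(2) relations_two_sided relations_closed(1) by metis
    then show ?case using keys by blast
  qed
qed

text \<open>Every element is congruent modulo the relations to a combination of basis words, and on
  these the coordinates are faithful. Hence an element without coordinates is a relation.\<close>

theorem relations_eq_tkernel: "tensor_relations s = tkernel"
proof
  show "tkernel \<subseteq> tensor_relations s"
  proof
    fix a assume a: "a \<in> tkernel"
    obtain a' where a': "Poly_Mapping.keys a' \<subseteq> basis_words" "a - a' \<in> tensor_relations s" using normal_form by blast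
    have "a' = a - (a - a')" by simp
    then have "a' \<in> tkernel" using a a'(2) relations_subset_tkernel F.subspace_diff[OF subspace_tkernel] by (metis subsetD)
    then show "a \<in> tensor_relations s" using tkernel_basis_words a' by fastforce
  qed
qed (rule relations_subset_tkernel)

section \<open>Tensor algebra and tensor powers in coordinates\<close>

abbreviation cls :: "('v list \<Rightarrow>\<^sub>0 'f) \<Rightarrow> ('v list \<Rightarrow>\<^sub>0 'f) set" where
  "cls a \<equiv> tensor_relations s +>\<^bsub>free_algebra\<^esub> a"

sublocale T: param_ring "scale :: 'f \<Rightarrow> ('v list \<Rightarrow>\<^sub>0 'f) \<Rightarrow> _" "tensor_algebra s" cls "tkernel" fmul "Poly_Mapping.single [] 1"
  using F.param_ring_quotient[OF subspace_tkernel _ tkernel_two_sided] F.subspace_0[OF subspace_tkernel]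
  by (simp add: tensor_algebra_def relations_eq_tkernel)

lemma param_tensor_power: "param_space scale (tensor_power s n) cls (homogeneous n) (tkernel \<inter> homogeneous n)"
  using T.param_restrict[OF subspace_homogeneous] by (simp add: tensor_power_def)

lemma cls_eq_iff: "cls x = cls y \<longleftrightarrow> (\<forall>n. tcoord n x = tcoord n y)"
  using T.pi_eq_iff[of x y] by (auto simp: tkernel_def tcoord_diff fun_eq_iff)

lemma cls_eq_homogeneous:
  assumes "x \<in> homogeneous n" "y \<in> homogeneous n"
  shows "cls x = cls y \<longleftrightarrow> tcoord n x = tcoord n y"
  using tcoord_homogeneous[OF assms(1)] tcoord_homogeneous[OF assms(2)] unfolding cls_eq_iff by metis

lemma mem_cls: "x \<in> cls a \<longleftrightarrow> (\<forall>n. tcoord n x = tcoord n a)"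
proof -
  have "cls a = {y \<in> UNIV. y - a \<in> tkernel}"
    using F.coset_eq[OF subspace_tkernel, of a] F.subspace_0[OF subspace_tkernel] by (simp add: relations_eq_tkernel)
  then show ?thesis by (auto simp: tkernel_def tcoord_diff fun_eq_iff)
qed

text \<open>The union in \<open>place_action\<close> runs over all homogeneous representatives of
  the class. They share their coordinates, so they all lead to the same class.\<close>

lemma place_action_cls:
  assumes \<sigma>: "\<sigma> \<in> perms n" and a: "a \<in> homogeneous n"
  shows "place_action s n \<sigma> (cls a) = cls (relabel (permute_list (pinv \<sigma>)) a)"
proof -
  have "cls (relabel (permute_list (pinv \<sigma>)) x) = cls (relabel (permute_list (pinv \<sigma>)) a)"
    if "x \<in> cls a \<inter> homogeneous n" for x
  proof -
    have x: "x \<in> homogeneous n" "tcoord n x = tcoord n a" using that by (auto simp: mem_cls)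
    show ?thesis
      using x by (simp add: cls_eq_homogeneous[OF relabel_permute_homogeneous[OF x(1)] relabel_permute_homogeneous[OF a]]
          tcoord_permute[OF \<sigma> x(1)] tcoord_permute[OF \<sigma> a])
  qed
  moreover have "a \<in> cls a \<inter> homogeneous n" using a by (simp add: mem_cls)
  ultimately show ?thesis unfolding place_action_def relabel_def[symmetric] by blast
qed

lemma tcoord_surj:
  assumes "local_fn n f" "\<And>u x. f u \<noteq> 0 \<Longrightarrow> x < n \<Longrightarrow> u x < k"
  obtains a where "a \<in> homogeneous n" "tcoord n a = f" "Poly_Mapping.keys a \<subseteq> basis_words"
proof -
  define W where "W = {l. set l \<subseteq> {..<k} \<and> length l = n}"
  have fin: "finite W" unfolding W_def by (rule finite_lists_length_eq) simp
  define a where "a = (\<Sum>l\<in>W. Poly_Mapping.single (map b l) (f ((!) l)))"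
  have ka: "Poly_Mapping.keys a \<subseteq> map b ` W" unfolding a_def by (rule order_trans[OF keys_sum]) auto
  then have kb: "Poly_Mapping.keys a \<subseteq> basis_words" by (auto simp: basis_words_def W_def)
  have "a \<in> homogeneous n" using ka by (auto simp: homogeneous_def W_def)
  moreover have "tcoord n a = f"
  proof
    fix u
    have "tcoord n a u = (\<Sum>l\<in>W. f ((!) l) * (if l = map u [0..<n] then 1 else 0))"
      unfolding a_def tcoord_sum by (rule sum.cong) (auto simp: tcoord_single word_coord_basis W_def)
    also have "\<dots> = (if map u [0..<n] \<in> W then f ((!) (map u [0..<n])) else 0)"
      using fin by (simp add: if_distrib[of "\<lambda>x. _ * x"] cong: if_cong)
    also have "f ((!) (map u [0..<n])) = f u" by (rule local_fnD[OF assms(1)]) simp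
    also have "(if map u [0..<n] \<in> W then f u else 0) = f u"
      using assms(2)[of u] by (auto simp: W_def)
    finally show "tcoord n a u = f u" .
  qed
  ultimately show ?thesis using that kb by blast
qed

end

section \<open>Isotypic components of tensor powers\<close>

lemma keys_add_subset:
  assumes "Poly_Mapping.keys a \<subseteq> S" "Poly_Mapping.keys b \<subseteq> S"
  shows "Poly_Mapping.keys (a + b) \<subseteq> S"
  using order_trans[OF Poly_Mapping.keys_add Un_least[OF assms]] .

text \<open>The product of \<open>monoid_algebra (symgrp n)\<close>, whose formula is the same for
  all \<open>n\<close>.\<close>

definition gmul :: "((nat \<Rightarrow> nat) \<Rightarrow>\<^sub>0 'f::field) \<Rightarrow> ((nat \<Rightarrow> nat) \<Rightarrow>\<^sub>0 'f) \<Rightarrow> (nat \<Rightarrow> nat) \<Rightarrow>\<^sub>0 'f" where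
  "gmul a b = (\<Sum>g\<in>Poly_Mapping.keys a. \<Sum>h\<in>Poly_Mapping.keys b.
     Poly_Mapping.single (g \<circ> h) (Poly_Mapping.lookup a g * Poly_Mapping.lookup b h))"

definition alg_op :: "((nat \<Rightarrow> nat) \<Rightarrow>\<^sub>0 'f::field) \<Rightarrow> ((nat \<Rightarrow> nat) \<Rightarrow> 'f) \<Rightarrow> (nat \<Rightarrow> nat) \<Rightarrow> 'f" where
  "alg_op a f = (\<lambda>u. lin_ext (\<lambda>\<sigma>. f (u \<circ> \<sigma>)) a)"

lemma lin_ext_sum: "lin_ext g (\<Sum>i\<in>I. a i) = (\<Sum>i\<in>I. lin_ext g (a i))"
  by (induction I rule: infinite_finite_induct) (simp_all add: lin_ext_add)

lemma alg_op_add: "alg_op (a + b) f = (\<lambda>u. alg_op a f u + alg_op b f u)"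
  by (simp add: alg_op_def lin_ext_add)

lemma alg_op_scale: "alg_op (scale c a) f = (\<lambda>u. c * alg_op a f u)"
  by (simp add: alg_op_def lin_ext_scale)

lemma alg_op_single: "alg_op (Poly_Mapping.single \<sigma> c) f = (\<lambda>u. c * act \<sigma> f u)"
  by (simp add: alg_op_def act_def)

lemma alg_op_zero [simp]: "alg_op 0 f = (\<lambda>u. 0)"
  by (simp add: alg_op_def)

lemma alg_op_sum: "alg_op (\<Sum>i\<in>I. a i) f = (\<lambda>u. \<Sum>i\<in>I. alg_op (a i) f u)"
  by (simp add: alg_op_def lin_ext_sum)

lemma alg_op_gmul: "alg_op (gmul a b) f = alg_op a (alg_op b f)"
  unfolding alg_op_def gmul_def lin_ext_sum lin_ext_single
  by (simp add: lin_ext_def sum_distrib_left mult.assoc comp_assoc)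

lemma keys_gmul:
  assumes "Poly_Mapping.keys a \<subseteq> perms n" "Poly_Mapping.keys b \<subseteq> perms n"
  shows "Poly_Mapping.keys (gmul a b) \<subseteq> perms n"
proof -
  have "Poly_Mapping.keys (gmul a b) \<subseteq> (\<Union>g\<in>Poly_Mapping.keys a. \<Union>h\<in>Poly_Mapping.keys b. {g \<circ> h})"
    unfolding gmul_def
    by (rule order_trans[OF keys_sum], rule UN_mono[OF subset_refl], rule order_trans[OF keys_sum], rule UN_mono[OF subset_refl]) auto
  then show ?thesis using assms perms_comp by blast
qed

lemma group_op_alg_op:
  assumes "Poly_Mapping.keys a \<subseteq> perms n" shows "group_op n (alg_op a)"
  by (rule group_opI[where a = "Poly_Mapping.lookup a"])
     (simp add: alg_op_def lin_ext_superset[OF finite_perms assms])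

lemma alg_op_delta_id:
  assumes "Poly_Mapping.keys a \<subseteq> perms n" "\<tau> \<in> perms n"
  shows "alg_op a delta_id (pinv \<tau>) = (Poly_Mapping.lookup a \<tau> :: 'f::field_char_0)"
proof -
  have "pinv \<tau> \<circ> \<sigma> = id \<longleftrightarrow> \<sigma> = \<tau>" if "\<sigma> \<in> perms n" for \<sigma>
  proof
    assume "pinv \<tau> \<circ> \<sigma> = id"
    then have "\<tau> \<circ> (pinv \<tau> \<circ> \<sigma>) = \<tau>" by simp
    then show "\<sigma> = \<tau>" using assms(2) by (simp add: comp_assoc[symmetric])
  qed (use assms(2) in simp)
  then have "alg_op a delta_id (pinv \<tau>) = (\<Sum>\<sigma>\<in>perms n. if \<sigma> = \<tau> then Poly_Mapping.lookup a \<sigma> else 0)"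
    unfolding alg_op_def lin_ext_superset[OF finite_perms assms(1)] delta_id_def by (intro sum.cong) auto
  then show ?thesis using assms(2) by simp
qed

text \<open>The word \<open>id\<close> has a free orbit, so the coefficients can be read off from
  the values on \<open>delta_id\<close>. This is the faithfulness of the regular
  representation.\<close>

lemma alg_op_inj:
  assumes "Poly_Mapping.keys a \<subseteq> perms n" "Poly_Mapping.keys b \<subseteq> perms n"
    and "alg_op a delta_id = alg_op b (delta_id :: _ \<Rightarrow> 'f::field_char_0)"
  shows "a = b"
proof (rule poly_mapping_eqI)
  fix \<tau> show "Poly_Mapping.lookup a \<tau> = Poly_Mapping.lookup b \<tau>"
  proof (cases "\<tau> \<in> perms n")
    case True
    then show ?thesis using alg_op_delta_id[OF assms(1) True] alg_op_delta_id[OF assms(2) True] assms(3) by simp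
  next
    case False
    then have "\<tau> \<notin> Poly_Mapping.keys a" "\<tau> \<notin> Poly_Mapping.keys b" using assms by auto
    then show ?thesis by (simp add: in_keys_iff)
  qed
qed

lemma alg_op_young:
  assumes "\<mu> \<in> partitions"
  shows "alg_op (young_symmetrizer \<mu>) f = row_op \<mu> (col_op \<mu> f)"
  by (simp add: young_symmetrizer_def alg_op_sum alg_op_single row_op_def col_op_def act_def comp_assoc)

lemma keys_young:
  assumes "\<mu> \<in> partitions"
  shows "Poly_Mapping.keys (young_symmetrizer \<mu> :: _ \<Rightarrow>\<^sub>0 'f::field) \<subseteq> perms (psize \<mu>)"
proof -
  have "Poly_Mapping.keys (young_symmetrizer \<mu> :: _ \<Rightarrow>\<^sub>0 'f::field) \<subseteq> (\<Union>p\<in>row_group \<mu>. \<Union>q\<in>column_group \<mu>. {p \<circ> q})"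
    unfolding young_symmetrizer_def
    by (rule order_trans[OF keys_sum], rule UN_mono[OF subset_refl], rule order_trans[OF keys_sum], rule UN_mono[OF subset_refl]) auto
  then show ?thesis using perms_comp row_group_perms[OF assms] column_group_perms[OF assms] by blast
qed

lemma carrier_symgrp: "carrier (symgrp n) = perms n"
  by (simp add: symgrp_def perms_def)

lemma specht_simps:
  "carrier (specht \<mu>) = {gmul a (young_symmetrizer \<mu>) | a. Poly_Mapping.keys a \<subseteq> perms (psize \<mu>)}"
  "x \<oplus>\<^bsub>specht \<mu>\<^esub> y = x + y" "c \<odot>\<^bsub>specht \<mu>\<^esub> x = scale c x"
  "specht_action \<mu> \<sigma> x = gmul (Poly_Mapping.single \<sigma> 1) x"
  by (simp_all add: specht_def specht_action_def monoid_algebra_def Let_def symgrp_def gmul_def perms_def scale_def)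

lemma poly_mapping_keys_induct [consumes 1, case_names zero single add]:
  fixes a :: "'x \<Rightarrow>\<^sub>0 'f::comm_monoid_add"
  assumes "Poly_Mapping.keys a \<subseteq> S" "P 0" "\<And>x c. x \<in> S \<Longrightarrow> P (Poly_Mapping.single x c)"
    and "\<And>a b. Poly_Mapping.keys a \<subseteq> S \<Longrightarrow> Poly_Mapping.keys b \<subseteq> S \<Longrightarrow> P a \<Longrightarrow> P b \<Longrightarrow> P (a + b)"
  shows "P a"
proof -
  have "P (\<Sum>k\<in>T. Poly_Mapping.single k (Poly_Mapping.lookup a k)) \<and>
    Poly_Mapping.keys (\<Sum>k\<in>T. Poly_Mapping.single k (Poly_Mapping.lookup a k)) \<subseteq> S" if "finite T" "T \<subseteq> S" for T
    using that
  proof (induction T rule: finite_induct)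
    case (insert x T)
    have k: "Poly_Mapping.keys (Poly_Mapping.single x (Poly_Mapping.lookup a x)) \<subseteq> S" using insert.prems by auto
    have x: "P (Poly_Mapping.single x (Poly_Mapping.lookup a x))" using assms(3) insert.prems by blast
    have IH: "P (\<Sum>k\<in>T. Poly_Mapping.single k (Poly_Mapping.lookup a k))"
      "Poly_Mapping.keys (\<Sum>k\<in>T. Poly_Mapping.single k (Poly_Mapping.lookup a k)) \<subseteq> S"
      using insert by auto
    show ?case
      unfolding sum.insert[OF insert.hyps] using assms(4)[OF k IH(2) x IH(1)] keys_add_subset[OF k IH(2)] by blast
  qed (simp add: assms)
  from this[of "Poly_Mapping.keys a"] show ?thesis using assms(1) by (simp add: poly_mapping_sum_single)
qed

lemma gmul_linear:
  fixes a b c :: "(nat \<Rightarrow> nat) \<Rightarrow>\<^sub>0 'f::field"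
  shows gmul_add_right: "gmul a (b + c) = gmul a b + gmul a c" and gmul_add_left: "gmul (a + b) c = gmul a c + gmul b c"
  and gmul_scale_left: "gmul (scale d a) b = scale d (gmul a b)"
proof -
  have sup: "gmul a b = (\<Sum>g\<in>S. \<Sum>h\<in>T. Poly_Mapping.single (g \<circ> h) (Poly_Mapping.lookup a g * Poly_Mapping.lookup b h))"
    if "finite S" "Poly_Mapping.keys a \<subseteq> S" "finite T" "Poly_Mapping.keys b \<subseteq> T" for a b :: "(nat \<Rightarrow> nat) \<Rightarrow>\<^sub>0 'f" and S T
  proof -
    have "gmul a b = (\<Sum>g\<in>Poly_Mapping.keys a. \<Sum>h\<in>T. Poly_Mapping.single (g \<circ> h) (Poly_Mapping.lookup a g * Poly_Mapping.lookup b h))"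
      unfolding gmul_def
      by (intro sum.cong refl sum.mono_neutral_left) (use that in \<open>auto simp: not_in_keys_iff_lookup_eq_zero\<close>)
    also have "\<dots> = (\<Sum>g\<in>S. \<Sum>h\<in>T. Poly_Mapping.single (g \<circ> h) (Poly_Mapping.lookup a g * Poly_Mapping.lookup b h))"
      by (intro sum.mono_neutral_left) (use that in \<open>auto simp: not_in_keys_iff_lookup_eq_zero\<close>)
    finally show ?thesis .
  qed
  let ?S = "Poly_Mapping.keys a \<union> Poly_Mapping.keys b \<union> Poly_Mapping.keys c"
  have k: "Poly_Mapping.keys (a + b) \<subseteq> ?S" "Poly_Mapping.keys (b + c) \<subseteq> ?S" "Poly_Mapping.keys (scale d a) \<subseteq> ?S"
    using Poly_Mapping.keys_add[of a b] Poly_Mapping.keys_add[of b c] by (blast, blast, auto simp: in_keys_iff)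
  note sup' = sup[of ?S _ ?S]
  show "gmul a (b + c) = gmul a b + gmul a c"
    using sup'[of a "b + c"] sup'[of a b] sup'[of a c] k by (simp add: lookup_add distrib_left single_add sum.distrib le_supI1 le_supI2)
  show "gmul (a + b) c = gmul a c + gmul b c"
    using sup'[of "a + b" c] sup'[of a c] sup'[of b c] k by (simp add: lookup_add distrib_right single_add sum.distrib le_supI1 le_supI2)
  interpret vector_space scale by (rule vector_space_scale)
  show "gmul (scale d a) b = scale d (gmul a b)"
    using sup'[of "scale d a" b] sup'[of a b] k by (simp add: scale_sum_right mult.assoc le_supI1 le_supI2)
qed

lemma gmul_zero [simp]: "gmul 0 a = 0" "gmul a 0 = 0"
  using gmul_add_left[of 0 0 a] gmul_add_right[of a 0 0] by simp_all

context
  fixes \<mu> :: "nat \<Rightarrow> nat" and y :: "(nat \<Rightarrow> nat) \<Rightarrow>\<^sub>0 'f::field_char_0"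
  assumes \<mu>: "\<mu> \<in> partitions"
  defines "y \<equiv> young_symmetrizer \<mu>"
begin

lemma specht_keys: "x \<in> carrier (specht \<mu> :: ('f, _) module) \<Longrightarrow> Poly_Mapping.keys x \<subseteq> perms (psize \<mu>)"
  using keys_gmul keys_young[OF \<mu>] by (fastforce simp: specht_simps)

lemma specht_alg_op:
  assumes x: "x \<in> carrier (specht \<mu> :: ('f, _) module)"
  obtains a where "Poly_Mapping.keys a \<subseteq> perms (psize \<mu>)" "\<And>f. alg_op x f = alg_op a (row_op \<mu> (col_op \<mu> f))"
  using x by (auto simp: specht_simps alg_op_gmul alg_op_young[OF \<mu>])

lemma specht_closed:
  assumes x: "x \<in> carrier (specht \<mu> :: ('f, _) module)"
  shows specht_add: "x' \<in> carrier (specht \<mu> :: ('f, _) module) \<Longrightarrow> x + x' \<in> carrier (specht \<mu>)"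
    and specht_scale: "scale c x \<in> carrier (specht \<mu>)"
    and specht_gmul: "Poly_Mapping.keys d \<subseteq> perms (psize \<mu>) \<Longrightarrow> gmul d x \<in> carrier (specht \<mu>)"
proof -
  obtain a where a: "x = gmul a y" "Poly_Mapping.keys a \<subseteq> perms (psize \<mu>)" using x by (auto simp: specht_simps y_def)
  show "x + x' \<in> carrier (specht \<mu>)" if x': "x' \<in> carrier (specht \<mu>)"
  proof -
    obtain a' where a': "x' = gmul a' y" "Poly_Mapping.keys a' \<subseteq> perms (psize \<mu>)" using x' by (auto simp: specht_simps y_def)
    have "x + x' = gmul (a + a') y" by (simp add: a a' gmul_add_left)
    moreover have "Poly_Mapping.keys (a + a') \<subseteq> perms (psize \<mu>)" by (rule keys_add_subset[OF a(2) a'(2)])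
    ultimately show ?thesis by (auto simp: specht_simps y_def)
  qed
  have "scale c x = gmul (scale c a) y" by (simp add: a gmul_scale_left)
  moreover have "Poly_Mapping.keys (scale c a) \<subseteq> perms (psize \<mu>)" using a by (auto simp: in_keys_iff subset_iff)
  ultimately show "scale c x \<in> carrier (specht \<mu>)" by (auto simp: specht_simps y_def)
  show "gmul d x \<in> carrier (specht \<mu>)" if d: "Poly_Mapping.keys d \<subseteq> perms (psize \<mu>)"
  proof -
    have "gmul d x = gmul (gmul d a) y"
      by (rule alg_op_inj[of _ "psize \<mu>"])
         (unfold a(1) y_def, (intro keys_gmul d a(2) keys_young[OF \<mu>])+, simp add: alg_op_gmul)
    then show ?thesis using keys_gmul[OF d a(2)] by (auto simp: specht_simps y_def)
  qed
qed

text \<open>Elements of the Specht module are not functions on words, so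
  \<open>central_op \<mu>\<close> acts on them through this element of the group algebra.\<close>

definition central_elem :: "(nat \<Rightarrow> nat) \<Rightarrow>\<^sub>0 'f" where
  "central_elem = (\<Sum>g\<in>perms (psize \<mu>). gmul (Poly_Mapping.single g 1) (gmul y (Poly_Mapping.single (pinv g) 1)))"

lemma alg_op_central_elem: "alg_op central_elem f = central_op \<mu> f"
  by (simp add: central_elem_def alg_op_sum alg_op_gmul alg_op_single y_def alg_op_young[OF \<mu>]
      central_op_eq_sum_young[OF \<mu>])

lemma keys_central_elem: "Poly_Mapping.keys central_elem \<subseteq> perms (psize \<mu>)"
proof -
  have "Poly_Mapping.keys (gmul (Poly_Mapping.single g 1) (gmul y (Poly_Mapping.single (pinv g) (1::'f)))) \<subseteq> perms (psize \<mu>)"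
    if "g \<in> perms (psize \<mu>)" for g
    by (intro keys_gmul) (use that keys_young[OF \<mu>] perms_inv[OF that] in \<open>auto simp: y_def\<close>)
  then show ?thesis unfolding central_elem_def by (intro order_trans[OF keys_sum] UN_least)
qed

lemma central_op_specht:
  assumes x: "x \<in> carrier (specht \<mu>)"
  shows "central_op \<mu> (alg_op x f) = (\<lambda>u. central_const \<mu> * alg_op x f u :: 'f)"
proof -
  obtain a where a: "Poly_Mapping.keys a \<subseteq> perms (psize \<mu>)" "\<And>f. alg_op x f = alg_op a (row_op \<mu> (col_op \<mu> f))"
    using specht_alg_op[OF x] by blast
  note ga = group_op_alg_op[OF a(1)]
  show ?thesis
    unfolding a(2) central_op_commute[OF \<mu> ga] central_op_row_col[OF \<mu>] group_op_scale[OF ga] ..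
qed

lemma central_elem_specht:
  assumes x: "x \<in> carrier (specht \<mu>)"
  shows "gmul central_elem x = scale (central_const \<mu>) x"
proof (rule alg_op_inj[of _ "psize \<mu>"])
  show "Poly_Mapping.keys (gmul central_elem x) \<subseteq> perms (psize \<mu>)"
    by (rule keys_gmul[OF keys_central_elem specht_keys[OF x]])
  show "Poly_Mapping.keys (scale (central_const \<mu>) x) \<subseteq> perms (psize \<mu>)"
    by (rule specht_keys[OF specht_scale[OF x]])
qed (simp add: alg_op_gmul alg_op_central_elem central_op_specht[OF x] alg_op_scale)

text \<open>This is what remains of the irreducibility of the Specht module.\<close>
lemma specht_eval_inj:
  assumes x: "x \<in> carrier (specht \<mu>)" and f: "row_op \<mu> (col_op \<mu> f) \<noteq> (\<lambda>u. 0 :: 'f)"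
    and xf: "alg_op x f = (\<lambda>u. 0)"
  shows "x = 0"
proof -
  obtain a where a: "Poly_Mapping.keys a \<subseteq> perms (psize \<mu>)" "\<And>f. alg_op x f = alg_op a (row_op \<mu> (col_op \<mu> f))"
    using specht_alg_op[OF x] by blast
  note ga = group_op_alg_op[OF a(1)]
  have zero: "row_op \<mu> (col_op \<mu> (act g (alg_op x h))) = (\<lambda>u. 0)" if g: "g \<in> perms (psize \<mu>)" for g h
  proof -
    have "group_op (psize \<mu>) (\<lambda>f. col_op \<mu> (act g (alg_op a (row_op \<mu> f))))"
      by (rule group_op_comp[OF group_op_col_op[OF \<mu>] group_op_comp[OF group_op_act[OF g] group_op_comp[OF ga group_op_row_op[OF \<mu>]]]])
    then obtain c where c: "\<And>f. row_op \<mu> (col_op \<mu> (act g (alg_op a (row_op \<mu> (col_op \<mu> f))))) = (\<lambda>u. c * row_op \<mu> (col_op \<mu> f) u)"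
      using row_col_sandwich[OF \<mu>] by blast
    \<comment> \<open>Write Y for the Young operator. The sandwich identity at \<open>f\<close>
      reads c Y f = Y g x f = 0 with Y f nonzero. Hence c = 0, and the same identity then vanishes
      for every \<open>h\<close>.\<close>
    have "(\<lambda>u. c * row_op \<mu> (col_op \<mu> f) u) = (\<lambda>u. 0)"
      unfolding c[symmetric] a(2)[symmetric] xf group_op_zero[OF group_op_act[OF g]] group_op_zero[OF group_op_young[OF \<mu>]] ..
    then have "c * row_op \<mu> (col_op \<mu> f) u = 0" for u by metis
    then have "c = 0" using f by auto
    then show ?thesis using c[of h] a(2)[of h] by simp
  qed
  have "central_op \<mu> (alg_op x delta_id) = (\<lambda>u. 0)"
    unfolding central_op_eq_sum_young[OF \<mu>] by (rule ext, rule sum.neutral) (simp add: zero perms_inv, simp add: act_def)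
  then have "central_const \<mu> * alg_op x delta_id u = 0" for u using central_op_specht[OF x, of delta_id] by metis
  then have "alg_op x delta_id = alg_op 0 delta_id" using central_const_nonzero[OF \<mu>, where 'f = 'f] by auto
  then show ?thesis by (intro alg_op_inj[OF specht_keys[OF x], of 0]) auto
qed

end

section \<open>Copies of Specht modules inside tensor powers\<close>

context tensor_coords
begin

definition tvalue :: "nat \<Rightarrow> ('v list \<Rightarrow>\<^sub>0 'f) set \<Rightarrow> (nat \<Rightarrow> nat) \<Rightarrow> 'f" where
  "tvalue n C = tcoord n (SOME a. a \<in> C)"

lemma tvalue_cls [simp]: "tvalue n (cls a) = tcoord n a"
proof -
  have "a \<in> cls a" by (simp add: mem_cls)
  then have "(SOME a'. a' \<in> cls a) \<in> cls a" by (rule someI)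
  then show ?thesis by (simp add: tvalue_def mem_cls)
qed

text \<open>Exactly these functions are the coordinates of tensors of degree \<open>n\<close> over
  \<open>V\<close>.\<close>

definition letters_below :: "nat \<Rightarrow> ((nat \<Rightarrow> nat) \<Rightarrow> 'f) \<Rightarrow> bool" where
  "letters_below n f \<longleftrightarrow> local_fn n f \<and> (\<forall>u. f u \<noteq> 0 \<longrightarrow> (\<forall>x<n. u x < k))"

lemma letters_below_tcoord: "letters_below n (tcoord n a)"
  unfolding letters_below_def using local_tcoord tcoord_large_letter not_less by blast

lemma letters_below_group_op:
  assumes T: "group_op n T" and f: "letters_below n f" shows "letters_below n (T f)"
  unfolding letters_below_def
proof (intro conjI allI impI)
  show "local_fn n (T f)" using local_fn_group_op[OF T] f by (simp add: letters_below_def)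
  fix u x assume u: "T f u \<noteq> 0" and x: "x < n"
  obtain a where a: "\<And>f u. T f u = (\<Sum>\<sigma>\<in>perms n. a \<sigma> * f (u \<circ> \<sigma>))"
    using T unfolding group_op_def by blast
  have "(\<Sum>\<sigma>\<in>perms n. a \<sigma> * f (u \<circ> \<sigma>)) \<noteq> 0" using u by (simp add: a)
  then obtain \<sigma> where \<sigma>: "\<sigma> \<in> perms n" "f (u \<circ> \<sigma>) \<noteq> 0"
    by (rule sum.not_neutral_contains_not_neutral) auto
  have "pinv \<sigma> x < n" using perms_less[OF perms_inv[OF \<sigma>(1)]] x by simp
  then have "(u \<circ> \<sigma>) (pinv \<sigma> x) < k" using f \<sigma>(2) by (auto simp: letters_below_def)
  then show "u x < k" using pinv_apply[OF \<sigma>(1)] by simp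
qed

lemma letters_below_surj:
  assumes "letters_below n f"
  obtains a where "a \<in> homogeneous n" "tcoord n a = f" "Poly_Mapping.keys a \<subseteq> basis_words"
  using tcoord_surj[of n f] assms unfolding letters_below_def by blast

text \<open>\<open>central_elem\<close> multiplies the Specht module by
  \<open>central_const\<close>, and the injective map \<phi> carries this back to the copy
  \<open>U\<close>. For this, \<open>main\<close> extends the equivariance of \<phi> from
  permutations to the group algebra.\<close>

lemma copy_subset_eigenspace:
  assumes \<mu>: "\<mu> \<in> partitions" and n: "n = psize \<mu>"
    and U: "subspace_of U (tensor_power s n)"
    and iso: "rep_isomorphic (perms n) (tensor_power s n \<lparr> carrier := U \<rparr>) (place_action s n)
      (specht \<mu> :: ('f, _) module) (specht_action \<mu>)"
    and inv: "\<And>g x. g \<in> perms n \<Longrightarrow> x \<in> U \<Longrightarrow> place_action s n g x \<in> U"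
    and C: "C \<in> U"
  shows "central_op \<mu> (tvalue n C) = (\<lambda>u. central_const \<mu> * tvalue n C u)"
proof -
  interpret P: param_space scale "tensor_power s n" cls "homogeneous n" "tkernel \<inter> homogeneous n"
    by (rule param_tensor_power)
  have rep: "\<exists>a\<in>homogeneous n. x = cls a" if "x \<in> U" for x
    using P.subspace_ofD(2)[OF U] that by auto
  obtain \<phi> where \<phi>: "bij_betw \<phi> U (carrier (specht \<mu>))"
    "\<And>x y. x \<in> U \<Longrightarrow> y \<in> U \<Longrightarrow> \<phi> (x \<oplus>\<^bsub>tensor_power s n\<^esub> y) = \<phi> x + \<phi> y"
    "\<And>c x. x \<in> U \<Longrightarrow> \<phi> (c \<odot>\<^bsub>tensor_power s n\<^esub> x) = scale c (\<phi> x)"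
    "\<And>g x. g \<in> perms n \<Longrightarrow> x \<in> U \<Longrightarrow> \<phi> (place_action s n g x) = gmul (Poly_Mapping.single g 1) (\<phi> x)"
    using iso unfolding rep_isomorphic_def by (auto simp: specht_simps)
  interpret sub: submodule U "ring_of_type_algebra :: 'f ring" "tensor_power s n" by (rule U)
  have U_closed: "x \<oplus>\<^bsub>tensor_power s n\<^esub> y \<in> U" "c \<odot>\<^bsub>tensor_power s n\<^esub> x \<in> U" if "x \<in> U" "y \<in> U" for x y c
    using sub.m_closed[OF that] sub.smult_closed[OF _ that(1)] by (auto simp: ring_of_type_algebra_def)
  have tv: "tvalue n (x \<oplus>\<^bsub>tensor_power s n\<^esub> y) = (\<lambda>u. tvalue n x u + tvalue n y u)"
    "tvalue n (c \<odot>\<^bsub>tensor_power s n\<^esub> x) = (\<lambda>u. c * tvalue n x u)"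
    "g \<in> perms n \<Longrightarrow> tvalue n (place_action s n g x) = act g (tvalue n x)" if xy: "x \<in> U" "y \<in> U" for x y c g
  proof -
    obtain a where "a \<in> homogeneous n" "x = cls a" using rep[OF xy(1)] by blast
    moreover obtain a' where "a' \<in> homogeneous n" "y = cls a'" using rep[OF xy(2)] by blast
    ultimately have a: "a \<in> homogeneous n" "x = cls a" "a' \<in> homogeneous n" "y = cls a'" by auto
    show "tvalue n (x \<oplus>\<^bsub>tensor_power s n\<^esub> y) = (\<lambda>u. tvalue n x u + tvalue n y u)"
      "tvalue n (c \<odot>\<^bsub>tensor_power s n\<^esub> x) = (\<lambda>u. c * tvalue n x u)"
      using a by (simp_all add: P.add_eq P.smult_eq tcoord_add tcoord_scale)
    show "tvalue n (place_action s n g x) = act g (tvalue n x)" if "g \<in> perms n"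
      using a that by (simp add: place_action_cls tcoord_permute)
  qed
  have main: "\<exists>x\<in>U. \<phi> x = gmul d (\<phi> C) \<and> tvalue n x = alg_op d (tvalue n C)"
    if "Poly_Mapping.keys d \<subseteq> perms n" for d
    using that
  proof (induction d rule: poly_mapping_keys_induct)
    case zero
    have "scale 0 (\<phi> C) = 0" by (rule poly_mapping_eqI) simp
    then show ?case using U_closed[OF C C] \<phi>(3)[OF C, of 0] tv(2)[OF C C, of 0] by (intro bexI[of _ "0 \<odot>\<^bsub>tensor_power s n\<^esub> C"]) simp_all
  next
    case (single g c)
    let ?x = "c \<odot>\<^bsub>tensor_power s n\<^esub> (place_action s n g C)"
    have pU: "place_action s n g C \<in> U" by (rule inv[OF single C])
    have "\<phi> ?x = scale c (gmul (Poly_Mapping.single g 1) (\<phi> C))" using \<phi>(3)[OF pU] \<phi>(4)[OF single C] by simp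
    also have "\<dots> = gmul (Poly_Mapping.single g c) (\<phi> C)" unfolding gmul_scale_left[symmetric] by simp
    finally show ?case using U_closed(2)[OF pU pU] tv(2)[OF pU pU] tv(3)[OF C C single]
      by (intro bexI[of _ ?x]) (simp_all add: alg_op_single)
  next
    case (add a b)
    then obtain x y where "x \<in> U" "\<phi> x = gmul a (\<phi> C)" "tvalue n x = alg_op a (tvalue n C)"
      "y \<in> U" "\<phi> y = gmul b (\<phi> C)" "tvalue n y = alg_op b (tvalue n C)" by blast
    then show ?case using U_closed(1) \<phi>(2) tv(1)
      by (intro bexI[of _ "x \<oplus>\<^bsub>tensor_power s n\<^esub> y"]) (simp_all add: gmul_add_left alg_op_add)
  qed
  have sp: "\<phi> C \<in> carrier (specht \<mu>)" using \<phi>(1) C by (auto simp: bij_betw_def)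
  obtain x where x: "x \<in> U" "\<phi> x = gmul (central_elem \<mu>) (\<phi> C)" "tvalue n x = alg_op (central_elem \<mu>) (tvalue n C)"
    using main[of "central_elem \<mu>"] keys_central_elem[OF \<mu>] n by blast
  have "\<phi> x = \<phi> (central_const \<mu> \<odot>\<^bsub>tensor_power s n\<^esub> C)"
    using x(2) central_elem_specht[OF \<mu> sp] \<phi>(3)[OF C] by simp
  then have "x = central_const \<mu> \<odot>\<^bsub>tensor_power s n\<^esub> C"
    using \<phi>(1) x(1) U_closed(2)[OF C C] by (meson bij_betw_def inj_onD)
  then show ?thesis using x(3) tv(2)[OF C C] alg_op_central_elem[OF \<mu>, of "tvalue n C"] by metis
qed

text \<open>Evaluating group algebra elements at \<open>f\<close> is equivariant on the Specht
  module, and injective by \<open>specht_eval_inj\<close> as soon as the Young operator does not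
  kill \<open>f\<close>. Its image is then a copy of the Specht module that contains the class of
  \<open>x\<close>.\<close>

lemma young_orbit_in_W_comp:
  assumes \<mu>: "\<mu> \<in> partitions" and n: "n = psize \<mu>"
    and f: "letters_below n f" and d: "Poly_Mapping.keys d \<subseteq> perms n"
    and x: "x \<in> homogeneous n" "tcoord n x = alg_op d (row_op \<mu> (col_op \<mu> f))"
  shows "cls x \<in> W_comp s \<mu>"
proof -
  interpret P: param_space scale "tensor_power s n" cls "homogeneous n" "tkernel \<inter> homogeneous n"
    by (rule param_tensor_power)
  define t where "t = row_op \<mu> (col_op \<mu> f)"
  show ?thesis
  proof (cases "t = (\<lambda>u. 0)")
    \<comment> \<open>Now \<open>x\<close> is a zero tensor, which lies in every subspace.\<close>
    case True
    then have "tcoord n x = tcoord n 0" using x(2) group_op_zero[OF group_op_alg_op[OF d]] by (simp add: t_def)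
    then have "cls x = cls 0" using cls_eq_homogeneous[OF x(1) P.H_closed(1)] by blast
    moreover have "cls 0 \<in> U" if "subspace_of U (tensor_power s n)" for U
      using F.subspace_0[OF P.subspace_ofD(1)[OF that]] by simp
    ultimately show ?thesis
      unfolding W_comp_def isotypic_component_def lin_span_def n[symmetric] by auto
  next
    case False
    define U where "U = {cls x | x. x \<in> homogeneous n \<and> (\<exists>d. Poly_Mapping.keys d \<subseteq> perms n \<and> tcoord n x = alg_op d t)}"
    define L where "L = {x \<in> homogeneous n. \<exists>d. Poly_Mapping.keys d \<subseteq> perms n \<and> tcoord n x = alg_op d t}"
    have UL: "U = cls ` L" by (auto simp: U_def L_def)
    have "F.subspace L"
      unfolding subspace_scale_eq
    proof (intro conjI ballI allI)
      show "0 \<in> L" unfolding L_def using P.H_closed(1) by (auto intro!: exI[of _ 0])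
      fix x y assume "x \<in> L" "y \<in> L"
      then obtain d d' where *: "x \<in> homogeneous n" "y \<in> homogeneous n" "Poly_Mapping.keys d \<subseteq> perms n" "Poly_Mapping.keys d' \<subseteq> perms n"
        "tcoord n x = alg_op d t" "tcoord n y = alg_op d' t" by (auto simp: L_def)
      have "Poly_Mapping.keys (d + d') \<subseteq> perms n" by (rule keys_add_subset[OF *(3,4)])
      then show "x + y \<in> L" using * by (auto simp: L_def P.H_closed tcoord_add alg_op_add intro!: exI[of _ "d + d'"])
    next
      fix c x assume "x \<in> L"
      then obtain d where *: "x \<in> homogeneous n" "Poly_Mapping.keys d \<subseteq> perms n" "tcoord n x = alg_op d t" by (auto simp: L_def)
      have "Poly_Mapping.keys (scale c d) \<subseteq> perms n" using * by (auto simp: in_keys_iff subset_iff)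
      then show "scale c x \<in> L" using * by (auto simp: L_def P.H_closed tcoord_scale alg_op_scale intro!: exI[of _ "scale c d"])
    qed
    then have subU: "subspace_of U (tensor_power s n)" unfolding UL by (rule P.subspace_ofI) (auto simp: L_def)
    have invU: "place_action s n g Z \<in> U" if g: "g \<in> perms n" and Z: "Z \<in> U" for g Z
    proof -
      obtain x d where *: "Z = cls x" "x \<in> homogeneous n" "Poly_Mapping.keys d \<subseteq> perms n" "tcoord n x = alg_op d t"
        using Z by (auto simp: U_def)
      have "tcoord n (relabel (permute_list (pinv g)) x) = alg_op (gmul (Poly_Mapping.single g 1) d) t"
        using * g by (simp add: tcoord_permute alg_op_gmul alg_op_single)
      moreover have "Poly_Mapping.keys (gmul (Poly_Mapping.single g 1) d) \<subseteq> perms n"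
        by (rule keys_gmul) (use g * in auto)
      ultimately show ?thesis
        using * g relabel_permute_homogeneous[of x n] unfolding U_def by (auto simp: place_action_cls)
    qed
    define S where "S = carrier (specht \<mu> :: ('f, _) module)"
    \<comment> \<open>The evaluation map, with values in tensors. \<open>rep_isomorphic\<close> asks
      for a map that starts from the copy, so the inverse of this one is supplied later.\<close>
    define \<psi> where "\<psi> b = cls (SOME x. x \<in> homogeneous n \<and> tcoord n x = alg_op b f)" for b
    have \<psi>: "\<exists>x. x \<in> homogeneous n \<and> \<psi> b = cls x \<and> tcoord n x = alg_op b f" if b: "b \<in> S" for b
    proof -
      have "letters_below n (alg_op b f)"
        by (rule letters_below_group_op[OF group_op_alg_op f]) (use specht_keys[OF \<mu>, of b] b n in \<open>simp add: S_def\<close>)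
      then obtain x where "x \<in> homogeneous n \<and> tcoord n x = alg_op b f" using letters_below_surj by blast
      then show ?thesis unfolding \<psi>_def by (metis (mono_tags, lifting) someI)
    qed
    have \<psi>_eq: "\<psi> b = cls x" if "b \<in> S" "x \<in> homogeneous n" "tcoord n x = alg_op b f" for b x
      using \<psi>[OF that(1)] that cls_eq_homogeneous by metis
    have img: "\<psi> ` S = U"
    proof safe
      fix b assume b: "b \<in> S"
      obtain a where a: "Poly_Mapping.keys a \<subseteq> perms n" "\<And>f. alg_op b f = alg_op a (row_op \<mu> (col_op \<mu> f))"
        using specht_alg_op[OF \<mu>] b n unfolding S_def by metis
      then show "\<psi> b \<in> U" using \<psi>[OF b] by (auto simp: U_def t_def)
    next
      fix Z assume "Z \<in> U"
      then obtain x d where *: "Z = cls x" "x \<in> homogeneous n" "Poly_Mapping.keys d \<subseteq> perms n" "tcoord n x = alg_op d t"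
        by (auto simp: U_def)
      let ?b = "gmul d (young_symmetrizer \<mu>)"
      have "?b \<in> S" using * n by (auto simp: S_def specht_simps)
      moreover have "tcoord n x = alg_op ?b f" using * by (simp add: alg_op_gmul alg_op_young[OF \<mu>] t_def)
      ultimately show "Z \<in> \<psi> ` S" using \<psi>_eq[of ?b x] * by blast
    qed
    have Sadd: "b + b' \<in> S" "scale c b \<in> S" if "b \<in> S" "b' \<in> S" for b b' c
      using specht_add[OF \<mu>] specht_scale[OF \<mu>] that by (auto simp: S_def)
    have Sg: "gmul (Poly_Mapping.single g 1) b \<in> S" if "b \<in> S" "g \<in> perms n" for b g
      using specht_gmul[OF \<mu>, of b "Poly_Mapping.single g 1"] that n by (auto simp: S_def)
    have hom: "\<psi> (b + b') = \<psi> b \<oplus>\<^bsub>tensor_power s n\<^esub> \<psi> b'" "\<psi> (scale c b) = c \<odot>\<^bsub>tensor_power s n\<^esub> \<psi> b"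
      if b: "b \<in> S" "b' \<in> S" for b b' c
    proof -
      obtain x x' where x: "x \<in> homogeneous n" "\<psi> b = cls x" "tcoord n x = alg_op b f"
        "x' \<in> homogeneous n" "\<psi> b' = cls x'" "tcoord n x' = alg_op b' f" using \<psi> b by metis
      show "\<psi> (b + b') = \<psi> b \<oplus>\<^bsub>tensor_power s n\<^esub> \<psi> b'"
        using x by (simp add: P.add_eq \<psi>_eq[OF Sadd(1)[OF b], of "x + x'"] P.H_closed tcoord_add alg_op_add)
      show "\<psi> (scale c b) = c \<odot>\<^bsub>tensor_power s n\<^esub> \<psi> b"
        using x by (simp add: P.smult_eq \<psi>_eq[OF Sadd(2)[OF b], of "scale c x"] P.H_closed tcoord_scale alg_op_scale)
    qed
    have eqv: "\<psi> (gmul (Poly_Mapping.single g 1) b) = place_action s n g (\<psi> b)" if b: "b \<in> S" and g: "g \<in> perms n" for g b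
    proof -
      obtain x where x: "x \<in> homogeneous n" "\<psi> b = cls x" "tcoord n x = alg_op b f" using \<psi>[OF b] by blast
      show ?thesis
        unfolding x(2) place_action_cls[OF g x(1)]
        by (rule \<psi>_eq[OF Sg[OF b g] relabel_permute_homogeneous[OF x(1)]])
           (simp add: tcoord_permute[OF g x(1)] x(3) alg_op_gmul alg_op_single)
    qed
    have inj: "inj_on \<psi> S"
    proof (rule inj_onI)
      fix b b' assume b: "b \<in> S" "b' \<in> S" "\<psi> b = \<psi> b'"
      have e: "alg_op b f = alg_op b' f" using \<psi>[OF b(1)] \<psi>[OF b(2)] b(3) by (metis tvalue_cls)
      have sub: "b - b' = b + scale (-1) b'" by (rule poly_mapping_eqI) (simp add: lookup_minus lookup_add)
      have "b - b' \<in> S" unfolding sub by (rule Sadd(1)[OF b(1) Sadd(2)[OF b(2) b(2)]])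
      moreover have "alg_op (b - b') f = (\<lambda>u. 0)" unfolding sub alg_op_add alg_op_scale by (simp add: e)
      ultimately have "b - b' = 0" using specht_eval_inj[OF \<mu>, of "b - b'" f] False by (simp add: S_def t_def)
      then show "b = b'" by simp
    qed
    define \<phi> where "\<phi> = inv_into S \<psi>"
    have \<phi>\<psi>: "\<phi> (\<psi> b) = b" if "b \<in> S" for b using inj that by (simp add: \<phi>_def)
    have "rep_isomorphic (perms n) (tensor_power s n \<lparr> carrier := U \<rparr>) (place_action s n)
      (specht \<mu> :: ('f, _) module) (specht_action \<mu>)"
      unfolding rep_isomorphic_def
    proof (intro exI[of _ \<phi>] conjI ballI allI, goal_cases)
      case 1
      have "bij_betw \<psi> S U" using inj img by (simp add: bij_betw_def)
      then show ?case using bij_betw_inv_into by (simp add: \<phi>_def S_def)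
    next
      case (2 x y)
      then obtain b b' where "b \<in> S" "b' \<in> S" "x = \<psi> b" "y = \<psi> b'" using img by auto
      then show ?case by (simp add: specht_simps hom(1)[symmetric] \<phi>\<psi> Sadd)
    next
      case (3 c x)
      then obtain b where "b \<in> S" "x = \<psi> b" using img by auto
      then show ?case by (simp add: specht_simps hom(2)[symmetric] \<phi>\<psi> Sadd)
    next
      case (4 g x)
      then obtain b where "b \<in> S" "x = \<psi> b" using img by auto
      then show ?case using 4 by (simp add: specht_simps eqv[symmetric] \<phi>\<psi> Sg)
    qed
    then have "U \<subseteq> W_comp s \<mu>"
      using subU invU unfolding W_comp_def isotypic_component_def lin_span_def n[symmetric] carrier_symgrp by blast
    moreover have "cls x \<in> U" using x d by (auto simp: U_def t_def)
    ultimately show ?thesis by blast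
  qed
qed

text \<open>One inclusion is \<open>copy_subset_eigenspace\<close>. Conversely, an eigenvector is up
  to the nonzero eigenvalue the sum of the conjugates g Y g^-1 of the Young operator applied to it,
  and each summand lies in the component by \<open>young_orbit_in_W_comp\<close>.\<close>

theorem W_comp_eq:
  assumes \<mu>: "\<mu> \<in> partitions" and n: "n = psize \<mu>"
  shows "W_comp s \<mu> = cls ` {a \<in> homogeneous n. central_op \<mu> (tcoord n a) = (\<lambda>u. central_const \<mu> * tcoord n a u)}"
    (is "_ = cls ` ?E")
proof -
  interpret P: param_space scale "tensor_power s n" cls "homogeneous n" "tkernel \<inter> homogeneous n"
    by (rule param_tensor_power)
  note z = group_op_central_op[OF \<mu>, folded n]
  define \<U> where "\<U> = {U. subspace_of U (tensor_power s n) \<and> (\<forall>g\<in>perms n. \<forall>x\<in>U. place_action s n g x \<in> U) \<and>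
     rep_isomorphic (perms n) (tensor_power s n \<lparr> carrier := U \<rparr>) (place_action s n) (specht \<mu> :: ('f, _) module) (specht_action \<mu>)}"
  have W: "W_comp s \<mu> = lin_span (tensor_power s n) (\<Union>\<U>)"
    by (simp add: W_comp_def isotypic_component_def n[symmetric] carrier_symgrp \<U>_def)
  have subE: "F.subspace ?E"
    unfolding subspace_scale_eq
    by (auto simp: P.H_closed tcoord_add tcoord_scale group_op_zero[OF z] group_op_add[OF z] group_op_scale[OF z] algebra_simps)
  show ?thesis
  proof
    have "\<Union>\<U> \<subseteq> cls ` ?E"
    proof
      fix C assume "C \<in> \<Union>\<U>"
      then obtain U where U: "U \<in> \<U>" "C \<in> U" by blast
      then have e: "central_op \<mu> (tvalue n C) = (\<lambda>u. central_const \<mu> * tvalue n C u)"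
        using copy_subset_eigenspace[OF \<mu> n, of U C] by (auto simp: \<U>_def)
      have "U = cls ` {x \<in> homogeneous n. cls x \<in> U}" using U P.subspace_ofD(2)[of U] by (simp add: \<U>_def)
      then obtain a where "a \<in> homogeneous n" "C = cls a" using U(2) by blast
      then show "C \<in> cls ` ?E" using e by auto
    qed
    moreover have "subspace_of (cls ` ?E) (tensor_power s n)" by (rule P.subspace_ofI[OF subE]) auto
    ultimately show "W_comp s \<mu> \<subseteq> cls ` ?E" unfolding W lin_span_def by blast
    define Q where "Q = {x \<in> homogeneous n. cls x \<in> \<Union>\<U>}"
    have UQ: "\<Union>\<U> = cls ` Q"
    proof -
      have "\<exists>a\<in>homogeneous n. C = cls a" if "C \<in> U" "U \<in> \<U>" for C U
      proof -
        have "U = cls ` {x \<in> homogeneous n. cls x \<in> U}" using that P.subspace_ofD(2)[of U] by (simp add: \<U>_def)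
        then show ?thesis using that(1) by blast
      qed
      then show ?thesis unfolding Q_def by blast
    qed
    have WQ: "W_comp s \<mu> = cls ` F.span Q" unfolding W UQ by (rule P.lin_span_eq) (auto simp: Q_def)
    have QH: "F.span Q \<subseteq> homogeneous n" by (rule F.span_minimal[OF _ subspace_homogeneous]) (auto simp: Q_def)
    show "cls ` ?E \<subseteq> W_comp s \<mu>"
    proof safe
      fix a assume a: "a \<in> homogeneous n" "central_op \<mu> (tcoord n a) = (\<lambda>u. central_const \<mu> * tcoord n a u)"
      let ?f = "\<lambda>g. act (pinv g) (tcoord n a)"
      let ?c = "inverse (central_const \<mu>) :: 'f"
      have lb: "letters_below n (?f g)" if "g \<in> perms n" for g
        by (rule letters_below_group_op[OF group_op_act[OF perms_inv[OF that]] letters_below_tcoord])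
      have "\<exists>x. x \<in> F.span Q \<and> tcoord n x = act g (row_op \<mu> (col_op \<mu> (?f g)))" if g: "g \<in> perms n" for g
      proof -
        have "letters_below n (act g (row_op \<mu> (col_op \<mu> (?f g))))"
          by (rule letters_below_group_op[OF group_op_act[OF g] letters_below_group_op[OF group_op_young[OF \<mu>, folded n] lb[OF g]]])
        then obtain x where x: "x \<in> homogeneous n" "tcoord n x = act g (row_op \<mu> (col_op \<mu> (?f g)))"
          using letters_below_surj by blast
        have "cls x \<in> W_comp s \<mu>"
          by (rule young_orbit_in_W_comp[OF \<mu> n lb[OF g], of "Poly_Mapping.single g 1"]) (use g x in \<open>auto simp: alg_op_single\<close>)
        then obtain x' where x': "x' \<in> F.span Q" "cls x = cls x'" unfolding WQ by blast
        then have "tcoord n x' = tcoord n x" using cls_eq_iff by metis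
        then show ?thesis using x x' by auto
      qed
      then obtain x where x: "\<And>g. g \<in> perms n \<Longrightarrow> x g \<in> F.span Q"
        "\<And>g. g \<in> perms n \<Longrightarrow> tcoord n (x g) = act g (row_op \<mu> (col_op \<mu> (?f g)))" by metis
      define w where "w = scale ?c (\<Sum>g\<in>perms n. x g)"
      have w: "w \<in> F.span Q" unfolding w_def by (intro F.span_scale F.span_sum x)
      have "tcoord n w = (\<lambda>u. ?c * central_op \<mu> (tcoord n a) u)"
        unfolding w_def tcoord_scale tcoord_sum central_op_eq_sum_young[OF \<mu>] n[symmetric] using x(2) by simp
      also have "\<dots> = tcoord n a" using a(2) central_const_nonzero[OF \<mu>, where 'f = 'f] by (simp add: mult.assoc[symmetric])
      finally have "cls w = cls a" using cls_eq_homogeneous[of w n a] w QH a(1) by blast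
      then show "cls a \<in> W_comp s \<mu>" using w unfolding WQ by (metis imageI)
    qed
  qed
qed

end

section \<open>The ideal of a filter of partitions\<close>

context tensor_coords
begin

text \<open>The vanishing of the components outside \<Omega> is a family of linear conditions, one
  degree at a time, and holds for all tensor relations. \<open>I_ideal_eq\<close> identifies the
  classes of these elements with the ideal.\<close>

definition filter_ideal :: "(nat \<Rightarrow> nat) set \<Rightarrow> ('v list \<Rightarrow>\<^sub>0 'f) set" where
  "filter_ideal \<Omega> = {a. \<forall>n. \<forall>\<mu>\<in>partitions_of n. \<mu> \<notin> \<Omega> \<longrightarrow> central_op \<mu> (tcoord n a) = (\<lambda>u. 0)}"

lemma subspace_filter_ideal: "F.subspace (filter_ideal \<Omega>)"
  unfolding subspace_scale_eq
proof (intro conjI ballI allI)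
  show "0 \<in> filter_ideal \<Omega>" using group_op_zero[OF group_op_central] by (auto simp: filter_ideal_def)
  show "x + y \<in> filter_ideal \<Omega>" if "x \<in> filter_ideal \<Omega>" "y \<in> filter_ideal \<Omega>" for x y
    unfolding filter_ideal_def
  proof safe
    fix n \<mu> assume \<mu>: "\<mu> \<in> partitions_of n" "\<mu> \<notin> \<Omega>"
    then have "central_op \<mu> (tcoord n x) = (\<lambda>u. 0)" "central_op \<mu> (tcoord n y) = (\<lambda>u. 0)"
      using that by (auto simp: filter_ideal_def)
    then show "central_op \<mu> (tcoord n (x + y)) = (\<lambda>u. 0)"
      by (simp add: tcoord_add group_op_add[OF group_op_central[OF \<mu>(1)]])
  qed
  show "scale c x \<in> filter_ideal \<Omega>" if "x \<in> filter_ideal \<Omega>" for c x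
    unfolding filter_ideal_def
  proof safe
    fix n \<mu> assume \<mu>: "\<mu> \<in> partitions_of n" "\<mu> \<notin> \<Omega>"
    then have "central_op \<mu> (tcoord n x) = (\<lambda>u. 0)" using that by (auto simp: filter_ideal_def)
    then show "central_op \<mu> (tcoord n (scale c x)) = (\<lambda>u. 0)"
      by (simp add: tcoord_scale group_op_scale[OF group_op_central[OF \<mu>(1)]])
  qed
qed

lemma tkernel_filter_ideal: "tkernel \<subseteq> filter_ideal \<Omega>"
  using group_op_zero[OF group_op_central] by (auto simp: filter_ideal_def tkernel_def)

lemma filter_ideal_expand:
  assumes a: "a \<in> filter_ideal \<Omega>"
  shows "tcoord n a = (\<lambda>u. \<Sum>\<mu>\<in>partitions_of n \<inter> \<Omega>. inverse (central_const \<mu>) * central_op \<mu> (tcoord n a) u)"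
proof
  fix u
  have "tcoord n a u = (\<Sum>\<mu>\<in>partitions_of n. inverse (central_const \<mu>) * central_op \<mu> (tcoord n a) u)"
    by (rule fun_cong[OF central_op_complete[OF local_tcoord]])
  also have "\<dots> = (\<Sum>\<mu>\<in>partitions_of n \<inter> \<Omega>. inverse (central_const \<mu>) * central_op \<mu> (tcoord n a) u)"
    by (rule sum.mono_neutral_right) (use a in \<open>auto simp: filter_ideal_def\<close>)
  finally show "tcoord n a u = (\<Sum>\<mu>\<in>partitions_of n \<inter> \<Omega>. inverse (central_const \<mu>) * central_op \<mu> (tcoord n a) u)" .
qed

lemma central_op_W_comp:
  assumes "\<mu> \<in> partitions" "\<nu> \<in> partitions_of n" "\<nu> \<noteq> \<mu>"
    and a: "a \<in> homogeneous (psize \<mu>)" "central_op \<mu> (tcoord (psize \<mu>) a) = (\<lambda>u. central_const \<mu> * tcoord (psize \<mu>) a u)"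
  shows "central_op \<nu> (tcoord n a) = (\<lambda>u. 0)"
proof (cases "n = psize \<mu>")
  case False
  then show ?thesis using tcoord_homogeneous[OF a(1)] group_op_zero[OF group_op_central[OF assms(2)]] by simp
next
  case True
  have \<nu>: "\<nu> \<in> partitions" "psize \<nu> = n" using assms(2) by (auto simp: partitions_of_def)
  have "central_op \<nu> (central_op \<mu> (tcoord n a)) = (\<lambda>u. 0)"
    by (rule central_op_orthogonal) (use assms \<nu> True in auto)
  then have "central_const \<mu> * central_op \<nu> (tcoord n a) u = 0" for u
    using a(2) group_op_scale[OF group_op_central[OF assms(2)]] True by metis
  then show ?thesis using central_const_nonzero[OF assms(1), where 'f = 'f] by auto
qed

text \<open>The generators satisfy the conditions by orthogonality. Conversely, completeness
  rebuilds an element from its components, of which only those in \<Omega> are left.\<close>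

theorem I_ideal_eq:
  assumes \<Omega>: "\<Omega> \<subseteq> partitions"
  shows "I_ideal s \<Omega> = cls ` filter_ideal \<Omega>"
proof -
  define Q where "Q = {a. \<exists>\<mu>\<in>\<Omega>. a \<in> homogeneous (psize \<mu>) \<and>
    central_op \<mu> (tcoord (psize \<mu>) a) = (\<lambda>u. central_const \<mu> * tcoord (psize \<mu>) a u)}"
  have "(\<Union>\<mu>\<in>\<Omega>. W_comp s \<mu>) = cls ` Q"
  proof -
    have "(\<Union>\<mu>\<in>\<Omega>. W_comp s \<mu>) = (\<Union>\<mu>\<in>\<Omega>. cls ` {a \<in> homogeneous (psize \<mu>). central_op \<mu> (tcoord (psize \<mu>) a) = (\<lambda>u. central_const \<mu> * tcoord (psize \<mu>) a u)})"
      using W_comp_eq[OF _ refl] \<Omega> by (intro SUP_cong refl) auto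
    then show ?thesis by (auto simp: Q_def)
  qed
  then have I: "I_ideal s \<Omega> = cls ` F.span Q" unfolding I_ideal_def by (simp add: T.lin_span_eq)
  have QJ: "F.span Q \<subseteq> filter_ideal \<Omega>"
  proof (rule F.span_minimal[OF _ subspace_filter_ideal], rule subsetI)
    fix a assume "a \<in> Q"
    then show "a \<in> filter_ideal \<Omega>" using central_op_W_comp \<Omega> unfolding Q_def filter_ideal_def by blast
  qed
  have "\<exists>q\<in>F.span Q. cls q = cls a" if a: "a \<in> filter_ideal \<Omega>" for a
  proof -
    have ex: "\<exists>x. x \<in> homogeneous n \<and> tcoord n x = central_op \<mu> (tcoord n a)" if "\<mu> \<in> partitions_of n" for n \<mu>
      using letters_below_surj[OF letters_below_group_op[OF group_op_central[OF that] letters_below_tcoord]] by metis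
    define x where "x n \<mu> = (SOME x. x \<in> homogeneous n \<and> tcoord n x = central_op \<mu> (tcoord n a))" for n \<mu>
    have x: "x n \<mu> \<in> homogeneous n" "tcoord n (x n \<mu>) = central_op \<mu> (tcoord n a)" if "\<mu> \<in> partitions_of n" for n \<mu>
      using someI_ex[OF ex[OF that]] by (auto simp: x_def)
    have xQ: "x n \<mu> \<in> Q" if "\<mu> \<in> partitions_of n \<inter> \<Omega>" for n \<mu>
      using that x[of \<mu> n] central_op_central_op[of \<mu> "tcoord n a"] by (auto simp: Q_def partitions_of_def)
    \<comment> \<open>Coordinates can be nonzero only in these degrees, which keeps the following
      sum finite.\<close>
    define D where "D = length ` Poly_Mapping.keys a"
    define q where "q = (\<Sum>n\<in>D. \<Sum>\<mu>\<in>partitions_of n \<inter> \<Omega>. scale (inverse (central_const \<mu>)) (x n \<mu>))"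
    have "q \<in> F.span Q" unfolding q_def by (intro F.span_sum F.span_scale F.span_base xQ)
    moreover have "tcoord m q = tcoord m a" for m
    proof -
      have "tcoord m (x n \<mu>) = (if n = m then central_op \<mu> (tcoord m a) else (\<lambda>u. 0))" if "\<mu> \<in> partitions_of n" for n \<mu>
        using x[OF that] tcoord_homogeneous[OF x(1)[OF that]] by auto
      then have "tcoord m q = (\<lambda>u. \<Sum>n\<in>D. \<Sum>\<mu>\<in>partitions_of n \<inter> \<Omega>.
          inverse (central_const \<mu>) * (if n = m then central_op \<mu> (tcoord m a) else (\<lambda>u. 0)) u)"
        unfolding q_def tcoord_sum tcoord_scale by (intro ext sum.cong refl) auto
      also have "\<dots> = (\<lambda>u. \<Sum>n\<in>D. if n = m then tcoord m a u else 0)"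
        by (intro ext sum.cong refl) (simp add: fun_cong[OF filter_ideal_expand[OF a, of m], symmetric])
      also have "\<dots> = tcoord m a"
      proof (cases "m \<in> D")
        case False
        then have "tcoord m a = (\<lambda>u. 0)"
          unfolding D_def tcoord_def lin_ext_def word_coord_def by (intro ext sum.neutral ballI) auto
        then show ?thesis by (simp cong: if_cong)
      qed (simp add: D_def)
      finally show ?thesis .
    qed
    ultimately show ?thesis using cls_eq_iff by blast
  qed
  then show ?thesis using QJ unfolding I by (auto simp: image_iff) (metis subsetD)+
qed

text \<open>The operator of \<nu> permutes the first \<open>n\<close> places only and passes by the
  appended letter, so the product is a sum of images of operators with \<nu> in \<Omega>. For \<mu>
  outside \<Omega> the operator of \<mu> kills them by branching, since \<nu> \<le> \<mu> would put
  \<mu> into the filter.\<close>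

lemma filter_ideal_append:
  assumes \<Omega>: "partition_filter \<Omega>" and a: "a \<in> filter_ideal \<Omega>"
  shows "fmul a (Poly_Mapping.single [x] 1) \<in> filter_ideal \<Omega>"
  unfolding filter_ideal_def
proof (safe)
  fix m \<mu> assume \<mu>: "\<mu> \<in> partitions_of m" "\<mu> \<notin> \<Omega>"
  show "central_op \<mu> (tcoord m (fmul a (Poly_Mapping.single [x] 1))) = (\<lambda>u. 0)"
  proof (cases m)
    case 0
    have "tcoord 0 (fmul a (Poly_Mapping.single [x] 1)) = (\<lambda>u. 0)" by (rule ext) (rule tcoord_append_0)
    then show ?thesis using 0 group_op_zero[OF group_op_central[OF \<mu>(1)]] by simp
  next
    case (Suc n)
    define h where "h = tcoord m (fmul a (Poly_Mapping.single [x] 1))"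
    have h: "h u = tcoord n a u * coord x (u n)" for u unfolding h_def Suc by (rule tcoord_append)
    have loc: "local_fn (Suc n) h" using local_tcoord[of m] by (simp add: h_def Suc)
    have "central_op \<nu> h u = central_op \<nu> (tcoord n a) u * coord x (u n)" if \<nu>: "\<nu> \<in> partitions_of n" for \<nu> u
    proof -
      obtain c where c: "\<And>f u. central_op \<nu> f u = (\<Sum>\<sigma>\<in>perms n. c \<sigma> * (f :: _ \<Rightarrow> 'f) (u \<circ> \<sigma>))"
        using group_op_central[OF \<nu>] unfolding group_op_def by blast
      have "\<sigma> n = n" if "\<sigma> \<in> perms n" for \<sigma> using that by (auto simp: perms_def permutes_def)
      then have "coord x ((u \<circ> \<sigma>) n) = coord x (u n)" if "\<sigma> \<in> perms n" for \<sigma>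
        using that by (metis comp_apply)
      then show ?thesis unfolding c h sum_distrib_right by (intro sum.cong) (simp_all add: mult.assoc)
    qed
    then have "h = (\<lambda>u. \<Sum>\<nu>\<in>partitions_of n \<inter> \<Omega>. inverse (central_const \<nu>) * central_op \<nu> h u)"
      by (intro ext, subst h, subst filter_ideal_expand[OF a]) (simp add: sum_distrib_right mult.assoc)
    then have "central_op \<mu> h = central_op \<mu> (\<lambda>u. \<Sum>\<nu>\<in>partitions_of n \<inter> \<Omega>. inverse (central_const \<nu>) * central_op \<nu> h u)"
      by (rule arg_cong)
    also have "\<dots> = (\<lambda>u. \<Sum>\<nu>\<in>partitions_of n \<inter> \<Omega>. inverse (central_const \<nu>) * central_op \<mu> (central_op \<nu> h) u)"
      by (rule group_op_linear[OF group_op_central[OF \<mu>(1)]])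
    also have "\<dots> = (\<lambda>u. 0)"
    proof (intro ext sum.neutral ballI)
      fix u \<nu> assume \<nu>: "\<nu> \<in> partitions_of n \<inter> \<Omega>"
      have "\<not> \<nu> \<le> \<mu>" using \<nu> \<mu> \<Omega> unfolding partition_filter_def partitions_of_def by blast
      then have "central_op \<mu> (central_op \<nu> h) = (\<lambda>u. 0)"
        by (intro central_op_branching[of _ n, OF _ _ _ loc]) (use \<nu> \<mu> Suc in auto)
      then show "inverse (central_const \<nu>) * central_op \<mu> (central_op \<nu> h) u = 0" by simp
    qed
    finally show ?thesis by (simp add: h_def)
  qed
qed

definition rotation :: "nat \<Rightarrow> nat \<Rightarrow> nat" where
  "rotation n x = (if x < n then Suc x else if x = n then 0 else x)"

lemma rotation_perms: "rotation n \<in> perms (Suc n)"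
proof -
  have "inj_on (rotation n) {..<Suc n}" by (rule inj_onI) (auto simp: rotation_def split: if_splits)
  moreover have "rotation n ` {..<Suc n} \<subseteq> {..<Suc n}" by (auto simp: rotation_def)
  ultimately have "bij_betw (rotation n) {..<Suc n} {..<Suc n}" by (simp add: bij_betw_def endo_inj_surj)
  then have "rotation n permutes {..<Suc n}" by (rule bij_imp_permutes) (simp add: rotation_def)
  then show ?thesis by (simp add: perms_def)
qed

text \<open>Left and right multiplication by a letter differ by a cyclic place permutation, with
  which the central operators commute.\<close>

lemma filter_ideal_prepend:
  assumes \<Omega>: "partition_filter \<Omega>" and a: "a \<in> filter_ideal \<Omega>"
  shows "fmul (Poly_Mapping.single [x] 1) a \<in> filter_ideal \<Omega>"
  unfolding filter_ideal_def
proof (safe)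
  fix m \<mu> assume \<mu>: "\<mu> \<in> partitions_of m" "\<mu> \<notin> \<Omega>"
  show "central_op \<mu> (tcoord m (fmul (Poly_Mapping.single [x] 1) a)) = (\<lambda>u. 0)"
  proof (cases m)
    case 0
    have "tcoord 0 (fmul (Poly_Mapping.single [x] 1) a) = (\<lambda>u. 0)" by (rule ext) (rule tcoord_prepend_0)
    then show ?thesis using 0 group_op_zero[OF group_op_central[OF \<mu>(1)]] by simp
  next
    case (Suc n)
    define h where "h = tcoord m (fmul a (Poly_Mapping.single [x] 1))"
    have z: "central_op \<mu> h = (\<lambda>u. 0)" using filter_ideal_append[OF \<Omega> a, of x] \<mu> by (auto simp: filter_ideal_def h_def)
    have "tcoord m (fmul (Poly_Mapping.single [x] 1) a) = act (rotation n) h"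
    proof
      fix u
      have "tcoord n a (u \<circ> rotation n) = tcoord n a (u \<circ> Suc)"
        by (rule local_fnD[OF local_tcoord]) (simp add: rotation_def)
      then show "tcoord m (fmul (Poly_Mapping.single [x] 1) a) u = act (rotation n) h u"
        by (simp add: Suc h_def tcoord_prepend tcoord_append act_def rotation_def mult.commute)
    qed
    moreover have "central_op \<mu> (act (rotation n) h) = act (rotation n) (central_op \<mu> h)"
      using central_op_act[of \<mu> "rotation n" h] rotation_perms[of n] \<mu> Suc by (simp add: partitions_of_def)
    ultimately show ?thesis by (simp add: z act_def)
  qed
qed

lemma filter_ideal_two_sided:
  assumes "partition_filter \<Omega>" "a \<in> filter_ideal \<Omega>"
  shows "fmul a c \<in> filter_ideal \<Omega> \<and> fmul c a \<in> filter_ideal \<Omega>"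
  by (rule two_sided_closed[OF subspace_filter_ideal filter_ideal_prepend filter_ideal_append])
     (use assms in auto)

lemma param_A_alg:
  assumes "partition_filter \<Omega>"
  shows "param_ring scale (A_alg s \<Omega>) (\<lambda>a. I_ideal s \<Omega> +>\<^bsub>tensor_algebra s\<^esub> cls a) (filter_ideal \<Omega>) fmul (Poly_Mapping.single [] 1)"
  using T.param_ring_quotient[OF subspace_filter_ideal tkernel_filter_ideal filter_ideal_two_sided[OF assms]]
    I_ideal_eq[of \<Omega>] assms by (simp add: A_alg_def partition_filter_def)

lemma param_A_comp:
  assumes "partition_filter \<Omega>"
  shows "param_space scale (A_comp s \<Omega> n) (\<lambda>a. cls ` (filter_ideal \<Omega> \<inter> homogeneous n) +>\<^bsub>tensor_power s n\<^esub> cls a)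
    (homogeneous n) (filter_ideal \<Omega> \<inter> homogeneous n)"
proof -
  interpret P: param_space scale "tensor_power s n" cls "homogeneous n" "tkernel \<inter> homogeneous n"
    by (rule param_tensor_power)
  have "I_ideal s \<Omega> \<inter> carrier (tensor_power s n) = cls ` (filter_ideal \<Omega> \<inter> homogeneous n)"
  proof safe
    fix C assume C: "C \<in> I_ideal s \<Omega>" "C \<in> carrier (tensor_power s n)"
    obtain a where a: "a \<in> filter_ideal \<Omega>" "C = cls a" using C I_ideal_eq[of \<Omega>] assms by (auto simp: partition_filter_def)
    obtain d where d: "d \<in> homogeneous n" "C = cls d" using C P.carrier_eq by auto
    have "d - a \<in> filter_ideal \<Omega>" using a d T.pi_eq_iff[of d a] tkernel_filter_ideal by auto
    then have "d \<in> filter_ideal \<Omega>" using F.subspace_add[OF subspace_filter_ideal _ a(1), of "d - a"] by simp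
    then show "C \<in> cls ` (filter_ideal \<Omega> \<inter> homogeneous n)" using d by auto
  next
    fix a assume "a \<in> filter_ideal \<Omega>" "a \<in> homogeneous n"
    then show "cls a \<in> I_ideal s \<Omega>" "cls a \<in> carrier (tensor_power s n)"
      using I_ideal_eq[of \<Omega>] assms P.carrier_eq by (auto simp: partition_filter_def)
  qed
  moreover have "tkernel \<inter> homogeneous n \<subseteq> filter_ideal \<Omega> \<inter> homogeneous n" using tkernel_filter_ideal by auto
  ultimately show ?thesis
    using P.param_quotient[OF F.subspace_inter[OF subspace_filter_ideal subspace_homogeneous]]
    by (simp add: A_comp_def)
qed

section \<open>Products of commutators\<close>

definition com :: "('v list \<Rightarrow>\<^sub>0 'f) \<Rightarrow> ('v list \<Rightarrow>\<^sub>0 'f) \<Rightarrow> 'v list \<Rightarrow>\<^sub>0 'f" where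
  "com a c = fmul a c - fmul c a"

abbreviation letter :: "'v \<Rightarrow> 'v list \<Rightarrow>\<^sub>0 'f" where
  "letter x \<equiv> Poly_Mapping.single [x] 1"

text \<open>Commutators of letters with arbitrary words before, between and behind them. The Leibniz
  rule in \<open>com_words_com\<close> reduces all other commutators to these.\<close>

inductive com_word :: "nat \<Rightarrow> ('v list \<Rightarrow>\<^sub>0 'f) \<Rightarrow> bool" where
  com_words_0: "com_word 0 (Poly_Mapping.single w 1)"
| com_words_prepend: "com_word m g \<Longrightarrow> com_word m (fmul (letter x) g)"
| com_words_Suc: "com_word m g \<Longrightarrow> com_word (Suc m) (fmul (com (letter x) (letter y)) g)"

abbreviation com_words :: "nat \<Rightarrow> ('v list \<Rightarrow>\<^sub>0 'f) set" where
  "com_words m \<equiv> Collect (com_word m)"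

lemma com_words_left_mult: "g \<in> F.span (com_words m) \<Longrightarrow> fmul a g \<in> F.span (com_words m)"
proof (induction a rule: poly_mapping_add_induct)
  case (single w c)
  have l: "fmul (letter x) g \<in> F.span (com_words m)" if "g \<in> F.span (com_words m)" for x g
    using that
  proof (induction rule: F.span_induct_alt)
    case (step c h y)
    then have "fmul (letter x) h \<in> F.span (com_words m)" by (intro F.span_base CollectI com_words_prepend) simp
    then show ?case using step by (simp add: fmul_add_right fmul_scale F.span_add F.span_scale)
  qed (simp add: F.span_zero)
  show ?case
  proof (induction w)
    case Nil
    have "fmul (Poly_Mapping.single [] c) g = scale c g"
      using fmul_scale(1)[of c "Poly_Mapping.single [] 1" g] by (simp add: fmul_one)
    then show ?case using F.span_scale[OF single] by simp
  next
    case (Cons x w)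
    then show ?case unfolding single_Cons[of x w c] fmul_assoc by (rule l)
  qed
qed (simp_all add: F.span_zero fmul_add_left F.span_add)

lemma com_add: "com (a + d) c = com a c + com d c" "com c (a + d) = com c a + com c d"
  by (simp_all add: com_def fmul_add_left fmul_add_right)

lemma com_mul: "com (fmul a d) c = fmul a (com d c) + fmul (com a c) d"
  "com c (fmul a d) = fmul a (com c d) + fmul (com c a) d"
  by (simp_all add: com_def F.mul_diff fmul_assoc)

lemma com_zero: "com 0 a = 0" "com a 0 = 0"
  by (simp_all add: com_def)

lemma com_one: "com (Poly_Mapping.single [] c) a = 0" "com a (Poly_Mapping.single [] c) = 0"
proof -
  have "fmul (Poly_Mapping.single [] c) a = fmul a (Poly_Mapping.single [] c)"
    by (induction a rule: poly_mapping_add_induct) (simp_all add: fmul_add_left fmul_add_right mult.commute)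
  then show "com (Poly_Mapping.single [] c) a = 0" "com a (Poly_Mapping.single [] c) = 0" by (simp_all add: com_def)
qed

text \<open>The Leibniz rule splits a commutator of words into commutators of letters with factors
  on both sides. Left factors are absorbed by \<open>com_words_left_mult\<close>, right factors by
  multiplying them into \<open>g\<close>, which is why \<open>g\<close> varies in the
  inductions.\<close>

lemma com_words_com:
  assumes "g \<in> F.span (com_words m)"
  shows "fmul (com a c) g \<in> F.span (com_words (Suc m))"
proof -
  have letters: "fmul (com (letter x) (letter y)) g \<in> F.span (com_words (Suc m))" if "g \<in> F.span (com_words m)" for x y g
    using that
  proof (induction rule: F.span_induct_alt)
    case (step c h b)
    then have "fmul (com (letter x) (letter y)) h \<in> F.span (com_words (Suc m))"
      by (intro F.span_base CollectI com_words_Suc) simp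
    then show ?case using step by (simp add: fmul_add_right fmul_scale F.span_add F.span_scale)
  qed (simp add: F.span_zero)
  have letter_word: "fmul (com (letter x) c) g \<in> F.span (com_words (Suc m))" if "g \<in> F.span (com_words m)" for x c g
    using that
  proof (induction c arbitrary: g rule: poly_mapping_add_induct)
    case (single w d)
    then show ?case
    proof (induction w arbitrary: g)
      case (Cons y w)
      show ?case
        unfolding single_Cons[of y w d] com_mul fmul_add_left fmul_assoc
        by (intro F.span_add com_words_left_mult letters Cons)
    qed (simp add: com_one F.span_zero)
  qed (simp_all add: com_add com_zero F.span_zero fmul_add_left F.span_add)
  show ?thesis using assms
  proof (induction a arbitrary: g rule: poly_mapping_add_induct)
    case (single w d)
    then show ?case
    proof (induction w arbitrary: g)
      case (Cons y w)
      show ?case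
        unfolding single_Cons[of y w d] com_mul fmul_add_left fmul_assoc
        by (intro F.span_add com_words_left_mult letter_word Cons)
    qed (simp add: com_one F.span_zero)
  qed (simp_all add: com_add com_zero F.span_zero fmul_add_left F.span_add)
qed

lemma skew_pairs_shift:
  assumes "skew_pairs m n f" shows "skew_pairs m (Suc n) (\<lambda>u. c (u 0) * f (u \<circ> Suc))"
proof -
  obtain a b where ab: "\<forall>i<m. a i < n \<and> b i < n \<and> act (transpose (a i) (b i)) f = (\<lambda>u. - f u)"
    "\<forall>i<m. \<forall>j<m. a i \<noteq> b j \<and> (i \<noteq> j \<longrightarrow> a i \<noteq> a j \<and> b i \<noteq> b j)"
    using assms unfolding skew_pairs_def by blast
  have t: "transpose (Suc p) (Suc q) \<circ> Suc = Suc \<circ> transpose p q" for p q :: nat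
    by (auto simp: fun_eq_iff transpose_def)
  have "act (transpose (Suc p) (Suc q)) (\<lambda>u. c (u 0) * f (u \<circ> Suc)) = (\<lambda>u. c (u 0) * act (transpose p q) f (u \<circ> Suc))" for p q
    by (auto simp: act_def comp_assoc t fun_eq_iff transpose_def)
  then show ?thesis using ab unfolding skew_pairs_def
    by (intro exI[of _ "\<lambda>i. Suc (a i)"] exI[of _ "\<lambda>i. Suc (b i)"]) auto
qed

lemma skew_pairs_two:
  assumes "skew_pairs m n f" and d: "\<And>x y. d x y = - d y x"
  shows "skew_pairs (Suc m) (Suc (Suc n)) (\<lambda>u. d (u 0) (u (Suc 0)) * f (u \<circ> Suc \<circ> Suc) :: 'f)"
proof -
  obtain a b where ab: "\<forall>i<m. a i < n \<and> b i < n \<and> act (transpose (a i) (b i)) f = (\<lambda>u. - f u)"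
    "\<forall>i<m. \<forall>j<m. a i \<noteq> b j \<and> (i \<noteq> j \<longrightarrow> a i \<noteq> a j \<and> b i \<noteq> b j)"
    using assms unfolding skew_pairs_def by blast
  let ?h = "\<lambda>u. d (u 0) (u (Suc 0)) * f (u \<circ> Suc \<circ> Suc)"
  have t: "transpose (Suc p) (Suc q) \<circ> Suc = Suc \<circ> transpose p q" for p q :: nat
    by (auto simp: fun_eq_iff transpose_def)
  have "act (transpose (Suc (Suc p)) (Suc (Suc q))) ?h = (\<lambda>u. d (u 0) (u (Suc 0)) * act (transpose p q) f (u \<circ> Suc \<circ> Suc))" for p q
  proof
    fix u :: "nat \<Rightarrow> nat"
    have "u \<circ> transpose (Suc (Suc p)) (Suc (Suc q)) \<circ> Suc \<circ> Suc = u \<circ> Suc \<circ> Suc \<circ> transpose p q"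
      by (metis comp_assoc t)
    then show "act (transpose (Suc (Suc p)) (Suc (Suc q))) ?h u = d (u 0) (u (Suc 0)) * act (transpose p q) f (u \<circ> Suc \<circ> Suc)"
      by (simp add: act_def)
  qed
  moreover have "act (transpose 0 (Suc 0)) ?h = (\<lambda>u. - ?h u)"
  proof
    fix u :: "nat \<Rightarrow> nat"
    have "u \<circ> transpose 0 (Suc 0) \<circ> Suc \<circ> Suc = u \<circ> Suc \<circ> Suc" by (auto simp: fun_eq_iff transpose_def)
    then show "act (transpose 0 (Suc 0)) ?h u = - ?h u" using d[of "u (Suc 0)" "u 0"] by (simp add: act_def)
  qed
  ultimately show ?thesis using ab unfolding skew_pairs_def
    by (intro exI[of _ "\<lambda>i. case i of 0 \<Rightarrow> 0 | Suc i \<Rightarrow> Suc (Suc (a i))"]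
        exI[of _ "\<lambda>i. case i of 0 \<Rightarrow> Suc 0 | Suc i \<Rightarrow> Suc (Suc (b i))"])
      (auto split: nat.splits)
qed

text \<open>The zero function is listed separately because a small degree has no room for
  \<open>m\<close> disjoint pairs.\<close>

lemma com_words_skew:
  assumes "com_word m g" shows "tcoord n g = (\<lambda>u. 0) \<or> skew_pairs m n (tcoord n g)"
  using assms
proof (induction arbitrary: n rule: com_word.induct)
  case (com_words_0 w)
  show ?case by (simp add: skew_pairs_def)
next
  case (com_words_prepend m g x)
  show ?case
  proof (cases n)
    case 0
    then show ?thesis by (auto simp: tcoord_prepend_0)
  next
    case (Suc n')
    have e: "tcoord n (fmul (letter x) g) = (\<lambda>u. coord x (u 0) * tcoord n' g (u \<circ> Suc))"
      by (rule ext) (simp add: Suc tcoord_prepend)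
    then show ?thesis using com_words_prepend.IH[of n'] skew_pairs_shift[of m n' "tcoord n' g" "coord x"] Suc by auto
  qed
next
  case (com_words_Suc m g x y)
  have c: "fmul (com (letter x) (letter y)) g = fmul (letter x) (fmul (letter y) g) - fmul (letter y) (fmul (letter x) g)"
    by (simp only: com_def F.mul_diff fmul_assoc)
  show ?case
  proof (cases "n < 2")
    case True
    have "tcoord n (fmul (letter x) (fmul (letter y) g)) u = 0" for x y u
      using True by (cases n) (simp_all add: tcoord_prepend tcoord_prepend_0)
    then show ?thesis unfolding c tcoord_diff by simp
  next
    case False
    define n' where "n' = n - 2"
    have n: "n = Suc (Suc n')" using False by (simp add: n'_def)
    let ?d = "\<lambda>p q. coord x p * coord y q - coord y p * coord x q"
    have e: "tcoord n (fmul (com (letter x) (letter y)) g) = (\<lambda>u. ?d (u 0) (u (Suc 0)) * tcoord n' g (u \<circ> Suc \<circ> Suc))"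
      unfolding c tcoord_diff by (rule ext) (simp add: n tcoord_prepend algebra_simps)
    show ?thesis
    proof (cases "tcoord n' g = (\<lambda>u. 0)")
      case False
      then have "skew_pairs m n' (tcoord n' g)" using com_words_Suc.IH by blast
      then have "skew_pairs (Suc m) (Suc (Suc n')) (\<lambda>u. ?d (u 0) (u (Suc 0)) * tcoord n' g (u \<circ> Suc \<circ> Suc))"
        by (rule skew_pairs_two) simp
      then show ?thesis unfolding e using n by simp
    qed (simp add: e)
  qed
qed

text \<open>The column in \<Omega> leaves at most \<open>k\<close> rows, and the rectangle keeps the
  second row shorter than \<open>c\<close>. So at most c (k - 1) cells lie below the first row,
  which is the origin of the number of commutators.\<close>

lemma partition_outside_filter:
  assumes \<Omega>: "partition_filter \<Omega>" and col: "rect 1 (k + 1) \<in> \<Omega>" and c: "rect c 2 \<in> \<Omega>" "c > 0"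
    and \<mu>: "\<mu> \<in> partitions_of n" "\<mu> \<notin> \<Omega>"
  shows "n < \<mu> 0 + (c * (k - 1) + 1)"
proof -
  have p: "\<mu> \<in> partitions" "psize \<mu> = n" using \<mu> by (auto simp: partitions_of_def)
  have up: "\<not> \<nu> \<le> \<mu>" if "\<nu> \<in> \<Omega>" for \<nu> using that \<mu> p \<Omega> by (auto simp: partition_filter_def)
  have k: "\<mu> i = 0" if "i \<ge> k" for i
  proof -
    have "\<mu> k = 0"
    proof (rule ccontr)
      assume "\<mu> k \<noteq> 0"
      then have "rect 1 (k + 1) i \<le> \<mu> i" for i
        using partitions_antimono[OF p(1), of i k] by (cases "i < k + 1") (simp_all add: rect_def)
      then have "rect 1 (k + 1) \<le> \<mu>" by (rule le_funI)
      then show False using up[OF col] by simp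
    qed
    then show ?thesis using partitions_antimono[OF p(1) that] by simp
  qed
  have m1: "\<mu> 1 < c"
  proof (rule ccontr)
    assume "\<not> \<mu> 1 < c"
    then have "rect c 2 i \<le> \<mu> i" for i
      using partitions_antimono[OF p(1), of i 1] by (cases "i < 2") (simp_all add: rect_def)
    then have "rect c 2 \<le> \<mu>" by (rule le_funI)
    then show False using up[OF c(1)] by simp
  qed
  have n: "n = (\<Sum>i<k. \<mu> i)" using psize_eq_sum[OF k] p by simp
  show ?thesis
  proof (cases k)
    case (Suc k')
    have "(\<Sum>i<k'. \<mu> (Suc i)) \<le> (\<Sum>i<k'. c)"
    proof (rule sum_mono)
      fix i show "\<mu> (Suc i) \<le> c" using partitions_antimono[OF p(1), of 1 "Suc i"] m1 by simp
    qed
    then show ?thesis using n Suc by (simp add: sum.lessThan_Suc_shift mult.commute del: sum.lessThan_Suc)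
  qed (use n in simp)
qed

lemma com_words_filter_ideal:
  assumes \<Omega>: "partition_filter \<Omega>" "rect 1 (k + 1) \<in> \<Omega>" "rect c 2 \<in> \<Omega>" "c > 0"
  shows "F.span (com_words (c * (k - 1) + 1)) \<subseteq> filter_ideal \<Omega>"
proof (rule F.span_minimal[OF _ subspace_filter_ideal], rule subsetI)
  fix g assume "g \<in> com_words (c * (k - 1) + 1)"
  then have g: "com_word (c * (k - 1) + 1) g" by simp
  show "g \<in> filter_ideal \<Omega>"
    unfolding filter_ideal_def
  proof safe
    fix n \<mu> assume \<mu>: "\<mu> \<in> partitions_of n" "\<mu> \<notin> \<Omega>"
    show "central_op \<mu> (tcoord n g) = (\<lambda>u. 0)"
      using com_words_skew[OF g, of n] central_op_skew_zero[OF \<mu>(1) partition_outside_filter[OF \<Omega> \<mu>]]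
        group_op_zero[OF group_op_central[OF \<mu>(1)]] by auto
  qed
qed

lemma com_words_product:
  "foldr (\<lambda>i y. fmul (com (a (2 * i + 1)) (a (2 * i + 2))) y) [j..<j + m] (Poly_Mapping.single [] 1) \<in> F.span (com_words m)"
proof (induction m arbitrary: j)
  case 0
  show ?case by (simp add: F.span_base com_words_0)
next
  case (Suc m)
  have "[j..<j + Suc m] = j # [Suc j..<Suc j + m]" by (simp add: upt_rec)
  then show ?case using com_words_com[OF Suc[of "Suc j"]] by simp
qed

end

section \<open>Growth\<close>

context param_space
begin

text \<open>A subset of \<open>S\<close> of least cardinality that still generates modulo
  \<open>K\<close> gives a basis: if the class b depended on the other classes, all representatives
  of b could be dropped at once.\<close>

lemma has_dim_le:
  assumes S: "finite S" "S \<subseteq> H" and gen: "\<And>x. x \<in> H \<Longrightarrow> \<exists>y\<in>span S. x - y \<in> K"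
  shows "\<exists>d\<le>card S. has_dim A d"
proof -
  define P where "P B \<longleftrightarrow> B \<subseteq> S \<and> (\<forall>x\<in>H. \<exists>y\<in>span B. x - y \<in> K)" for B
  have "P S" using gen by (auto simp: P_def)
  then obtain B where B: "P B" "\<And>B'. P B' \<Longrightarrow> card B \<le> card B'"
    using ex_has_least_nat[of P S card] by blast
  have BS: "B \<subseteq> S" "B \<subseteq> H" "finite B" using B(1) S finite_subset[of B S] by (auto simp: P_def)
  have "b \<notin> lin_span A (\<pi> ` B - {b})" if b: "b \<in> \<pi> ` B" for b
  proof
    assume bad: "b \<in> lin_span A (\<pi> ` B - {b})"
    obtain x0 where x0: "x0 \<in> B" "b = \<pi> x0" using b by auto
    define B' where "B' = {x \<in> B. \<pi> x \<noteq> b}"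
    have "\<pi> ` B - {b} = \<pi> ` B'" by (auto simp: B'_def)
    moreover have B'H: "B' \<subseteq> H" using BS by (auto simp: B'_def)
    ultimately obtain z where z: "z \<in> span B'" "\<pi> x0 = \<pi> z" using bad x0 lin_span_eq[of B'] by auto
    have "span B' \<subseteq> H" by (rule span_minimal[OF B'H subspace_H])
    then have x0z: "x0 - z \<in> K" using pi_eq_iff[of x0 z] x0 z BS by auto
    define L where "L = {y. \<exists>z\<in>span B'. y - z \<in> K}"
    have subL: "subspace L"
      unfolding subspace_def
    proof (intro conjI ballI allI)
      show "0 \<in> L" using span_zero subspace_0[OF subspace_K] by (auto simp: L_def intro!: bexI[of _ 0])
      fix x y assume "x \<in> L" "y \<in> L"
      then obtain v w where vw: "v \<in> span B'" "x - v \<in> K" "w \<in> span B'" "y - w \<in> K" by (auto simp: L_def)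
      then have "(x + y) - (v + w) \<in> K" using subspace_add[OF subspace_K vw(2,4)] by (simp add: algebra_simps)
      then show "x + y \<in> L" using vw span_add by (auto simp: L_def)
    next
      fix c x assume "x \<in> L"
      then obtain v where v: "v \<in> span B'" "x - v \<in> K" by (auto simp: L_def)
      then have "\<sigma> c x - \<sigma> c v \<in> K" using subspace_scale[OF subspace_K v(2), of c] by (simp add: scale_right_diff_distrib)
      then show "\<sigma> c x \<in> L" using v span_scale by (auto simp: L_def)
    qed
    have "B \<subseteq> L"
    proof
      fix x assume x: "x \<in> B"
      show "x \<in> L"
      proof (cases "\<pi> x = b")
        case True
        then have "x - x0 \<in> K" using pi_eq_iff[of x x0] x x0 BS by auto
        then have "x - z \<in> K" using subspace_add[OF subspace_K _ x0z] by fastforce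
        then show ?thesis using z by (auto simp: L_def)
      next
        case False
        then have "x \<in> span B'" using x by (auto simp: B'_def intro: span_base)
        then show ?thesis using subspace_0[OF subspace_K] by (auto simp: L_def intro!: bexI[of _ x])
      qed
    qed
    then have spL: "span B \<subseteq> L" using subL by (rule span_minimal)
    have "P B'"
      unfolding P_def
    proof (intro conjI ballI)
      show "B' \<subseteq> S" using BS by (auto simp: B'_def)
      fix x assume "x \<in> H"
      then obtain y where y: "y \<in> span B" "x - y \<in> K" using B(1) by (auto simp: P_def)
      then obtain w where w: "w \<in> span B'" "y - w \<in> K" using spL by (auto simp: L_def)
      have "x - w \<in> K" using subspace_add[OF subspace_K y(2) w(2)] by simp
      then show "\<exists>y\<in>span B'. x - y \<in> K" using w by blast
    qed
    then have "card B \<le> card B'" by (rule B(2))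
    moreover have "B' \<subset> B" using x0 by (auto simp: B'_def)
    ultimately show False using psubset_card_mono[OF BS(3), of B'] by linarith
  qed
  moreover have "lin_span A (\<pi> ` B) = carrier A"
    unfolding lin_span_eq[OF BS(2)] carrier_eq
  proof
    have sp: "span B \<subseteq> H" by (rule span_minimal[OF BS(2) subspace_H])
    then show "\<pi> ` span B \<subseteq> \<pi> ` H" by auto
    show "\<pi> ` H \<subseteq> \<pi> ` span B"
    proof
      fix X' assume "X' \<in> \<pi> ` H"
      then obtain x where x: "x \<in> H" "X' = \<pi> x" by auto
      then obtain y where "y \<in> span B" "x - y \<in> K" using B(1) by (auto simp: P_def)
      then show "X' \<in> \<pi> ` span B" using x sp pi_eq_iff[of x y] by auto
    qed
  qed
  moreover have "\<pi> ` B \<subseteq> carrier A" using BS by (auto simp: carrier_eq)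
  ultimately have "has_dim A (card (\<pi> ` B))" using BS unfolding has_dim_def is_basis_def by blast
  moreover have "card (\<pi> ` B) \<le> card S" using card_image_le[OF BS(3), of \<pi>] card_mono[OF S(1) BS(1)] by simp
  ultimately show ?thesis by blast
qed

lemma has_dim_span:
  assumes "has_dim A d"
  obtains B where "finite B" "card B = d" "B \<subseteq> H" "\<And>x. x \<in> H \<Longrightarrow> \<exists>y\<in>span B. x - y \<in> K"
proof -
  obtain C where C: "finite C" "card C = d" "C \<subseteq> carrier A" "lin_span A C = carrier A"
    using assms unfolding has_dim_def is_basis_def by blast
  obtain B where B: "B \<subseteq> H" "C = \<pi> ` B" "inj_on \<pi> B"
    using C(3) subset_image_inj[of C \<pi> H] unfolding carrier_eq by blast
  have "finite B" "card B = d" using B C finite_imageD card_image by (blast, metis)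
  moreover have "\<exists>y\<in>span B. x - y \<in> K" if x: "x \<in> H" for x
  proof -
    have "\<pi> x \<in> \<pi> ` span B" using C(4) x lin_span_eq[OF B(1)] B(2) carrier_eq by auto
    then obtain y where y: "y \<in> span B" "\<pi> x = \<pi> y" by auto
    have "span B \<subseteq> H" by (rule span_minimal[OF B(1) subspace_H])
    then show ?thesis using y x pi_eq_iff[of x y] by auto
  qed
  ultimately show ?thesis using that B by blast
qed

end

text \<open>The word has \<open>m\<close> disjoint descents at adjacent places.\<close>

primrec bad_word :: "nat \<Rightarrow> nat list \<Rightarrow> bool" where
  "bad_word 0 l = True"
| "bad_word (Suc m) l = (\<exists>s x y t. l = s @ x # y # t \<and> y < x \<and> bad_word m t)"

text \<open>Earlier places weigh more, so exchanging the two letters of a descent lowers the rank by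
  their difference.\<close>

primrec word_rank :: "nat list \<Rightarrow> nat" where
  "word_rank [] = 0"
| "word_rank (x # l) = Suc (length l) * x + word_rank l"

lemma word_rank_append: "word_rank (s @ t) = word_rank s + length t * sum_list s + word_rank t"
  by (induction s) (simp_all add: algebra_simps)

text \<open>The cut is made at the first descent: what precedes it is sorted, and what follows it
  has one disjoint descent less at its disposal.\<close>

lemma not_bad_cases:
  assumes "\<not> bad_word (Suc m) l"
  shows "sorted l \<or> (\<exists>s x y t. l = s @ x # y # t \<and> sorted s \<and> \<not> bad_word m t)"
proof (cases "sorted l")
  case False
  have "\<exists>s x y t. l = s @ x # y # t \<and> sorted s \<and> y < x" using False
  proof (induction l)
    case (Cons a l)
    show ?case
    proof (cases l)
      case Nil
      then show ?thesis using Cons.prems by simp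
    next
      case l: (Cons c l')
      show ?thesis
      proof (cases "c < a")
        case True
        then show ?thesis using l by (intro exI[of _ "[]"] exI[of _ a] exI[of _ c] exI[of _ l']) simp
      next
        case ac: False
        moreover have "sorted (a # l) \<longleftrightarrow> a \<le> c \<and> sorted l" unfolding l by (rule sorted2)
        ultimately have "\<not> sorted l" using Cons.prems by simp
        then obtain s x y t where st: "l = s @ x # y # t" "sorted s" "y < x" using Cons.IH by blast
        have "sorted (a # s)" using st ac l by (cases s) (simp_all only: sorted1 sorted2 append_Cons list.inject, simp)
        then show ?thesis using st by (intro exI[of _ "a # s"] exI[of _ x] exI[of _ y] exI[of _ t]) simp
      qed
    qed
  qed simp
  then obtain s x y t where st: "l = s @ x # y # t" "sorted s" "y < x" by blast
  then have "\<not> bad_word m t" using assms by auto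
  then show ?thesis using st by blast
qed simp

text \<open>A sorted word is determined by the multiplicities of its \<open>k\<close> letters, each
  of them at most \<open>n\<close>.\<close>

lemma sorted_words_card:
  "finite {l. sorted l \<and> set l \<subseteq> {..<k} \<and> length l \<le> n}"
  "card {l. sorted l \<and> set l \<subseteq> {..<k} \<and> length l \<le> n} \<le> (n + 1) ^ k"
proof -
  let ?S = "{l. sorted l \<and> set l \<subseteq> {..<k} \<and> length l \<le> n}"
  show "finite ?S" by (rule finite_subset[OF _ finite_lists_length_le[of "{..<k}" n]]) auto
  have "inj_on (\<lambda>l. \<lambda>i\<in>{..<k}. count_list l i) ?S"
  proof (rule inj_onI)
    fix l l' assume l: "l \<in> ?S" "l' \<in> ?S" "(\<lambda>i\<in>{..<k}. count_list l i) = (\<lambda>i\<in>{..<k}. count_list l' i)"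
    have "count_list l i = count_list l' i" for i
    proof (cases "i < k")
      case True
      then show ?thesis using fun_cong[OF l(3), of i] by simp
    next
      case False
      then have "i \<notin> set l" "i \<notin> set l'" using l by auto
      then show ?thesis by (simp add: count_list_0_iff)
    qed
    then have "mset l = mset l'" by (intro multiset_eqI) (simp add: count_mset)
    then show "l = l'" using l properties_for_sort by (metis (mono_tags, lifting) mem_Collect_eq)
  qed
  moreover have "(\<lambda>l. \<lambda>i\<in>{..<k}. count_list l i) ` ?S \<subseteq> {..<k} \<rightarrow>\<^sub>E {..n}"
    by (auto intro!: restrict_PiE_iff[THEN iffD2] intro: order_trans[OF count_le_length])
  moreover have "finite ({..<k} \<rightarrow>\<^sub>E {..n})" by (rule finite_PiE) auto
  ultimately have "card ?S \<le> card ({..<k} \<rightarrow>\<^sub>E {..n})" by (rule card_inj_on_le)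
  also have "\<dots> = (n + 1) ^ k" by (simp add: card_PiE)
  finally show "card ?S \<le> (n + 1) ^ k" .
qed

lemma not_bad_words_card:
  "card {l. set l \<subseteq> {..<k} \<and> length l \<le> n \<and> \<not> bad_word m l} \<le> ((n + 1) ^ k * (k * k + 1)) ^ m"
proof (induction m)
  case (Suc m)
  define N where "N m = {l. set l \<subseteq> {..<k} \<and> length l \<le> n \<and> \<not> bad_word m l}" for m
  define S where "S = {l. sorted l \<and> set l \<subseteq> {..<k} \<and> length l \<le> n}"
  have finN: "finite (N m)" for m
    by (rule finite_subset[OF _ finite_lists_length_le[of "{..<k}" n]]) (auto simp: N_def)
  have S: "finite S" "card S \<le> (n + 1) ^ k" using sorted_words_card unfolding S_def by auto
  let ?T = "S \<times> {..<k} \<times> {..<k} \<times> N m"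
  have "N (Suc m) \<subseteq> S \<union> (\<lambda>(s, x, y, t). s @ x # y # t) ` ?T"
  proof
    fix l assume l: "l \<in> N (Suc m)"
    from not_bad_cases[of m l] l consider "sorted l" | s x y t where "l = s @ x # y # t" "sorted s" "\<not> bad_word m t"
      by (auto simp: N_def)
    then show "l \<in> S \<union> (\<lambda>(s, x, y, t). s @ x # y # t) ` ?T"
    proof cases
      case 1
      then show ?thesis using l by (auto simp: N_def S_def)
    next
      case 2
      then have "(s, x, y, t) \<in> ?T" using l by (auto simp: N_def S_def)
      then show ?thesis using 2 by (intro UnI2 image_eqI[of _ _ "(s, x, y, t)"]) auto
    qed
  qed
  then have "card (N (Suc m)) \<le> card (S \<union> (\<lambda>(s, x, y, t). s @ x # y # t) ` ?T)"
    using S finN by (intro card_mono) auto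
  also have "\<dots> \<le> card S + card ((\<lambda>(s, x, y, t). s @ x # y # t) ` ?T)" by (rule card_Un_le)
  also have "card ((\<lambda>(s, x, y, t). s @ x # y # t) ` ?T) \<le> card ?T"
    using S finN by (intro card_image_le) auto
  also have "card ?T = card S * (k * (k * card (N m)))" by (simp add: card_cartesian_product)
  also have "card S + card S * (k * (k * card (N m))) = card S * (1 + k * k * card (N m))" by (simp add: algebra_simps)
  also have "\<dots> \<le> (n + 1) ^ k * (1 + k * k * ((n + 1) ^ k * (k * k + 1)) ^ m)"
    using S(2) Suc by (intro mult_mono add_mono) (auto simp: N_def)
  also have "\<dots> \<le> (n + 1) ^ k * (((n + 1) ^ k * (k * k + 1)) ^ m + k * k * ((n + 1) ^ k * (k * k + 1)) ^ m)"
  proof -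
    have "1 \<le> ((n + 1) ^ k * (k * k + 1)) ^ m" by (simp add: Suc_le_eq)
    then show ?thesis by (intro mult_left_mono add_right_mono) auto
  qed
  also have "\<dots> = ((n + 1) ^ k * (k * k + 1)) ^ Suc m" by (simp add: algebra_simps)
  finally show ?case by (simp add: N_def)
qed simp

text \<open>A polynomial is bounded by C (n + 1)^D. At n = t (D + 1) the power of two is (2^t)^(D +
  1), which is at least (t + 1)^(D + 1), whereas the bound grows only like (t + 1)^D.\<close>

lemma poly_less_exponential:
  fixes p :: "real poly"
  shows "\<exists>n. poly p (real n) < 2 ^ n"
proof (rule ccontr)
  assume no: "\<not> ?thesis"
  have "\<exists>C D. \<forall>n. \<bar>poly p (real n)\<bar> \<le> C * (real n + 1) ^ D"
  proof (induction p)
    case 0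
    show ?case by (intro exI[of _ 0]) simp
  next
    case (pCons a p)
    then obtain C D where CD: "\<And>n. \<bar>poly p (real n)\<bar> \<le> C * (real n + 1) ^ D" by blast
    have C0: "C \<ge> 0" using CD[of 0] by simp
    have "\<bar>poly (pCons a p) (real n)\<bar> \<le> (\<bar>a\<bar> + C) * (real n + 1) ^ Suc D" for n
    proof -
      have "\<bar>poly (pCons a p) (real n)\<bar> \<le> \<bar>a\<bar> + real n * \<bar>poly p (real n)\<bar>"
        using abs_triangle_ineq[of a "real n * poly p (real n)"] by (simp add: abs_mult)
      also have "\<dots> \<le> \<bar>a\<bar> * (real n + 1) ^ Suc D + (real n + 1) * (C * (real n + 1) ^ D)"
      proof (rule add_mono)
        have "1 \<le> (real n + 1) ^ Suc D" by (rule one_le_power) simp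
        then show "\<bar>a\<bar> \<le> \<bar>a\<bar> * (real n + 1) ^ Suc D" using mult_left_mono[of 1 _ "\<bar>a\<bar>"] by fastforce
        show "real n * \<bar>poly p (real n)\<bar> \<le> (real n + 1) * (C * (real n + 1) ^ D)"
          using CD[of n] C0 by (intro mult_mono) auto
      qed
      finally show ?thesis by (simp add: algebra_simps)
    qed
    then show ?case by blast
  qed
  then obtain C D where CD: "\<And>n. \<bar>poly p (real n)\<bar> \<le> C * (real n + 1) ^ D" by blast
  have le: "2 ^ n \<le> C * (real n + 1) ^ D" for n using no CD[of n] by (smt (verit))
  have C0: "C \<ge> 0" using CD[of 0] by simp
  have "real t + 1 \<le> C * (real D + 1) ^ D" for t :: nat
  proof -
    have t: "real t + 1 \<le> 2 ^ t"
      using Bernoulli_inequality[of "1::real" t] by simp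
    have "(real t + 1) * (real t + 1) ^ D \<le> (2 ^ t) ^ Suc D"
      using power_mono[OF t, of "Suc D"] by simp
    also have "\<dots> = 2 ^ (t * Suc D)" by (simp only: power_mult)
    also have "\<dots> \<le> C * (real (t * Suc D) + 1) ^ D" by (rule le)
    also have "\<dots> \<le> C * ((real D + 1) * (real t + 1)) ^ D"
    proof (intro mult_left_mono power_mono)
      show "real (t * Suc D) + 1 \<le> (real D + 1) * (real t + 1)" by (simp add: algebra_simps)
    qed (use C0 in auto)
    also have "\<dots> = C * (real D + 1) ^ D * (real t + 1) ^ D" by (simp add: power_mult_distrib)
    finally show ?thesis by (rule mult_right_le_imp_le) simp
  qed
  moreover obtain t where "C * (real D + 1) ^ D < real t" using reals_Archimedean2 by blast
  ultimately show False by (smt (verit))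
qed

section \<open>Rewriting words modulo products of commutators\<close>

context tensor_coords
begin

definition bword :: "nat list \<Rightarrow> 'v list \<Rightarrow>\<^sub>0 'f" where
  "bword l = Poly_Mapping.single (map b l) 1"

lemma bword_append: "bword (l @ l') = fmul (bword l) (bword l')"
  by (simp add: bword_def)

text \<open>Replacing the two letters of each of the \<open>m\<close> descents by their commutator
  gives an element with leading term \<open>l\<close>: in every other term some descent has been
  exchanged, so its rank is smaller.\<close>

lemma bad_word_reduce:
  assumes "bad_word m l" "set l \<subseteq> {..<k}"
  shows "\<exists>d\<in>F.span (com_words m).
    d - bword l \<in> F.span (bword ` {l'. length l' = length l \<and> set l' \<subseteq> {..<k} \<and> word_rank l' < word_rank l})"
  using assms
proof (induction m arbitrary: l)
  case 0
  show ?case by (rule bexI[of _ "bword l"]) (auto simp: F.span_zero bword_def intro: F.span_base com_words_0)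
next
  case (Suc m)
  define R where "R l = bword ` {l'. length l' = length l \<and> set l' \<subseteq> {..<k} \<and> word_rank l' < word_rank l}" for l
  obtain s x y t where l: "l = s @ x # y # t" "y < x" "bad_word m t" using Suc.prems by auto
  have lk: "set s \<subseteq> {..<k}" "x < k" "y < k" "set t \<subseteq> {..<k}" using Suc.prems l by auto
  obtain d where d: "d \<in> F.span (com_words m)" "d - bword t \<in> F.span (R t)"
    using Suc.IH[OF l(3) lk(4)] unfolding R_def by blast
  let ?c = "com (letter (b x)) (letter (b y))"
  let ?T = "\<lambda>r. fmul (bword s) (fmul ?c r)"
  have T: "?T (bword t') = bword (s @ x # y # t') - bword (s @ y # x # t')" for t'
    by (simp add: com_def bword_def F.mul_diff)
  have swap: "bword (s @ y # x # t) \<in> R l"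
    unfolding R_def by (rule image_eqI[OF refl]) (use l lk in \<open>auto simp: word_rank_append algebra_simps\<close>)
  have TR: "?T r \<in> F.span (R l)" if "r \<in> F.span (R t)" for r
    using that
  proof (induction rule: F.span_induct_alt)
    case base
    then show ?case by (simp add: F.span_zero)
  next
    case (step c h r)
    then obtain t' where t': "h = bword t'" "length t' = length t" "set t' \<subseteq> {..<k}" "word_rank t' < word_rank t"
      by (auto simp: R_def)
    have "bword (s @ x # y # t') \<in> R l" "bword (s @ y # x # t') \<in> R l"
      unfolding R_def by (rule image_eqI[OF refl], use l lk t' in \<open>auto simp: word_rank_append algebra_simps\<close>)+
    then have "?T h \<in> F.span (R l)" unfolding t'(1) T by (intro F.span_diff F.span_base)
    then show ?case using step by (simp add: fmul_add_right fmul_scale F.span_add F.span_scale)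
  qed
  have "?T d \<in> F.span (com_words (Suc m))" by (intro com_words_left_mult com_words_com d)
  moreover have "?T d - bword l = ?T (d - bword t) - bword (s @ y # x # t)"
    unfolding F.mul_diff(2) T l by simp
  then have "?T d - bword l \<in> F.span (R l)" using TR[OF d(2)] F.span_diff F.span_base[OF swap] by metis
  ultimately show ?case unfolding R_def by blast
qed

lemma not_bad_words_span:
  assumes L: "F.subspace L" "F.span (com_words m) \<subseteq> L" and l: "set l \<subseteq> {..<k}"
  shows "\<exists>q\<in>F.span (bword ` {l'. length l' = length l \<and> set l' \<subseteq> {..<k} \<and> \<not> bad_word m l'}). bword l - q \<in> L"
  using l
proof (induction "word_rank l" arbitrary: l rule: less_induct)
  case less
  define B where "B = bword ` {l'. length l' = length l \<and> set l' \<subseteq> {..<k} \<and> \<not> bad_word m l'}"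
  have "\<exists>q\<in>F.span B. bword l - q \<in> L"
  proof (cases "bad_word m l")
    case False
    then have "bword l \<in> F.span B" using less.prems by (intro F.span_base) (auto simp: B_def)
    then show ?thesis using F.subspace_0[OF L(1)] by (intro bexI[of _ "bword l"]) auto
  next
    case True
    define R where "R = bword ` {l'. length l' = length l \<and> set l' \<subseteq> {..<k} \<and> word_rank l' < word_rank l}"
    obtain d where d: "d \<in> F.span (com_words m)" "d - bword l \<in> F.span R"
      using bad_word_reduce[OF True less.prems] unfolding R_def by blast
    have "\<exists>q\<in>F.span B. r - q \<in> L" if "r \<in> F.span R" for r
      using that
    proof (induction rule: F.span_induct_alt)
      case base
      show ?case using F.span_zero F.subspace_0[OF L(1)] by (intro bexI[of _ 0]) auto
    next
      case (step c h r)
      then obtain l' where l': "h = bword l'" "length l' = length l" "set l' \<subseteq> {..<k}" "word_rank l' < word_rank l"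
        by (auto simp: R_def)
      obtain q where q: "q \<in> F.span B" "h - q \<in> L" using less.hyps[OF l'(4,3)] l' by (auto simp: B_def)
      obtain q' where q': "q' \<in> F.span B" "r - q' \<in> L" using step by blast
      have "(scale c h + r) - (scale c q + q') = scale c (h - q) + (r - q')"
        by (simp add: F.scale_right_diff_distrib)
      also have "\<dots> \<in> L" by (intro F.subspace_add[OF L(1)] F.subspace_scale[OF L(1)] q q')
      finally show ?case using F.span_add[OF F.span_scale[OF q(1)] q'(1)] by blast
    qed
    then obtain q where q: "q \<in> F.span B" "(d - bword l) - q \<in> L" using d(2) by blast
    have "d - ((d - bword l) - q) \<in> L" by (rule F.subspace_diff[OF L(1) _ q(2)]) (use d(1) L(2) in auto)
    moreover have "bword l - (- q) = d - ((d - bword l) - q)" by simp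
    ultimately have "bword l - (- q) \<in> L" by (simp only:)
    then show ?thesis using F.span_neg[OF q(1)] by blast
  qed
  then show ?case by (simp add: B_def)
qed

lemma polynomial_growth_of_commutators:
  assumes \<Omega>: "partition_filter \<Omega>" and com: "F.span (com_words m) \<subseteq> filter_ideal \<Omega>"
  shows "polynomial_growth s \<Omega>"
proof -
  \<comment> \<open>The bound of \<open>not_bad_words_card\<close> as a polynomial in
    \<open>n\<close>, where \<open>[:1, 1:]\<close> stands for n + 1.\<close>
  define p :: "real poly" where "p = ([:1, 1:] ^ k * [:real (k * k + 1):]) ^ m"
  have "\<exists>d. has_dim (A_comp s \<Omega> n) d \<and> real d \<le> poly p (real n)" for n
  proof -
    interpret C: param_space scale "A_comp s \<Omega> n"
      "\<lambda>a. cls ` (filter_ideal \<Omega> \<inter> homogeneous n) +>\<^bsub>tensor_power s n\<^esub> cls a"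
      "homogeneous n" "filter_ideal \<Omega> \<inter> homogeneous n"
      by (rule param_A_comp[OF \<Omega>])
    define W where "W = {l. length l = n \<and> set l \<subseteq> {..<k} \<and> \<not> bad_word m l}"
    have finW: "finite W" by (rule finite_subset[OF _ finite_lists_length_eq[of "{..<k}" n]]) (auto simp: W_def)
    have WH: "bword ` W \<subseteq> homogeneous n" by (auto simp: W_def bword_def homogeneous_def)
    have sW: "F.span (bword ` W) \<subseteq> homogeneous n" by (rule F.span_minimal[OF WH subspace_homogeneous])
    have "\<exists>y\<in>F.span (bword ` W). x - y \<in> filter_ideal \<Omega> \<inter> homogeneous n" if x: "x \<in> homogeneous n" for x
    proof -
      obtain a where a: "a \<in> homogeneous n" "tcoord n a = tcoord n x" "Poly_Mapping.keys a \<subseteq> basis_words"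
        using letters_below_surj[OF letters_below_tcoord] by blast
      have "cls x = cls a" using cls_eq_homogeneous[OF x a(1)] a(2) by simp
      then have xa: "x - a \<in> filter_ideal \<Omega>" using T.pi_eq_iff[of x a] tkernel_filter_ideal by auto
      have "\<exists>q\<in>F.span (bword ` W). Poly_Mapping.single w c - q \<in> filter_ideal \<Omega>" if w: "w \<in> Poly_Mapping.keys a" for w c
      proof -
        obtain l where l: "w = map b l" "set l \<subseteq> {..<k}" using a(3) w by (auto simp: basis_words_def)
        have "length l = n" using a(1) w l by (auto simp: homogeneous_def)
        then obtain q where q: "q \<in> F.span (bword ` W)" "bword l - q \<in> filter_ideal \<Omega>"
          using not_bad_words_span[OF subspace_filter_ideal com l(2)] by (auto simp: W_def)
        have "Poly_Mapping.single w c - scale c q = scale c (bword l - q)"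
          by (simp add: F.scale_right_diff_distrib bword_def l)
        then show ?thesis using q F.subspace_scale[OF subspace_filter_ideal q(2), of c] F.span_scale by metis
      qed
      then obtain q where q: "\<And>w c. w \<in> Poly_Mapping.keys a \<Longrightarrow> q w c \<in> F.span (bword ` W)"
        "\<And>w c. w \<in> Poly_Mapping.keys a \<Longrightarrow> Poly_Mapping.single w c - q w c \<in> filter_ideal \<Omega>" by metis
      define y where "y = (\<Sum>w\<in>Poly_Mapping.keys a. q w (Poly_Mapping.lookup a w))"
      have y: "y \<in> F.span (bword ` W)" unfolding y_def by (intro F.span_sum q)
      have "a - y = (\<Sum>w\<in>Poly_Mapping.keys a. Poly_Mapping.single w (Poly_Mapping.lookup a w) - q w (Poly_Mapping.lookup a w))"
        unfolding y_def sum_subtractf poly_mapping_sum_single ..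
      also have "\<dots> \<in> filter_ideal \<Omega>" by (intro F.subspace_sum[OF subspace_filter_ideal] q)
      finally have "x - y \<in> filter_ideal \<Omega>" using F.subspace_add[OF subspace_filter_ideal xa] by fastforce
      then show ?thesis using y sW C.H_closed(5)[OF x] by blast
    qed
    then obtain d where d: "d \<le> card (bword ` W)" "has_dim (A_comp s \<Omega> n) d"
      using C.has_dim_le[OF finite_imageI[OF finW] WH] by blast
    have "d \<le> card W" using d(1) card_image_le[OF finW] order_trans by blast
    also have "card W \<le> card {l. set l \<subseteq> {..<k} \<and> length l \<le> n \<and> \<not> bad_word m l}"
      by (rule card_mono, rule finite_subset[OF _ finite_lists_length_le[of "{..<k}" n]]) (auto simp: W_def)
    also have "\<dots> \<le> ((n + 1) ^ k * (k * k + 1)) ^ m" by (rule not_bad_words_card)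
    finally have "real d \<le> real (((n + 1) ^ k * (k * k + 1)) ^ m)" by (rule of_nat_mono)
    also have "\<dots> = poly p (real n)" by (simp add: p_def algebra_simps)
    finally show ?thesis using d(2) by blast
  qed
  then show ?thesis unfolding polynomial_growth_def by blast
qed

section \<open>Filters without two-row rectangles\<close>

lemma filter_ideal_two_letters:
  assumes \<Omega>: "partition_filter \<Omega>" and no: "\<And>c. c > 0 \<Longrightarrow> rect c 2 \<notin> \<Omega>"
    and a: "a \<in> filter_ideal \<Omega>" and u: "\<And>x. x < n \<Longrightarrow> u x < 2"
  shows "tcoord n a u = 0"
proof -
  have "central_op \<mu> (tcoord n a) u = 0" if \<mu>: "\<mu> \<in> partitions_of n \<inter> \<Omega>" for \<mu>
  proof (rule central_op_two_letters)
    show p: "\<mu> \<in> partitions" using \<mu> by (simp add: partitions_of_def)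
    show "u x < 2" if "x < psize \<mu>" for x using that \<mu> u by (simp add: partitions_of_def)
    show "\<mu> 2 \<noteq> 0"
    proof
      \<comment> \<open>A member with at most two rows fits into a rectangle with two rows, which
        then belongs to \<Omega>. The successor keeps its width positive even for the empty
        partition.\<close>
      assume "\<mu> 2 = 0"
      then have z: "\<mu> i = 0" if "i \<ge> 2" for i using partitions_antimono[OF p that] by simp
      have "\<mu> i \<le> rect (Suc (\<mu> 0)) 2 i" for i
        using z[of i] partitions_antimono[OF p, of 0 i] by (cases "i < 2") (auto simp: rect_def)
      then have "\<mu> \<le> rect (Suc (\<mu> 0)) 2" by (rule le_funI)
      moreover have "finite {i. rect (Suc (\<mu> 0)) 2 i \<noteq> 0}"
        by (rule finite_subset[of _ "{..<2}"]) (auto simp: rect_def split: if_splits)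
      then have "rect (Suc (\<mu> 0)) 2 \<in> partitions" by (auto simp: partitions_def antimono_def rect_def)
      ultimately have "rect (Suc (\<mu> 0)) 2 \<in> \<Omega>" using \<Omega> \<mu> by (auto simp: partition_filter_def)
      then show False using no by simp
    qed
  qed
  then show ?thesis by (subst filter_ideal_expand[OF a]) simp
qed

text \<open>The map \<rho> keeps only the coordinates on words in the letters 0 and 1, and it
  vanishes on elements of the ideal. It fixes the 2^n words of this kind, so these independent
  elements lie in the span of the image of any generating set.\<close>

lemma two_letters_lower_bound:
  assumes \<Omega>: "partition_filter \<Omega>" and no: "\<And>c. c > 0 \<Longrightarrow> rect c 2 \<notin> \<Omega>" and k: "2 \<le> k"
    and d: "has_dim (A_comp s \<Omega> n) d"
  shows "2 ^ n \<le> d"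
proof -
  interpret C: param_space scale "A_comp s \<Omega> n"
    "\<lambda>a. cls ` (filter_ideal \<Omega> \<inter> homogeneous n) +>\<^bsub>tensor_power s n\<^esub> cls a"
    "homogeneous n" "filter_ideal \<Omega> \<inter> homogeneous n"
    by (rule param_A_comp[OF \<Omega>])
  obtain B where B: "finite B" "card B = d" "B \<subseteq> homogeneous n"
    "\<And>x. x \<in> homogeneous n \<Longrightarrow> \<exists>y\<in>F.span B. x - y \<in> filter_ideal \<Omega> \<inter> homogeneous n"
    using C.has_dim_span[OF d] by blast
  define W where "W = {l. set l \<subseteq> {..<2::nat} \<and> length l = n}"
  have W: "finite W" "card W = 2 ^ n"
    using finite_lists_length_eq[of "{..<2::nat}" n] card_lists_length_eq[of "{..<2::nat}" n] by (simp_all add: W_def)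
  have Wk: "set l \<subseteq> {..<k}" if "l \<in> W" for l using that k by (auto simp: W_def subset_iff)
  define \<rho> where "\<rho> a = (\<Sum>l\<in>W. scale (tcoord n a ((!) l)) (bword l))" for a
  have \<rho>_add: "\<rho> (x + y) = \<rho> x + \<rho> y" for x y by (simp add: \<rho>_def tcoord_add F.scale_left_distrib sum.distrib)
  have \<rho>_scale: "\<rho> (scale c x) = scale c (\<rho> x)" for c x by (simp add: \<rho>_def tcoord_scale F.scale_sum_right)
  have \<rho>_span: "\<rho> y \<in> F.span (\<rho> ` B)" if "y \<in> F.span B" for y
    using that
  proof (induction rule: F.span_induct_alt)
    case base
    have "\<rho> 0 = 0" by (simp add: \<rho>_def)
    then show ?case by (simp add: F.span_zero)
  next
    case (step c h y)
    then show ?case by (simp add: \<rho>_add \<rho>_scale F.span_add F.span_scale F.span_base)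
  qed
  have inj: "inj_on (map b) W"
    by (rule inj_on_mapI, rule inj_on_subset[OF basis_inj]) (use Wk in auto)
  have \<rho>_word: "\<rho> (bword l) = bword l" if l: "l \<in> W" for l
  proof -
    have "tcoord n (bword l) ((!) l') = (if l' = l then 1 else 0)" if "l' \<in> W" for l'
    proof -
      have "map ((!) l') [0..<n] = l'" using that map_nth[of l'] by (simp add: W_def)
      then show ?thesis using word_coord_basis[OF Wk[OF l], of n "(!) l'"] by (auto simp: bword_def tcoord_single)
    qed
    then have "\<rho> (bword l) = (\<Sum>l'\<in>W. if l' = l then bword l' else 0)"
      unfolding \<rho>_def by (intro sum.cong) auto
    then show ?thesis using l W by simp
  qed
  have "bword ` W \<subseteq> F.span (\<rho> ` B)"
  proof safe
    fix l assume l: "l \<in> W"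
    have "bword l \<in> homogeneous n" using l by (auto simp: bword_def homogeneous_def W_def)
    then obtain y where y: "y \<in> F.span B" "bword l - y \<in> filter_ideal \<Omega>" using B(4) by blast
    have "tcoord n (bword l - y) ((!) l') = 0" if "l' \<in> W" for l'
      by (rule filter_ideal_two_letters[OF \<Omega> no y(2)]) (use that in \<open>auto simp: W_def subset_iff\<close>)
    then have "tcoord n (bword l) ((!) l') = tcoord n y ((!) l')" if "l' \<in> W" for l'
      using that by (simp add: tcoord_diff)
    then have "\<rho> (bword l) = \<rho> y" unfolding \<rho>_def by (intro sum.cong) auto
    then show "bword l \<in> F.span (\<rho> ` B)" using \<rho>_word[OF l] \<rho>_span[OF y(1)] by simp
  qed
  moreover have inj_b: "inj_on bword W"
  proof (rule inj_onI)
    fix l l' assume l: "l \<in> W" "l' \<in> W" "bword l = bword l'"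
    have "{map b l} = {map b l'}" using arg_cong[OF l(3), of Poly_Mapping.keys] unfolding bword_def by simp
    then show "l = l'" using inj l by (auto simp: inj_on_def)
  qed
  have "F.independent (bword ` W)"
  proof (rule F.independent_if_scalars_zero)
    show "finite (bword ` W)" using W by simp
    fix f x assume 0: "(\<Sum>x\<in>bword ` W. scale (f x) x) = 0" and x: "x \<in> bword ` W"
    obtain l where l: "l \<in> W" "x = bword l" using x by auto
    have "(\<Sum>l\<in>W. scale (f (bword l)) (bword l)) = 0" using 0 inj_b by (simp add: sum.reindex)
    then have "0 = Poly_Mapping.lookup (\<Sum>l\<in>W. scale (f (bword l)) (bword l)) (map b l)" by simp
    also have "\<dots> = (\<Sum>l'\<in>W. if l' = l then f (bword l') else 0)"
      unfolding lookup_sum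
      by (rule sum.cong) (use inj l in \<open>auto simp: bword_def lookup_single when_def inj_on_def\<close>)
    also have "\<dots> = f x" using l W by simp
    finally show "f x = 0" by simp
  qed
  ultimately have "card (bword ` W) \<le> card (\<rho> ` B)"
    using F.independent_span_bound[of "\<rho> ` B" "bword ` W"] B(1) by blast
  also have "\<dots> \<le> d" using card_image_le[OF B(1), of \<rho>] B(2) by simp
  finally show ?thesis using card_image[OF inj_b] W(2) by simp
qed

end

section \<open>Polynomial identities\<close>

context param_ring
begin

lemma word_value_eq: "word_value A (\<lambda>i. \<pi> (a i)) w = \<pi> (foldr (\<lambda>i y. mul (a i) y) w e)"
  by (induction w) (simp_all add: word_value_def one_eq mult_eq)

lemma eval_poly_eq:
  "eval_poly A (\<lambda>i. \<pi> (a i)) f = \<pi> (\<Sum>w\<in>Poly_Mapping.keys f. \<sigma> (Poly_Mapping.lookup f w) (foldr (\<lambda>i y. mul (a i) y) w e))"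
  unfolding eval_poly_def word_value_eq by (simp add: smult_eq finsum_eq)

lemma commutator_eq: "commutator A (\<pi> x) (\<pi> y) = \<pi> (mul x y - mul y x)"
  by (simp add: commutator_def mult_eq a_minus_eq)

lemma commutator_product_eq:
  "commutator_product A (\<lambda>i. \<pi> (a i)) m =
    \<pi> (foldr (\<lambda>i y. mul (mul (a (2 * i + 1)) (a (2 * i + 2)) - mul (a (2 * i + 2)) (a (2 * i + 1))) y) [0..<m] e)"
proof -
  have "foldr (\<lambda>i y. commutator A (\<pi> (a (2 * i + 1))) (\<pi> (a (2 * i + 2))) \<otimes>\<^bsub>A\<^esub> y) l \<one>\<^bsub>A\<^esub> =
    \<pi> (foldr (\<lambda>i y. mul (mul (a (2 * i + 1)) (a (2 * i + 2)) - mul (a (2 * i + 2)) (a (2 * i + 1))) y) l e)" for l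
    by (induction l) (simp_all only: foldr.simps id_apply comp_apply one_eq mult_eq commutator_eq)
  then show ?thesis by (simp add: commutator_product_def)
qed

lemma carrier_sequence:
  fixes x :: "nat \<Rightarrow> 'b"
  assumes "\<forall>i. x i \<in> carrier A" obtains a where "x = (\<lambda>i. \<pi> (a i))"
proof -
  have "\<forall>i. \<exists>a. x i = \<pi> a" using assms by (auto simp: carrier_eq)
  then show ?thesis using that by (metis ext)
qed

text \<open>In the product the odd variables are the first entries of the commutators and the even
  ones the second entries, so this substitution makes all factors equal.\<close>

lemma commutator_power_eq:
  assumes "x \<in> carrier A" "y \<in> carrier A"
  shows "commutator A x y [^]\<^bsub>A\<^esub> (m::nat) = commutator_product A (\<lambda>i. if odd i then x else y) m"
proof -
  interpret Group.monoid A by (rule ring.is_monoid[OF is_ring])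
  have c: "commutator A x y \<in> carrier A" using assms commutator_eq by (auto simp: carrier_eq)
  have "foldr (\<lambda>i z. commutator A x y \<otimes>\<^bsub>A\<^esub> z) l \<one>\<^bsub>A\<^esub> = commutator A x y [^]\<^bsub>A\<^esub> length l" for l :: "nat list"
  proof (induction l)
    case (Cons i l)
    then show ?case using nat_pow_Suc2[OF c, of "length l"] by simp
  qed simp
  from this[of "[0..<m]"] show ?thesis by (simp add: commutator_product_def)
qed

end

section \<open>Substitution into noncommutative polynomials\<close>

definition subst_poly :: "(nat \<Rightarrow> 'x list \<Rightarrow>\<^sub>0 'f) \<Rightarrow> (nat list \<Rightarrow>\<^sub>0 'f) \<Rightarrow> 'x list \<Rightarrow>\<^sub>0 'f::field" where
  "subst_poly a f = (\<Sum>w\<in>Poly_Mapping.keys f. scale (Poly_Mapping.lookup f w) (foldr (\<lambda>i y. fmul (a i) y) w (Poly_Mapping.single [] 1)))"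

lemma subst_poly_superset:
  fixes a :: "nat \<Rightarrow> 'x list \<Rightarrow>\<^sub>0 'f::field"
  assumes "finite S" "Poly_Mapping.keys f \<subseteq> S"
  shows "subst_poly a f = (\<Sum>w\<in>S. scale (Poly_Mapping.lookup f w) (foldr (\<lambda>i y. fmul (a i) y) w (Poly_Mapping.single [] 1)))"
proof -
  have z: "scale 0 x = (0 :: 'x list \<Rightarrow>\<^sub>0 'f)" for x by (rule poly_mapping_eqI) simp
  show ?thesis
    unfolding subst_poly_def by (rule sum.mono_neutral_left) (use assms in \<open>auto simp: not_in_keys_iff_lookup_eq_zero z\<close>)
qed

lemma subst_poly_add: "subst_poly a (f + g) = subst_poly a f + subst_poly a g"
proof -
  interpret vector_space "scale :: 'b \<Rightarrow> ('a list \<Rightarrow>\<^sub>0 'b) \<Rightarrow> _" by (rule vector_space_scale)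
  let ?S = "Poly_Mapping.keys f \<union> Poly_Mapping.keys g"
  have "Poly_Mapping.keys (f + g) \<subseteq> ?S" by (rule Poly_Mapping.keys_add)
  then show ?thesis
    using subst_poly_superset[of ?S "f + g" a] subst_poly_superset[of ?S f a] subst_poly_superset[of ?S g a]
    by (simp add: lookup_add scale_left_distrib sum.distrib)
qed

lemma subst_poly_zero [simp]: "subst_poly a 0 = 0"
  by (simp add: subst_poly_def)

lemma subst_poly_diff: "subst_poly a (f - g) = subst_poly a f - subst_poly a g"
  using subst_poly_add[of a "f - g" g] by (simp add: algebra_simps)

lemma subst_poly_single:
  "subst_poly a (Poly_Mapping.single w c) = scale c (foldr (\<lambda>i y. fmul (a i) y) w (Poly_Mapping.single [] 1))"
  by (subst subst_poly_superset[of "{w}"]) auto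

lemma subst_poly_mult: "subst_poly a (fmul f g) = fmul (subst_poly a f) (subst_poly a g)"
proof (induction f rule: poly_mapping_add_induct)
  case (single u c)
  interpret vector_space "scale :: 'b \<Rightarrow> ('a list \<Rightarrow>\<^sub>0 'b) \<Rightarrow> _" by (rule vector_space_scale)
  have fold: "foldr (\<lambda>i y. fmul (a i) y) u x = fmul (foldr (\<lambda>i y. fmul (a i) y) u (Poly_Mapping.single [] 1)) x" for x u
    by (induction u) (simp_all add: fmul_one fmul_assoc)
  show ?case
    by (induction g rule: poly_mapping_add_induct)
       (simp_all add: subst_poly_add fmul_add_right subst_poly_single fmul_scale fold[of u "foldr _ _ _", symmetric] mult.commute)
qed (simp_all add: subst_poly_add fmul_add_left)

lemma lookup_fmul_single:
  "Poly_Mapping.lookup (fmul (Poly_Mapping.single u c) g) (u' @ v) = (if u = u' then c * Poly_Mapping.lookup g v else 0)"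
  if "length u = length u'"
  by (induction g rule: poly_mapping_add_induct)
     (use that in \<open>auto simp: fmul_add_right lookup_add lookup_single when_def distrib_left\<close>)

definition commutator_poly :: "nat \<Rightarrow> nat \<Rightarrow> nat list \<Rightarrow>\<^sub>0 'f::field" where
  "commutator_poly j m = foldr (\<lambda>i y. fmul (fmul (Poly_Mapping.single [2 * i + 1] 1) (Poly_Mapping.single [2 * i + 2] 1)
     - fmul (Poly_Mapping.single [2 * i + 2] 1) (Poly_Mapping.single [2 * i + 1] 1)) y) [j..<j + m] (Poly_Mapping.single [] 1)"

text \<open>The monomial with all variables in increasing order has coefficient 1, because every
  other term of the expansion exchanges some pair.\<close>

lemma commutator_poly_nonzero: "commutator_poly j m \<noteq> (0 :: nat list \<Rightarrow>\<^sub>0 'f::field)"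
proof -
  interpret F: param_ring scale "free_algebra :: ('f, nat list \<Rightarrow>\<^sub>0 'f) module" "\<lambda>a. a" "{0}" fmul "Poly_Mapping.single [] 1"
    by (rule param_ring_free_algebra)
  have "\<exists>w. Poly_Mapping.lookup (commutator_poly j m :: nat list \<Rightarrow>\<^sub>0 'f) w = 1"
  proof (induction m arbitrary: j)
    case 0
    show ?case by (intro exI[of _ "[]"]) (simp add: commutator_poly_def)
  next
    case (Suc m)
    obtain w where w: "Poly_Mapping.lookup (commutator_poly (Suc j) m :: nat list \<Rightarrow>\<^sub>0 'f) w = 1" using Suc by blast
    have l: "[j..<j + Suc m] = j # [Suc j..<Suc j + m]" by (simp add: upt_rec)
    have "commutator_poly j (Suc m) = fmul (Poly_Mapping.single [2 * j + 1, 2 * j + 2] 1) (commutator_poly (Suc j) m :: nat list \<Rightarrow>\<^sub>0 'f)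
      - fmul (Poly_Mapping.single [2 * j + 2, 2 * j + 1] 1) (commutator_poly (Suc j) m)"
      unfolding commutator_poly_def l by (simp add: F.mul_diff)
    then have "Poly_Mapping.lookup (commutator_poly j (Suc m) :: nat list \<Rightarrow>\<^sub>0 'f) ([2 * j + 1, 2 * j + 2] @ w) = 1"
      using w lookup_fmul_single[of "[2 * j + 1, 2 * j + 2]" "[2 * j + 1, 2 * j + 2]" "1 :: 'f" "commutator_poly (Suc j) m" w]
        lookup_fmul_single[of "[2 * j + 2, 2 * j + 1]" "[2 * j + 1, 2 * j + 2]" "1 :: 'f" "commutator_poly (Suc j) m" w]
      by (simp only: lookup_minus) simp
    then show ?case by blast
  qed
  then show ?thesis by (metis lookup_zero zero_neq_one)
qed

text \<open>No word 0^i 1 is a prefix of another, so these words freely generate an algebra of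
  infinite rank inside the free algebra on the letters 0 and 1.\<close>

definition prefix_code :: "nat list \<Rightarrow> nat list" where
  "prefix_code w = concat (map (\<lambda>i. replicate i 0 @ [1]) w)"

lemma inj_prefix_code: "inj prefix_code"
proof (rule injI)
  have block: "i = j \<and> v = v'" if "replicate i 0 @ 1 # v = replicate j 0 @ 1 # v'" for i j and v v' :: "nat list"
    using that
  proof (induction i arbitrary: j)
    case 0
    then show ?case by (cases j) auto
  next
    case (Suc i)
    then show ?case by (cases j) auto
  qed
  show "w = w'" if "prefix_code w = prefix_code w'" for w w'
    using that
  proof (induction w arbitrary: w')
    case Nil
    then show ?case by (cases w') (auto simp: prefix_code_def)
  next
    case (Cons i w)
    then obtain j v where w': "w' = j # v" by (cases w') (auto simp: prefix_code_def)
    have "i = j \<and> prefix_code w = prefix_code v"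
      by (rule block) (use Cons.prems w' in \<open>simp add: prefix_code_def\<close>)
    then show ?case using Cons.IH[of v] w' by simp
  qed
qed

context tensor_coords
begin

lemma A_alg_commutator_product:
  assumes \<Omega>: "partition_filter \<Omega>" and com: "F.span (com_words m) \<subseteq> filter_ideal \<Omega>"
    and x: "\<forall>i. x i \<in> carrier (A_alg s \<Omega>)"
  shows "commutator_product (A_alg s \<Omega>) x m = \<zero>\<^bsub>A_alg s \<Omega>\<^esub>"
proof -
  interpret A: param_ring scale "A_alg s \<Omega>" "\<lambda>a. I_ideal s \<Omega> +>\<^bsub>tensor_algebra s\<^esub> cls a" "filter_ideal \<Omega>" fmul "Poly_Mapping.single [] 1"
    by (rule param_A_alg[OF \<Omega>])
  obtain a where a: "x = (\<lambda>i. I_ideal s \<Omega> +>\<^bsub>tensor_algebra s\<^esub> cls (a i))" using x by (rule A.carrier_sequence)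
  show ?thesis
    unfolding a A.commutator_product_eq
    using A.pi_zero_iff com_words_product[of a 0 m] com by (auto simp: com_def)
qed

lemma A_alg_PI:
  assumes \<Omega>: "partition_filter \<Omega>" and com: "F.span (com_words m) \<subseteq> filter_ideal \<Omega>"
  shows "PI_algebra (A_alg s \<Omega>)"
proof -
  interpret A: param_ring scale "A_alg s \<Omega>" "\<lambda>a. I_ideal s \<Omega> +>\<^bsub>tensor_algebra s\<^esub> cls a" "filter_ideal \<Omega>" fmul "Poly_Mapping.single [] 1"
    by (rule param_A_alg[OF \<Omega>])
  have "satisfies_identity (A_alg s \<Omega>) (commutator_poly 0 m)"
    unfolding satisfies_identity_def
  proof (intro allI impI)
    fix x :: "nat \<Rightarrow> ('v list \<Rightarrow>\<^sub>0 'f) set set" assume "\<forall>i. x i \<in> carrier (A_alg s \<Omega>)"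
    then obtain a where a: "x = (\<lambda>i. I_ideal s \<Omega> +>\<^bsub>tensor_algebra s\<^esub> cls (a i))" by (rule A.carrier_sequence)
    have "subst_poly a (commutator_poly j m) = foldr (\<lambda>i y. fmul (com (a (2 * i + 1)) (a (2 * i + 2))) y) [j..<j + m] (Poly_Mapping.single [] 1)" for j
    proof -
      have v: "subst_poly a (Poly_Mapping.single [i] 1) = a i" for i
        by (simp add: subst_poly_single fmul_one)
      have "subst_poly a (foldr (\<lambda>i y. fmul (fmul (Poly_Mapping.single [2 * i + 1] 1) (Poly_Mapping.single [2 * i + 2] 1)
        - fmul (Poly_Mapping.single [2 * i + 2] 1) (Poly_Mapping.single [2 * i + 1] 1)) y) l (Poly_Mapping.single [] 1))
        = foldr (\<lambda>i y. fmul (com (a (2 * i + 1)) (a (2 * i + 2))) y) l (Poly_Mapping.single [] 1)" for l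
      proof (induction l)
        case Nil
        show ?case by (simp add: subst_poly_single)
      next
        case (Cons i l)
        then show ?case by (simp only: foldr.simps comp_apply subst_poly_mult subst_poly_diff v com_def)
      qed
      then show ?thesis by (simp add: commutator_poly_def)
    qed
    from this[of 0] show "eval_poly (A_alg s \<Omega>) x (commutator_poly 0 m) = \<zero>\<^bsub>A_alg s \<Omega>\<^esub>"
      unfolding a A.eval_poly_eq subst_poly_def[symmetric]
      using A.pi_zero_iff com_words_product[of a 0 m] com by auto
  qed
  then show ?thesis unfolding PI_algebra_def using commutator_poly_nonzero by blast
qed

text \<open>The variables of an identity are replaced by the words 0^i 1. The value lies in the
  ideal and has no coordinates on words in two letters, but its coordinate at the code of
  \<open>w\<close> is the coefficient of \<open>w\<close>, because the code is injective.\<close>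

lemma not_PI_without_rectangles:
  assumes \<Omega>: "partition_filter \<Omega>" and no: "\<And>c. c > 0 \<Longrightarrow> rect c 2 \<notin> \<Omega>" and k: "2 \<le> k"
  shows "\<not> PI_algebra (A_alg s \<Omega>)"
proof
  interpret A: param_ring scale "A_alg s \<Omega>" "\<lambda>a. I_ideal s \<Omega> +>\<^bsub>tensor_algebra s\<^esub> cls a" "filter_ideal \<Omega>" fmul "Poly_Mapping.single [] 1"
    by (rule param_A_alg[OF \<Omega>])
  assume "PI_algebra (A_alg s \<Omega>)"
  then obtain f :: "nat list \<Rightarrow>\<^sub>0 'f" where f: "f \<noteq> 0" "satisfies_identity (A_alg s \<Omega>) f" unfolding PI_algebra_def by blast
  define a where "a i = bword (replicate i 0 @ [1])" for i
  have fold: "foldr (\<lambda>i y. fmul (a i) y) w (Poly_Mapping.single [] 1) = bword (prefix_code w)" for w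
    by (induction w) (simp_all add: a_def prefix_code_def bword_append del: append_assoc, simp add: bword_def)
  have "eval_poly (A_alg s \<Omega>) (\<lambda>i. I_ideal s \<Omega> +>\<^bsub>tensor_algebra s\<^esub> cls (a i)) f = \<zero>\<^bsub>A_alg s \<Omega>\<^esub>"
    using f(2) unfolding satisfies_identity_def by (auto simp: A.carrier_eq)
  then have J: "subst_poly a f \<in> filter_ideal \<Omega>"
    unfolding A.eval_poly_eq subst_poly_def[symmetric] using A.pi_zero_iff by blast
  obtain w where w: "Poly_Mapping.lookup f w \<noteq> 0" using f(1) by (metis lookup_zero poly_mapping_eqI)
  let ?n = "length (prefix_code w)" and ?u = "(!) (prefix_code w)"
  have two: "set (prefix_code v) \<subseteq> {..<2}" for v by (auto simp: prefix_code_def)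
  have "tcoord ?n (subst_poly a f) ?u = 0"
    by (rule filter_ideal_two_letters[OF \<Omega> no J]) (use two[of w] in \<open>auto simp: subset_iff\<close>)
  moreover have "tcoord ?n (subst_poly a f) ?u =
    (\<Sum>v\<in>Poly_Mapping.keys f. Poly_Mapping.lookup f v * (if v = w then 1 else 0))"
    unfolding subst_poly_def fold tcoord_sum tcoord_scale
  proof (rule sum.cong[OF refl])
    fix v
    have "set (prefix_code v) \<subseteq> {..<k}" using two[of v] k by auto
    then have "tcoord ?n (bword (prefix_code v)) ?u = (if prefix_code v = map ?u [0..<?n] then 1 else 0)"
      by (simp add: bword_def tcoord_single word_coord_basis)
    also have "\<dots> = (if v = w then 1 else 0)" using inj_prefix_code by (simp add: map_nth inj_eq)
    finally show "Poly_Mapping.lookup f v * tcoord ?n (bword (prefix_code v)) ?u = Poly_Mapping.lookup f v * (if v = w then 1 else 0)"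
      by simp
  qed
  moreover have "\<dots> = Poly_Mapping.lookup f w"
    using w by (simp add: if_distrib[of "\<lambda>x. _ * x"] in_keys_iff cong: if_cong)
  ultimately show False using w by simp
qed

end

section \<open>Choice of a basis and the final equivalence\<close>

lemma exists_tensor_coords:
  assumes "finite_dimensional_vector_space s Basis" "vector_space.dim s (UNIV :: 'v::ab_group_add set) = k"
  obtains b coord where "tensor_coords (s :: 'f::field_char_0 \<Rightarrow> 'v \<Rightarrow> 'v) k b coord"
proof -
  interpret finite_dimensional_vector_space s Basis by (rule assms(1))
  have "card Basis = k" using assms(2) dim_UNIV by simp
  then obtain b where b: "bij_betw b {..<k} Basis"
    using ex_bij_betw_nat_finite[OF finite_Basis] by (metis atLeast0LessThan)
  have sp: "v \<in> span Basis" for v using span_Basis by simp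
  define coord where "coord v i = (if i < k then representation Basis v (b i) else 0)" for v i
  have bB: "b i \<in> Basis" if "i < k" for i using b that by (auto simp: bij_betw_def)
  have "tensor_coords s k b coord"
  proof (rule tensor_coords.intro)
    show "vector_space s" by unfold_locales
    show "coord (v + w) i = coord v i + coord w i" for v w i
      by (simp add: coord_def representation_add[OF independent_Basis sp sp])
    show "coord (s c v) i = c * coord v i" for c v i
      by (simp add: coord_def representation_scale[OF independent_Basis sp])
    show "coord v i = 0" if "k \<le> i" for v i using that by (simp add: coord_def)
    show "coord (b i) j = (if i = j then 1 else 0)" if "i < k" for i j
      using that b representation_basis[OF independent_Basis bB[OF that]] by (auto simp: coord_def bij_betw_def inj_on_def)
    fix v
    have "v = (\<Sum>x\<in>Basis. s (representation Basis v x) x)"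
      using sum_representation_eq[OF independent_Basis sp finite_Basis subset_refl] by simp
    also have "\<dots> = (\<Sum>i<k. s (coord v i) (b i))"
      by (rule sum.reindex_bij_betw[OF b, symmetric, THEN trans]) (simp add: coord_def)
    finally show "v = (\<Sum>i<k. s (coord v i) (b i))" .
  qed
  then show ?thesis by (rule that)
qed

theorem theorem6p1:
  fixes s :: "'f::field_char_0 \<Rightarrow> 'v::ab_group_add \<Rightarrow> 'v"
    and Basis :: "'v set"
    and k :: nat
    and \<Omega> :: "(nat \<Rightarrow> nat) set"
  assumes "finite_dimensional_vector_space s Basis"
    and "vector_space.dim s (UNIV :: 'v set) = k"
    and "partition_filter \<Omega>"
    and "\<Omega> \<noteq> {}"
    and "rect 1 (k + 1) \<in> \<Omega>"
  shows "(PI_algebra (A_alg s \<Omega>) \<longleftrightarrow> polynomial_growth s \<Omega>)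
    \<and> (polynomial_growth s \<Omega> \<longleftrightarrow> (\<exists>c>0. rect c 2 \<in> \<Omega>))
    \<and> (\<forall>c>0. \<forall>m. rect c 2 \<in> \<Omega> \<longrightarrow> m = c * (k - 1) + 1 \<longrightarrow>
          (\<forall>x. (\<forall>i. x i \<in> carrier (A_alg s \<Omega>)) \<longrightarrow>
             commutator_product (A_alg s \<Omega>) x m = \<zero>\<^bsub>A_alg s \<Omega>\<^esub>)
        \<and> (\<forall>x\<in>carrier (A_alg s \<Omega>). \<forall>y\<in>carrier (A_alg s \<Omega>).
             commutator (A_alg s \<Omega>) x y [^]\<^bsub>A_alg s \<Omega>\<^esub> m = \<zero>\<^bsub>A_alg s \<Omega>\<^esub>))"
proof -
  obtain b coord where "tensor_coords s k b coord" using exists_tensor_coords[OF assms(1,2)] by blast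
  then interpret tensor_coords s k b coord .
  note \<Omega> = assms(3)
  interpret A: param_ring scale "A_alg s \<Omega>" "\<lambda>a. I_ideal s \<Omega> +>\<^bsub>tensor_algebra s\<^esub> cls a" "filter_ideal \<Omega>" fmul "Poly_Mapping.single [] 1"
    by (rule param_A_alg[OF \<Omega>])
  have com: "F.span (com_words (c * (k - 1) + 1)) \<subseteq> filter_ideal \<Omega>" if "rect c 2 \<in> \<Omega>" "c > 0" for c
    by (rule com_words_filter_ideal[OF \<Omega> assms(5) that])
  have yes: "PI_algebra (A_alg s \<Omega>) \<and> polynomial_growth s \<Omega>" if "\<exists>c>0. rect c 2 \<in> \<Omega>"
    using that com A_alg_PI[OF \<Omega>] polynomial_growth_of_commutators[OF \<Omega>] by metis
  have no: "\<not> PI_algebra (A_alg s \<Omega>) \<and> \<not> polynomial_growth s \<Omega>" if none: "\<not> (\<exists>c>0. rect c 2 \<in> \<Omega>)"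
  proof -
    have rect: "\<And>c. c > 0 \<Longrightarrow> rect c 2 \<notin> \<Omega>" using none by blast
    \<comment> \<open>For k \<le> 1 the given column lies inside the partition (1, 1), which is a
      rectangle with c = 1 and would belong to \<Omega>.\<close>
    have k: "2 \<le> k"
    proof (rule ccontr)
      assume "\<not> 2 \<le> k"
      then have "rect 1 (k + 1) i \<le> rect 1 2 i" for i by (simp add: rect_def)
      then have "rect 1 (k + 1) \<le> rect 1 2" by (rule le_funI)
      moreover have "finite {i. rect 1 2 i \<noteq> 0}"
        by (rule finite_subset[of _ "{..<2}"]) (auto simp: rect_def split: if_splits)
      then have "rect 1 2 \<in> partitions" by (auto simp: partitions_def antimono_def rect_def)
      ultimately have "rect 1 2 \<in> \<Omega>" using \<Omega> assms(5) by (auto simp: partition_filter_def)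
      then show False using rect[of 1] by simp
    qed
    have "\<not> polynomial_growth s \<Omega>"
    proof
      assume "polynomial_growth s \<Omega>"
      then obtain p :: "real poly" where p: "\<And>n. \<exists>d. has_dim (A_comp s \<Omega> n) d \<and> real d \<le> poly p (real n)"
        unfolding polynomial_growth_def by blast
      obtain n where n: "poly p (real n) < 2 ^ n" using poly_less_exponential by blast
      obtain d where d: "has_dim (A_comp s \<Omega> n) d" "real d \<le> poly p (real n)" using p by blast
      have "2 ^ n \<le> real d" using two_letters_lower_bound[OF \<Omega> rect k d(1)] by simp
      then show False using n d(2) by linarith
    qed
    then show ?thesis using not_PI_without_rectangles[OF \<Omega> rect k] by blast
  qed
  have ids: "(\<forall>x. (\<forall>i. x i \<in> carrier (A_alg s \<Omega>)) \<longrightarrow>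
             commutator_product (A_alg s \<Omega>) x (c * (k - 1) + 1) = \<zero>\<^bsub>A_alg s \<Omega>\<^esub>)
        \<and> (\<forall>x\<in>carrier (A_alg s \<Omega>). \<forall>y\<in>carrier (A_alg s \<Omega>).
             commutator (A_alg s \<Omega>) x y [^]\<^bsub>A_alg s \<Omega>\<^esub> (c * (k - 1) + 1) = \<zero>\<^bsub>A_alg s \<Omega>\<^esub>)"
    if "c > 0" "rect c 2 \<in> \<Omega>" for c
  proof (intro conjI allI impI ballI)
    note cp = A_alg_commutator_product[OF \<Omega> com[OF that(2,1)]]
    show "commutator_product (A_alg s \<Omega>) x (c * (k - 1) + 1) = \<zero>\<^bsub>A_alg s \<Omega>\<^esub>"
      if "\<forall>i. x i \<in> carrier (A_alg s \<Omega>)" for x by (rule cp[OF that])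
    show "commutator (A_alg s \<Omega>) x y [^]\<^bsub>A_alg s \<Omega>\<^esub> (c * (k - 1) + 1) = \<zero>\<^bsub>A_alg s \<Omega>\<^esub>"
      if "x \<in> carrier (A_alg s \<Omega>)" "y \<in> carrier (A_alg s \<Omega>)" for x y
      unfolding A.commutator_power_eq[OF that] by (rule cp) (use that in auto)
  qed
  show ?thesis using yes no ids by blast
qed

end
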